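(* Let $\Bbbk$ be a field of characteristic zero and let $V=V_0\oplus V_1$ be a Novikov superalgebra over $\Bbbk$ with product $(\cdot\circ\cdot)$. Then the GD-superalgebra $V^{(-)}$, i.e. the space $V$ with the product $(\cdot\circ\cdot)$ and the bracket $[a,b]=a\circ b-(-1)^{|a||b|}b\circ a$ (for homogeneous $a,b\in V$), is special.
   Context: All spaces are over $\Bbbk$; $|a|\in\{0,1\}$ denotes the parity of a homogeneous element $a$; all operations respect the $\mathbb Z_2$-grading. A Novikov superalgebra is a $\mathbb Z_2$-graded space $V=V_0\oplus V_1$ with a bilinear grading-respecting product $\circ$ such that for all homogeneous $a,b,c$: $(a\circ b)\circ c-a\circ(b\circ c)=(-1)^{|a||b|}\big((b\circ a)\circ c-b\circ(a\circ c)\big)$ and $(a\circ b)\circ c=(-1)^{|b||c|}(a\circ c)\circ b$. A GD-superalgebra (Gelfand--Dorfman superalgebra) is a $\mathbb Z_2$-graded space $V$ with two bilinear grading-respecting operations $(\cdot\circ\cdot)$, $[\cdot,\cdot]$ such that $(V,\circ)$ is a Novikov superalgebra, $(V,[\cdot,\cdot])$ is a Lie superalgebra, and for all homogeneous $a,b,c\in V$ $$[a\circ b,c]-a\circ[b,c]+[a,b]\circ c+(-1)^{|a||b|}[b,a\circ c]-(-1)^{|b||c|}[a,c]\circ b=0.$$ It is known that for every Novikov superalgebra $V$ the structure $V^{(-)}$ is a GD-superalgebra. A Poisson superalgebra is an associative supercommutative superalgebra $P=P_0\oplus P_1$ with a bilinear grading-respecting bracket $\{\cdot,\cdot\}$ such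 that for homogeneous $a,b,c$: $\{a,b\}=-(-1)^{|a||b|}\{b,a\}$, $\{a,\{b,c\}\}-(-1)^{|a||b|}\{b,\{a,c\}\}=\{\{a,b\},c\}$, $\{a,bc\}=\{a,b\}c+(-1)^{|a||b|}b\{a,c\}$. An even derivation of $P$ is a linear map $d:P\to P$ with $d(P_i)\subseteq P_i$, $d(ab)=d(a)b+ad(b)$, $d\{a,b\}=\{d(a),b\}+\{a,d(b)\}$. Given such $d$, $P^{(d)}$ denotes the GD-superalgebra on the space $P$ with operations $a\circ b=ad(b)$, $[a,b]=\{a,b\}$. A GD-superalgebra $V$ is special if there exist a Poisson superalgebra $P$ and an even derivation $d$ of $P$ such that $V\subseteq P^{(d)}$, i.e. there is an injective even linear map $V\to P$ that preserves both operations $\circ$ and $[\cdot,\cdot]$. *)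

theory Defs
  imports "HOL-Algebra.Module" "HOL-Algebra.AbelCoset" "HOL-Library.Z2"
begin

section \<open>Superspaces\<close>

text \<open>
  Scalars form a ring record \<open>K\<close>; vector spaces over a field \<open>K\<close> are modules over \<open>K\<close>.
  The locale \<^locale>\<open>module\<close> says nothing about the fields \<open>mult\<close> and \<open>one\<close> of its
  record. Here \<open>mult\<close> holds the product under consideration (the Novikov product, or the
  Poisson product) and \<open>one\<close> is never used: no algebra is assumed to be unital.
  Parities are elements of the field \<^typ>\<open>bit\<close> of two elements.
\<close>

definition zero_characteristic :: "('k, 'c) ring_scheme \<Rightarrow> bool" where
  "zero_characteristic K \<longleftrightarrow> (\<forall>n::nat. n > 0 \<longrightarrow> [n] \<cdot>\<^bsub>K\<^esub> \<one>\<^bsub>K\<^esub> \<noteq> \<zero>\<^bsub>K\<^esub>)"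

record ('k, 'v) superalgebra = "('k, 'v) module" +
  part :: "bit \<Rightarrow> 'v set"

record ('k, 'v) bracket_superalgebra = "('k, 'v) superalgebra" +
  bracket :: "'v \<Rightarrow> 'v \<Rightarrow> 'v"  (\<open>\<lbrace>_,/ _\<rbrace>\<index>\<close>)

definition superspace :: "('k, 'c) ring_scheme \<Rightarrow> ('k, 'v, 'm) superalgebra_scheme \<Rightarrow> bool" where
  "superspace K V \<longleftrightarrow>
     module K V \<and> (\<forall>i. submodule (part V i) K V) \<and>
     part V 0 \<inter> part V 1 = {\<zero>\<^bsub>V\<^esub>} \<and> part V 0 <+>\<^bsub>V\<^esub> part V 1 = carrier V"

text \<open>The component of parity \<open>i\<close> of \<open>a\<close>.\<close>

definition component :: "('k, 'v, 'm) superalgebra_scheme \<Rightarrow> bit \<Rightarrow> 'v \<Rightarrow> 'v" where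
  "component V i a = (THE x. x \<in> part V i \<and> (\<exists>y\<in>part V (i + 1). a = x \<oplus>\<^bsub>V\<^esub> y))"

lemma superspace_parts:
  assumes "superspace K V"
  shows "abelian_group V"
    and "x \<in> part V i \<Longrightarrow> x \<in> carrier V"
    and "\<zero>\<^bsub>V\<^esub> \<in> part V i"
    and "x \<in> part V i \<Longrightarrow> y \<in> part V i \<Longrightarrow> x \<oplus>\<^bsub>V\<^esub> y \<in> part V i"
    and "x \<in> part V i \<Longrightarrow> \<ominus>\<^bsub>V\<^esub> x \<in> part V i"
    and "k \<in> carrier K \<Longrightarrow> x \<in> part V i \<Longrightarrow> k \<odot>\<^bsub>V\<^esub> x \<in> part V i"
    and "x \<in> part V i \<Longrightarrow> x \<in> part V (i + 1) \<Longrightarrow> x = \<zero>\<^bsub>V\<^esub>"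
    and "a \<in> carrier V \<Longrightarrow> \<exists>x\<in>part V i. \<exists>y\<in>part V (i + 1). a = x \<oplus>\<^bsub>V\<^esub> y"
proof -
  have m: "module K V" and sub: "\<And>i. submodule (part V i) K V"
    and int: "part V 0 \<inter> part V 1 = {\<zero>\<^bsub>V\<^esub>}" and sum: "part V 0 <+>\<^bsub>V\<^esub> part V 1 = carrier V"
    using assms by (auto simp: superspace_def)
  show ab: "abelian_group V" using m by (simp add: module_def)
  show "x \<in> part V i \<Longrightarrow> x \<in> carrier V" using module.submoduleE(1)[OF m sub] by blast
  then have car: "\<And>x i. x \<in> part V i \<Longrightarrow> x \<in> carrier V"
    using module.submoduleE(1)[OF m sub] by blast
  show "\<zero>\<^bsub>V\<^esub> \<in> part V i" using int by (cases i) auto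
  show "x \<in> part V i \<Longrightarrow> y \<in> part V i \<Longrightarrow> x \<oplus>\<^bsub>V\<^esub> y \<in> part V i"
    using module.submoduleE(5)[OF m sub] by blast
  show "x \<in> part V i \<Longrightarrow> \<ominus>\<^bsub>V\<^esub> x \<in> part V i"
    using module.submoduleE(3)[OF m sub] by blast
  show "k \<in> carrier K \<Longrightarrow> x \<in> part V i \<Longrightarrow> k \<odot>\<^bsub>V\<^esub> x \<in> part V i"
    using module.submoduleE(4)[OF m sub] by blast
  show "x \<in> part V i \<Longrightarrow> x \<in> part V (i + 1) \<Longrightarrow> x = \<zero>\<^bsub>V\<^esub>"
    using int by (cases i) auto
  show "\<exists>x\<in>part V i. \<exists>y\<in>part V (i + 1). a = x \<oplus>\<^bsub>V\<^esub> y" if a: "a \<in> carrier V"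
  proof -
    obtain x y where xy: "x \<in> part V 0" "y \<in> part V 1" "a = x \<oplus>\<^bsub>V\<^esub> y"
      using a sum unfolding set_add_def' by blast
    then have "a = y \<oplus>\<^bsub>V\<^esub> x"
      using abelian_monoid.a_comm[OF abelian_group.axioms(1)[OF ab]] car by metis
    moreover have "(1 :: bit) + 1 = 0" by simp
    ultimately show ?thesis using xy by (cases i) (metis add_0, metis)
  qed
qed

lemma component_eqI:
  assumes V: "superspace K V" and "x \<in> part V i" "y \<in> part V (i + 1)" "a = x \<oplus>\<^bsub>V\<^esub> y"
  shows "component V i a = x"
  unfolding component_def
proof (rule the_equality)
  show "x \<in> part V i \<and> (\<exists>y\<in>part V (i + 1). a = x \<oplus>\<^bsub>V\<^esub> y)" using assms by blast
next
  interpret abelian_group V by (rule superspace_parts(1)[OF V])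
  note P = superspace_parts[OF V]
  fix x' assume "x' \<in> part V i \<and> (\<exists>y\<in>part V (i + 1). a = x' \<oplus>\<^bsub>V\<^esub> y)"
  then obtain y' where x': "x' \<in> part V i" and y': "y' \<in> part V (i + 1)" "a = x' \<oplus>\<^bsub>V\<^esub> y'" by blast
  have c: "x \<in> carrier V" "y \<in> carrier V" "x' \<in> carrier V" "y' \<in> carrier V"
    using assms x' y' P(2) by auto
  have eq: "x' \<oplus>\<^bsub>V\<^esub> y' = x \<oplus>\<^bsub>V\<^esub> y" using assms(4) y'(2) by simp
  have "y = \<ominus>\<^bsub>V\<^esub> x \<oplus>\<^bsub>V\<^esub> (x' \<oplus>\<^bsub>V\<^esub> y')" using c eq by (simp add: r_neg1)
  then have "y \<oplus>\<^bsub>V\<^esub> \<ominus>\<^bsub>V\<^esub> y' = (\<ominus>\<^bsub>V\<^esub> x \<oplus>\<^bsub>V\<^esub> x') \<oplus>\<^bsub>V\<^esub> (y' \<oplus>\<^bsub>V\<^esub> \<ominus>\<^bsub>V\<^esub> y')" using c by (simp add: a_assoc)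
  then have "x' \<oplus>\<^bsub>V\<^esub> \<ominus>\<^bsub>V\<^esub> x = y \<oplus>\<^bsub>V\<^esub> \<ominus>\<^bsub>V\<^esub> y'" using c by (simp add: r_neg a_comm)
  moreover have "x' \<oplus>\<^bsub>V\<^esub> \<ominus>\<^bsub>V\<^esub> x \<in> part V i" using assms x' P by blast
  moreover have "y \<oplus>\<^bsub>V\<^esub> \<ominus>\<^bsub>V\<^esub> y' \<in> part V (i + 1)" using assms y' P by blast
  ultimately have "x' \<oplus>\<^bsub>V\<^esub> \<ominus>\<^bsub>V\<^esub> x = \<zero>\<^bsub>V\<^esub>" using P(7) by metis
  then show "x' = x" using c by (metis minus_equality minus_minus a_inv_closed)
qed

lemma component_part:
  assumes V: "superspace K V" and a: "a \<in> carrier V"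
  shows "component V i a \<in> part V i"
  using superspace_parts(8)[OF V a] component_eqI[OF V] by metis

lemma component_sum:
  assumes V: "superspace K V" and a: "a \<in> carrier V"
  shows "a = component V 0 a \<oplus>\<^bsub>V\<^esub> component V 1 a"
proof -
  interpret abelian_group V by (rule superspace_parts(1)[OF V])
  obtain x y where xy: "x \<in> part V 0" "y \<in> part V 1" "a = x \<oplus>\<^bsub>V\<^esub> y"
    using superspace_parts(8)[OF V a, of 0] by auto
  have "component V 0 a = x" by (rule component_eqI[OF V]) (use xy in auto)
  moreover have "component V 1 a = y"
  proof (rule component_eqI[OF V])
    show "a = y \<oplus>\<^bsub>V\<^esub> x" using xy superspace_parts(2)[OF V] a_comm by metis
  qed (use xy in auto)
  ultimately show ?thesis using xy by simp
qed

lemma component_homogeneous: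
  assumes V: "superspace K V" and x: "x \<in> part V i"
  shows "component V j x = (if j = i then x else \<zero>\<^bsub>V\<^esub>)"
proof -
  interpret abelian_group V by (rule superspace_parts(1)[OF V])
  note P = superspace_parts[OF V]
  show ?thesis
  proof (cases "j = i")
    case True
    have "component V i x = x"
      by (rule component_eqI[OF V x P(3)]) (use x P(2) in auto)
    with True show ?thesis by simp
  next
    case False
    then have ji: "j + 1 = i" by (cases i; cases j) auto
    have "component V j x = \<zero>\<^bsub>V\<^esub>"
      by (rule component_eqI[OF V P(3), of x]) (use x P(2) ji in auto)
    with False show ?thesis by simp
  qed
qed

text \<open>The scalar multiple \<open>(-1)\<^sup>i\<^sup>j x\<close>.\<close>

definition koszul :: "('k, 'v, 'm) superalgebra_scheme \<Rightarrow> bit \<Rightarrow> bit \<Rightarrow> 'v \<Rightarrow> 'v" where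
  "koszul V i j x = (if i * j = 0 then x else \<ominus>\<^bsub>V\<^esub> x)"

definition bilinear_op ::
  "('k, 'c) ring_scheme \<Rightarrow> ('k, 'v, 'm) superalgebra_scheme \<Rightarrow> ('v \<Rightarrow> 'v \<Rightarrow> 'v) \<Rightarrow> bool" where
  "bilinear_op K V f \<longleftrightarrow>
     (\<forall>x\<in>carrier V. \<forall>y\<in>carrier V. f x y \<in> carrier V) \<and>
     (\<forall>x\<in>carrier V. \<forall>y\<in>carrier V. \<forall>z\<in>carrier V.
        f (x \<oplus>\<^bsub>V\<^esub> y) z = f x z \<oplus>\<^bsub>V\<^esub> f y z \<and> f z (x \<oplus>\<^bsub>V\<^esub> y) = f z x \<oplus>\<^bsub>V\<^esub> f z y) \<and>
     (\<forall>k\<in>carrier K. \<forall>x\<in>carrier V. \<forall>y\<in>carrier V.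
        f (k \<odot>\<^bsub>V\<^esub> x) y = k \<odot>\<^bsub>V\<^esub> f x y \<and> f x (k \<odot>\<^bsub>V\<^esub> y) = k \<odot>\<^bsub>V\<^esub> f x y)"

definition graded_op ::
  "('k, 'c) ring_scheme \<Rightarrow> ('k, 'v, 'm) superalgebra_scheme \<Rightarrow> ('v \<Rightarrow> 'v \<Rightarrow> 'v) \<Rightarrow> bool" where
  "graded_op K V f \<longleftrightarrow>
     bilinear_op K V f \<and> (\<forall>i j. \<forall>x\<in>part V i. \<forall>y\<in>part V j. f x y \<in> part V (i + j))"

definition even_linear ::
  "('k, 'c) ring_scheme \<Rightarrow> ('k, 'v, 'm) superalgebra_scheme \<Rightarrow> ('k, 'w, 'n) superalgebra_scheme
    \<Rightarrow> ('v \<Rightarrow> 'w) \<Rightarrow> bool" where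
  "even_linear K V W f \<longleftrightarrow>
     f \<in> carrier V \<rightarrow> carrier W \<and>
     (\<forall>x\<in>carrier V. \<forall>y\<in>carrier V. f (x \<oplus>\<^bsub>V\<^esub> y) = f x \<oplus>\<^bsub>W\<^esub> f y) \<and>
     (\<forall>k\<in>carrier K. \<forall>x\<in>carrier V. f (k \<odot>\<^bsub>V\<^esub> x) = k \<odot>\<^bsub>W\<^esub> f x) \<and>
     (\<forall>i. f ` part V i \<subseteq> part W i)"


section \<open>Novikov, Lie, Gelfand--Dorfman and Poisson superalgebras\<close>

definition novikov_superalgebra ::
  "('k, 'c) ring_scheme \<Rightarrow> ('k, 'v, 'm) superalgebra_scheme \<Rightarrow> bool" where
  "novikov_superalgebra K V \<longleftrightarrow>
     superspace K V \<and> graded_op K V (mult V) \<and>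
     (\<forall>i j l. \<forall>a\<in>part V i. \<forall>b\<in>part V j. \<forall>c\<in>part V l.
        (a \<otimes>\<^bsub>V\<^esub> b) \<otimes>\<^bsub>V\<^esub> c \<ominus>\<^bsub>V\<^esub> a \<otimes>\<^bsub>V\<^esub> (b \<otimes>\<^bsub>V\<^esub> c) =
          koszul V i j ((b \<otimes>\<^bsub>V\<^esub> a) \<otimes>\<^bsub>V\<^esub> c \<ominus>\<^bsub>V\<^esub> b \<otimes>\<^bsub>V\<^esub> (a \<otimes>\<^bsub>V\<^esub> c)) \<and>
        (a \<otimes>\<^bsub>V\<^esub> b) \<otimes>\<^bsub>V\<^esub> c = koszul V j l ((a \<otimes>\<^bsub>V\<^esub> c) \<otimes>\<^bsub>V\<^esub> b))"

definition lie_superalgebra ::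
  "('k, 'c) ring_scheme \<Rightarrow> ('k, 'v, 'm) bracket_superalgebra_scheme \<Rightarrow> bool" where
  "lie_superalgebra K V \<longleftrightarrow>
     superspace K V \<and> graded_op K V (bracket V) \<and>
     (\<forall>i j. \<forall>a\<in>part V i. \<forall>b\<in>part V j. \<lbrace>a, b\<rbrace>\<^bsub>V\<^esub> = \<ominus>\<^bsub>V\<^esub> koszul V i j \<lbrace>b, a\<rbrace>\<^bsub>V\<^esub>) \<and>
     (\<forall>i j l. \<forall>a\<in>part V i. \<forall>b\<in>part V j. \<forall>c\<in>part V l.
        \<lbrace>a, \<lbrace>b, c\<rbrace>\<^bsub>V\<^esub>\<rbrace>\<^bsub>V\<^esub> \<ominus>\<^bsub>V\<^esub> koszul V i j \<lbrace>b, \<lbrace>a, c\<rbrace>\<^bsub>V\<^esub>\<rbrace>\<^bsub>V\<^esub> = \<lbrace>\<lbrace>a, b\<rbrace>\<^bsub>V\<^esub>, c\<rbrace>\<^bsub>V\<^esub>)"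

definition gd_superalgebra ::
  "('k, 'c) ring_scheme \<Rightarrow> ('k, 'v, 'm) bracket_superalgebra_scheme \<Rightarrow> bool" where
  "gd_superalgebra K V \<longleftrightarrow>
     novikov_superalgebra K V \<and> lie_superalgebra K V \<and>
     (\<forall>i j l. \<forall>a\<in>part V i. \<forall>b\<in>part V j. \<forall>c\<in>part V l.
        \<lbrace>a \<otimes>\<^bsub>V\<^esub> b, c\<rbrace>\<^bsub>V\<^esub> \<ominus>\<^bsub>V\<^esub> a \<otimes>\<^bsub>V\<^esub> \<lbrace>b, c\<rbrace>\<^bsub>V\<^esub> \<oplus>\<^bsub>V\<^esub> \<lbrace>a, b\<rbrace>\<^bsub>V\<^esub> \<otimes>\<^bsub>V\<^esub> c
          \<oplus>\<^bsub>V\<^esub> koszul V i j \<lbrace>b, a \<otimes>\<^bsub>V\<^esub> c\<rbrace>\<^bsub>V\<^esub> \<ominus>\<^bsub>V\<^esub> koszul V j l (\<lbrace>a, c\<rbrace>\<^bsub>V\<^esub> \<otimes>\<^bsub>V\<^esub> b) = \<zero>\<^bsub>V\<^esub>)"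

definition poisson_superalgebra ::
  "('k, 'c) ring_scheme \<Rightarrow> ('k, 'v, 'm) bracket_superalgebra_scheme \<Rightarrow> bool" where
  "poisson_superalgebra K P \<longleftrightarrow>
     superspace K P \<and> graded_op K P (mult P) \<and> graded_op K P (bracket P) \<and>
     (\<forall>a\<in>carrier P. \<forall>b\<in>carrier P. \<forall>c\<in>carrier P.
        (a \<otimes>\<^bsub>P\<^esub> b) \<otimes>\<^bsub>P\<^esub> c = a \<otimes>\<^bsub>P\<^esub> (b \<otimes>\<^bsub>P\<^esub> c)) \<and>
     (\<forall>i j. \<forall>a\<in>part P i. \<forall>b\<in>part P j.
        a \<otimes>\<^bsub>P\<^esub> b = koszul P i j (b \<otimes>\<^bsub>P\<^esub> a) \<and>
        \<lbrace>a, b\<rbrace>\<^bsub>P\<^esub> = \<ominus>\<^bsub>P\<^esub> koszul P i j \<lbrace>b, a\<rbrace>\<^bsub>P\<^esub>) \<and>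
     (\<forall>i j l. \<forall>a\<in>part P i. \<forall>b\<in>part P j. \<forall>c\<in>part P l.
        \<lbrace>a, \<lbrace>b, c\<rbrace>\<^bsub>P\<^esub>\<rbrace>\<^bsub>P\<^esub> \<ominus>\<^bsub>P\<^esub> koszul P i j \<lbrace>b, \<lbrace>a, c\<rbrace>\<^bsub>P\<^esub>\<rbrace>\<^bsub>P\<^esub> = \<lbrace>\<lbrace>a, b\<rbrace>\<^bsub>P\<^esub>, c\<rbrace>\<^bsub>P\<^esub> \<and>
        \<lbrace>a, b \<otimes>\<^bsub>P\<^esub> c\<rbrace>\<^bsub>P\<^esub> = \<lbrace>a, b\<rbrace>\<^bsub>P\<^esub> \<otimes>\<^bsub>P\<^esub> c \<oplus>\<^bsub>P\<^esub> koszul P i j (b \<otimes>\<^bsub>P\<^esub> \<lbrace>a, c\<rbrace>\<^bsub>P\<^esub>))"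

definition even_derivation ::
  "('k, 'c) ring_scheme \<Rightarrow> ('k, 'v, 'm) bracket_superalgebra_scheme \<Rightarrow> ('v \<Rightarrow> 'v) \<Rightarrow> bool" where
  "even_derivation K P d \<longleftrightarrow>
     even_linear K P P d \<and>
     (\<forall>a\<in>carrier P. \<forall>b\<in>carrier P.
        d (a \<otimes>\<^bsub>P\<^esub> b) = d a \<otimes>\<^bsub>P\<^esub> b \<oplus>\<^bsub>P\<^esub> a \<otimes>\<^bsub>P\<^esub> d b \<and>
        d \<lbrace>a, b\<rbrace>\<^bsub>P\<^esub> = \<lbrace>d a, b\<rbrace>\<^bsub>P\<^esub> \<oplus>\<^bsub>P\<^esub> \<lbrace>a, d b\<rbrace>\<^bsub>P\<^esub>)"


section \<open>The constructions of Gelfand--Dorfman superalgebras\<close>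

text \<open>The superalgebra \<open>P\<^sup>(\<^sup>d\<^sup>)\<close>: the bracket of \<open>P\<close>, and the product \<open>a d(b)\<close>.\<close>

definition derived_gd ::
  "('k, 'v, 'm) bracket_superalgebra_scheme \<Rightarrow> ('v \<Rightarrow> 'v) \<Rightarrow>
    ('k, 'v, 'm) bracket_superalgebra_scheme" where
  "derived_gd P d = P\<lparr>mult := \<lambda>a b. a \<otimes>\<^bsub>P\<^esub> d b\<rparr>"

text \<open>
  The supercommutator is given by \<open>x y - (-1)\<^sup>i\<^sup>j y x\<close> on homogeneous \<open>x\<close>, \<open>y\<close> of
  parities \<open>i\<close>, \<open>j\<close>, and by bilinearity in general.
\<close>

definition hom_commutator ::
  "('k, 'v, 'm) superalgebra_scheme \<Rightarrow> bit \<Rightarrow> bit \<Rightarrow> 'v \<Rightarrow> 'v \<Rightarrow> 'v" where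
  "hom_commutator V i j x y = x \<otimes>\<^bsub>V\<^esub> y \<ominus>\<^bsub>V\<^esub> koszul V i j (y \<otimes>\<^bsub>V\<^esub> x)"

definition supercommutator :: "('k, 'v, 'm) superalgebra_scheme \<Rightarrow> 'v \<Rightarrow> 'v \<Rightarrow> 'v" where
  "supercommutator V a b =
     hom_commutator V 0 0 (component V 0 a) (component V 0 b) \<oplus>\<^bsub>V\<^esub>
     hom_commutator V 0 1 (component V 0 a) (component V 1 b) \<oplus>\<^bsub>V\<^esub>
     hom_commutator V 1 0 (component V 1 a) (component V 0 b) \<oplus>\<^bsub>V\<^esub>
     hom_commutator V 1 1 (component V 1 a) (component V 1 b)"

lemma bilinear_op_zero:
  assumes "superspace K V" "bilinear_op K V f" "x \<in> carrier V"
  shows "f \<zero>\<^bsub>V\<^esub> x = \<zero>\<^bsub>V\<^esub>" "f x \<zero>\<^bsub>V\<^esub> = \<zero>\<^bsub>V\<^esub>"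
proof -
  interpret abelian_group V by (rule superspace_parts(1)[OF assms(1)])
  have c: "f \<zero>\<^bsub>V\<^esub> x \<in> carrier V" "f x \<zero>\<^bsub>V\<^esub> \<in> carrier V"
    using assms by (auto simp: bilinear_op_def)
  have "f \<zero>\<^bsub>V\<^esub> x \<oplus>\<^bsub>V\<^esub> f \<zero>\<^bsub>V\<^esub> x = f \<zero>\<^bsub>V\<^esub> x" "f x \<zero>\<^bsub>V\<^esub> \<oplus>\<^bsub>V\<^esub> f x \<zero>\<^bsub>V\<^esub> = f x \<zero>\<^bsub>V\<^esub>"
    using assms unfolding bilinear_op_def by (metis l_zero zero_closed)+
  with c show "f \<zero>\<^bsub>V\<^esub> x = \<zero>\<^bsub>V\<^esub>" "f x \<zero>\<^bsub>V\<^esub> = \<zero>\<^bsub>V\<^esub>"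
    by (metis add.l_cancel_one)+
qed

lemma supercommutator_homogeneous:
  assumes V: "superspace K V" and g: "graded_op K V (mult V)"
    and x: "x \<in> part V i" and y: "y \<in> part V j"
  shows "supercommutator V x y = x \<otimes>\<^bsub>V\<^esub> y \<ominus>\<^bsub>V\<^esub> koszul V i j (y \<otimes>\<^bsub>V\<^esub> x)"
proof -
  interpret abelian_group V by (rule superspace_parts(1)[OF V])
  have b: "bilinear_op K V (mult V)" using g by (simp add: graded_op_def)
  have c: "x \<in> carrier V" "y \<in> carrier V" using x y superspace_parts(2)[OF V] by auto
  have m: "x \<otimes>\<^bsub>V\<^esub> y \<in> carrier V" "y \<otimes>\<^bsub>V\<^esub> x \<in> carrier V"
    using b c by (auto simp: bilinear_op_def)
  note z = bilinear_op_zero[OF V b]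
  have n: "\<ominus>\<^bsub>V\<^esub> \<zero>\<^bsub>V\<^esub> = \<zero>\<^bsub>V\<^esub>" by (rule minus_equality) simp_all
  show ?thesis
    using c m
    by (cases i; cases j)
       (simp_all add: supercommutator_def hom_commutator_def koszul_def z n minus_eq
          component_homogeneous[OF V x] component_homogeneous[OF V y])
qed

text \<open>The superalgebra \<open>V\<^sup>(\<^sup>-\<^sup>)\<close>.\<close>

definition commutator_gd :: "('k, 'v) superalgebra \<Rightarrow> ('k, 'v) bracket_superalgebra" where
  "commutator_gd V =
     \<lparr>carrier = carrier V, mult = mult V, one = one V, zero = zero V, add = add V,
      smult = smult V, part = part V, bracket = supercommutator V\<rparr>"


section \<open>Special Gelfand--Dorfman superalgebras\<close>

definition gd_embedding ::
  "('k, 'c) ring_scheme \<Rightarrow> ('k, 'v, 'm) bracket_superalgebra_scheme \<Rightarrow>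
    ('k, 'w, 'n) bracket_superalgebra_scheme \<Rightarrow> ('v \<Rightarrow> 'w) \<Rightarrow> bool" where
  "gd_embedding K V W f \<longleftrightarrow>
     even_linear K V W f \<and> inj_on f (carrier V) \<and>
     (\<forall>a\<in>carrier V. \<forall>b\<in>carrier V.
        f (a \<otimes>\<^bsub>V\<^esub> b) = f a \<otimes>\<^bsub>W\<^esub> f b \<and> f \<lbrace>a, b\<rbrace>\<^bsub>V\<^esub> = \<lbrace>f a, f b\<rbrace>\<^bsub>W\<^esub>)"

text \<open>
  A definition cannot quantify over all types, so the Poisson superalgebras \<open>P\<close> in the
  definition of speciality have their carriers in one type. Nothing is lost: only the
  subalgebra of \<open>P\<close> generated by \<open>V\<close> under the operations of \<open>P\<close>, the derivation and the
  parity projections matters, its elements are values of expressions over \<open>V\<close>, and an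
  element can be replaced by the set of all expressions that evaluate to it. Theorem
  \<open>specialI\<close> below is this reduction: it admits a \<open>P\<close> over an arbitrary type.
\<close>

datatype ('k, 'v) dp_expr =
    Gen 'v
  | Zero
  | Add "('k, 'v) dp_expr" "('k, 'v) dp_expr"
  | Scale 'k "('k, 'v) dp_expr"
  | Mult "('k, 'v) dp_expr" "('k, 'v) dp_expr"
  | Bracket "('k, 'v) dp_expr" "('k, 'v) dp_expr"
  | Der "('k, 'v) dp_expr"
  | Proj bit "('k, 'v) dp_expr"

definition special ::
  "('k, 'c) ring_scheme \<Rightarrow> ('k, 'v) bracket_superalgebra \<Rightarrow> bool" where
  "special K V \<longleftrightarrow>
     gd_superalgebra K V \<and>
     (\<exists>(P :: ('k, ('k, 'v) dp_expr set) bracket_superalgebra) d f.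
        poisson_superalgebra K P \<and> even_derivation K P d \<and> gd_embedding K V (derived_gd P d) f)"

primrec dp_eval ::
  "('k, 'c) ring_scheme \<Rightarrow> 'v set \<Rightarrow> ('k, 'p, 'm) bracket_superalgebra_scheme \<Rightarrow> ('p \<Rightarrow> 'p) \<Rightarrow>
    ('v \<Rightarrow> 'p) \<Rightarrow> ('k, 'v) dp_expr \<Rightarrow> 'p" where
  "dp_eval K A P d f (Gen v) = (if v \<in> A then f v else \<zero>\<^bsub>P\<^esub>)"
| "dp_eval K A P d f Zero = \<zero>\<^bsub>P\<^esub>"
| "dp_eval K A P d f (Add s t) = dp_eval K A P d f s \<oplus>\<^bsub>P\<^esub> dp_eval K A P d f t"
| "dp_eval K A P d f (Scale k t) =
     (if k \<in> carrier K then k \<odot>\<^bsub>P\<^esub> dp_eval K A P d f t else \<zero>\<^bsub>P\<^esub>)"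
| "dp_eval K A P d f (Mult s t) = dp_eval K A P d f s \<otimes>\<^bsub>P\<^esub> dp_eval K A P d f t"
| "dp_eval K A P d f (Bracket s t) = \<lbrace>dp_eval K A P d f s, dp_eval K A P d f t\<rbrace>\<^bsub>P\<^esub>"
| "dp_eval K A P d f (Der t) = d (dp_eval K A P d f t)"
| "dp_eval K A P d f (Proj i t) = component P i (dp_eval K A P d f t)"

theorem specialI:
  fixes K :: "('k, 'c) ring_scheme" and V :: "('k, 'v) bracket_superalgebra"
    and P :: "('k, 'p, 'm) bracket_superalgebra_scheme"
  assumes V: "gd_superalgebra K V" and P: "poisson_superalgebra K P"
    and d: "even_derivation K P d" and f: "gd_embedding K V (derived_gd P d) f"
  shows "special K V"
proof -
  have SP: "superspace K P" and SV: "superspace K V"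
    using P V by (auto simp: poisson_superalgebra_def gd_superalgebra_def novikov_superalgebra_def)
  interpret module K P using SP by (simp add: superspace_def)
  note S = superspace_parts[OF SP]
  have bm: "bilinear_op K P (mult P)" and bb: "bilinear_op K P (bracket P)"
    using P by (auto simp: poisson_superalgebra_def graded_op_def)
  have dl: "even_linear K P P d" using d by (simp add: even_derivation_def)
  have fl: "even_linear K V (derived_gd P d) f" using f by (simp add: gd_embedding_def)
  have fc: "f v \<in> carrier P" if "v \<in> carrier V" for v
    using fl that by (auto simp: even_linear_def derived_gd_def)
  define ev where "ev = dp_eval K (carrier V) P d f"
  have ec: "ev t \<in> carrier P" for t
    unfolding ev_def
  proof (induction t)
    case (Proj i t)
    then show ?case using component_part[OF SP] S(2) by auto
  qed (use fc bm bb dl in \<open>auto simp: bilinear_op_def even_linear_def\<close>)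
  define Q where "Q = range ev"
  have Qc: "x \<in> carrier P" if "x \<in> Q" for x using that ec by (auto simp: Q_def)
  have Qf: "f v \<in> Q" if "v \<in> carrier V" for v
    using that rangeI[of ev "Gen v"] by (simp add: Q_def ev_def)
  have Qz: "\<zero>\<^bsub>P\<^esub> \<in> Q" using rangeI[of ev "Zero"] by (simp add: Q_def ev_def)
  have Qa: "x \<oplus>\<^bsub>P\<^esub> y \<in> Q" if "x \<in> Q" "y \<in> Q" for x y
    using that rangeI[of ev "Add _ _"] by (fastforce simp: Q_def ev_def)
  have Qm: "x \<otimes>\<^bsub>P\<^esub> y \<in> Q" if "x \<in> Q" "y \<in> Q" for x y
    using that rangeI[of ev "Mult _ _"] by (fastforce simp: Q_def ev_def)
  have Qb: "\<lbrace>x, y\<rbrace>\<^bsub>P\<^esub> \<in> Q" if "x \<in> Q" "y \<in> Q" for x y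
    using that rangeI[of ev "Bracket _ _"] by (fastforce simp: Q_def ev_def)
  have Qd: "d x \<in> Q" if "x \<in> Q" for x
    using that rangeI[of ev "Der _"] by (fastforce simp: Q_def ev_def)
  have Qp: "component P i x \<in> Q" if "x \<in> Q" for x i
    using that rangeI[of ev "Proj i _"] by (fastforce simp: Q_def ev_def)
  have Qs: "k \<odot>\<^bsub>P\<^esub> x \<in> Q" if "k \<in> carrier K" "x \<in> Q" for k x
  proof -
    obtain t where "x = ev t" using \<open>x \<in> Q\<close> by (auto simp: Q_def)
    then have "k \<odot>\<^bsub>P\<^esub> x = ev (Scale k t)" using that by (simp add: ev_def)
    then show ?thesis by (simp add: Q_def)
  qed
  have Qn: "\<ominus>\<^bsub>P\<^esub> x \<in> Q" if "x \<in> Q" for x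
  proof -
    have "(\<ominus>\<^bsub>K\<^esub> \<one>\<^bsub>K\<^esub>) \<odot>\<^bsub>P\<^esub> x = \<ominus>\<^bsub>P\<^esub> x" using Qc[OF that] by (simp add: smult_l_minus)
    then show ?thesis using Qs[of "\<ominus>\<^bsub>K\<^esub> \<one>\<^bsub>K\<^esub>" x] that by simp
  qed
  define g where "g = (\<lambda>x. {t. ev t = x})"
  define h where "h = (\<lambda>X. ev (SOME t. t \<in> X))"
  have hg [simp]: "h (g x) = x" if "x \<in> Q" for x
    using that unfolding h_def g_def Q_def by (auto intro: someI)
  define R where "R = \<lparr>carrier = g ` Q, mult = \<lambda>X Y. g (h X \<otimes>\<^bsub>P\<^esub> h Y), one = g \<one>\<^bsub>P\<^esub>,
    zero = g \<zero>\<^bsub>P\<^esub>, add = \<lambda>X Y. g (h X \<oplus>\<^bsub>P\<^esub> h Y), smult = \<lambda>k X. g (k \<odot>\<^bsub>P\<^esub> h X),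
    part = \<lambda>i. g ` (Q \<inter> part P i), bracket = \<lambda>X Y. g \<lbrace>h X, h Y\<rbrace>\<^bsub>P\<^esub>\<rparr>"
  have Rsel [simp]: "carrier R = g ` Q" "mult R = (\<lambda>X Y. g (h X \<otimes>\<^bsub>P\<^esub> h Y))"
    "zero R = g \<zero>\<^bsub>P\<^esub>" "add R = (\<lambda>X Y. g (h X \<oplus>\<^bsub>P\<^esub> h Y))"
    "smult R = (\<lambda>k X. g (k \<odot>\<^bsub>P\<^esub> h X))" "part R = (\<lambda>i. g ` (Q \<inter> part P i))"
    "bracket R = (\<lambda>X Y. g \<lbrace>h X, h Y\<rbrace>\<^bsub>P\<^esub>)"
    by (simp_all add: R_def)
  note Qcl [simp] = Qz Qa Qm Qb Qd Qs Qn Qf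
  have abR: "abelian_group R"
  proof (rule abelian_groupI)
    fix x assume "x \<in> carrier R"
    then obtain u where u: "x = g u" "u \<in> Q" by auto
    then have "g (\<ominus>\<^bsub>P\<^esub> u) \<oplus>\<^bsub>R\<^esub> x = \<zero>\<^bsub>R\<^esub>" using Qc by (simp add: M.l_neg)
    then show "\<exists>y\<in>carrier R. y \<oplus>\<^bsub>R\<^esub> x = \<zero>\<^bsub>R\<^esub>" using u by (intro bexI[where x = "g (\<ominus>\<^bsub>P\<^esub> u)"]) simp_all
  next
    fix x y assume "x \<in> carrier R" "y \<in> carrier R"
    then show "x \<oplus>\<^bsub>R\<^esub> y = y \<oplus>\<^bsub>R\<^esub> x" using Qc M.a_comm by fastforce
  qed (auto simp: Qc M.a_assoc)
  have mR: "module K R"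
    by (rule moduleI) (auto simp: Qc abR R.cring_axioms smult_l_distr smult_r_distr smult_assoc1 is_cring)
  have neg: "\<ominus>\<^bsub>R\<^esub> (g x) = g (\<ominus>\<^bsub>P\<^esub> x)" if "x \<in> Q" for x
    using that by (intro abelian_group.minus_equality[OF abR]) (auto simp: Qc M.l_neg)
  have ksz: "koszul R i j (g x) = g (koszul P i j x)" if "x \<in> Q" for x i j
    using that by (simp add: koszul_def neg)
  have Qk [simp]: "koszul P i j x \<in> Q" if "x \<in> Q" for x i j
    using that by (simp add: koszul_def)
  have mns: "g x \<ominus>\<^bsub>R\<^esub> g y = g (x \<ominus>\<^bsub>P\<^esub> y)" if "x \<in> Q" "y \<in> Q" for x y
    using that by (simp add: a_minus_def neg)
  have SR: "superspace K R"
    unfolding superspace_def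
  proof (intro conjI allI)
    show "module K R" by (rule mR)
    show "submodule (part R i) K R" for i
    proof (rule module.submoduleI[OF mR])
      fix a assume "a \<in> part R i"
      then show "\<ominus>\<^bsub>R\<^esub> a \<in> part R i" using S(5) by (auto simp: neg)
    qed (use S(3,4,6) in auto)
    have "u = \<zero>\<^bsub>P\<^esub>" if "u \<in> Q" "v \<in> Q" "g u = g v" "u \<in> part P 0" "v \<in> part P 1" for u v
    proof -
      have "u = v" using that hg by metis
      then show ?thesis using S(7)[of u 0] that by simp
    qed
    then show "part R 0 \<inter> part R 1 = {\<zero>\<^bsub>R\<^esub>}" using S(3) by fastforce
    show "part R 0 <+>\<^bsub>R\<^esub> part R 1 = carrier R"
    proof
      show "part R 0 <+>\<^bsub>R\<^esub> part R 1 \<subseteq> carrier R" by (auto simp: set_add_def')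
      show "carrier R \<subseteq> part R 0 <+>\<^bsub>R\<^esub> part R 1"
      proof
        fix a assume "a \<in> carrier R"
        then obtain u where u: "a = g u" "u \<in> Q" by auto
        have "a = g (component P 0 u) \<oplus>\<^bsub>R\<^esub> g (component P 1 u)"
          using u component_sum[OF SP Qc[OF u(2)]] Qp by simp
        moreover have "component P i u \<in> part P i" for i
          using component_part[OF SP] Qc[OF u(2)] by blast
        ultimately have "a = g (component P 0 u) \<oplus>\<^bsub>R\<^esub> g (component P 1 u)"
          "g (component P 0 u) \<in> part R 0" "g (component P 1 u) \<in> part R 1"
          using u Qp by (simp_all del: hg)
        then show "a \<in> part R 0 <+>\<^bsub>R\<^esub> part R 1" unfolding set_add_def' by blast
      qed
    qed
  qed
  have grd: "graded_op K R (\<lambda>X Y. g (q (h X) (h Y)))"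
    if q: "graded_op K P q" and Qq: "\<And>x y. x \<in> Q \<Longrightarrow> y \<in> Q \<Longrightarrow> q x y \<in> Q" for q
    using q Qc Qq unfolding graded_op_def bilinear_op_def by auto
  have PR: "poisson_superalgebra K R"
    unfolding poisson_superalgebra_def
  proof (intro conjI)
    show "graded_op K R (mult R)" "graded_op K R (bracket R)"
      using grd[of "mult P"] grd[of "bracket P"] P by (auto simp: poisson_superalgebra_def)
    show "\<forall>a\<in>carrier R. \<forall>b\<in>carrier R. \<forall>c\<in>carrier R.
        (a \<otimes>\<^bsub>R\<^esub> b) \<otimes>\<^bsub>R\<^esub> c = a \<otimes>\<^bsub>R\<^esub> (b \<otimes>\<^bsub>R\<^esub> c)"
      using P Qc by (auto simp: poisson_superalgebra_def)
    have sym: "a \<otimes>\<^bsub>P\<^esub> b = koszul P i j (b \<otimes>\<^bsub>P\<^esub> a) \<and> \<lbrace>a, b\<rbrace>\<^bsub>P\<^esub> = \<ominus>\<^bsub>P\<^esub> koszul P i j \<lbrace>b, a\<rbrace>\<^bsub>P\<^esub>"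
      if "a \<in> part P i" "b \<in> part P j" for a b i j
      using P that unfolding poisson_superalgebra_def by blast
    show "\<forall>i j. \<forall>a\<in>part R i. \<forall>b\<in>part R j.
        a \<otimes>\<^bsub>R\<^esub> b = koszul R i j (b \<otimes>\<^bsub>R\<^esub> a) \<and> \<lbrace>a, b\<rbrace>\<^bsub>R\<^esub> = \<ominus>\<^bsub>R\<^esub> koszul R i j \<lbrace>b, a\<rbrace>\<^bsub>R\<^esub>"
    proof (intro allI ballI)
      fix i j a b assume "a \<in> part R i" "b \<in> part R j"
      then obtain u v where uv: "a = g u" "b = g v" "u \<in> Q" "v \<in> Q" "u \<in> part P i" "v \<in> part P j"
        by auto
      have "g (u \<otimes>\<^bsub>P\<^esub> v) = g (koszul P i j (v \<otimes>\<^bsub>P\<^esub> u)) \<and> g \<lbrace>u, v\<rbrace>\<^bsub>P\<^esub> = g (\<ominus>\<^bsub>P\<^esub> koszul P i j \<lbrace>v, u\<rbrace>\<^bsub>P\<^esub>)"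
        using sym[OF uv(5,6)] by metis
      then show "a \<otimes>\<^bsub>R\<^esub> b = koszul R i j (b \<otimes>\<^bsub>R\<^esub> a) \<and> \<lbrace>a, b\<rbrace>\<^bsub>R\<^esub> = \<ominus>\<^bsub>R\<^esub> koszul R i j \<lbrace>b, a\<rbrace>\<^bsub>R\<^esub>"
        using uv(1-4) by (simp add: ksz neg)
    qed
    have jl: "\<lbrace>a, \<lbrace>b, c\<rbrace>\<^bsub>P\<^esub>\<rbrace>\<^bsub>P\<^esub> \<ominus>\<^bsub>P\<^esub> koszul P i j \<lbrace>b, \<lbrace>a, c\<rbrace>\<^bsub>P\<^esub>\<rbrace>\<^bsub>P\<^esub> = \<lbrace>\<lbrace>a, b\<rbrace>\<^bsub>P\<^esub>, c\<rbrace>\<^bsub>P\<^esub> \<and>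
        \<lbrace>a, b \<otimes>\<^bsub>P\<^esub> c\<rbrace>\<^bsub>P\<^esub> = \<lbrace>a, b\<rbrace>\<^bsub>P\<^esub> \<otimes>\<^bsub>P\<^esub> c \<oplus>\<^bsub>P\<^esub> koszul P i j (b \<otimes>\<^bsub>P\<^esub> \<lbrace>a, c\<rbrace>\<^bsub>P\<^esub>)"
      if "a \<in> part P i" "b \<in> part P j" "c \<in> part P l" for a b c i j l
      using P that unfolding poisson_superalgebra_def by blast
    show "\<forall>i j l. \<forall>a\<in>part R i. \<forall>b\<in>part R j. \<forall>c\<in>part R l.
        \<lbrace>a, \<lbrace>b, c\<rbrace>\<^bsub>R\<^esub>\<rbrace>\<^bsub>R\<^esub> \<ominus>\<^bsub>R\<^esub> koszul R i j \<lbrace>b, \<lbrace>a, c\<rbrace>\<^bsub>R\<^esub>\<rbrace>\<^bsub>R\<^esub> = \<lbrace>\<lbrace>a, b\<rbrace>\<^bsub>R\<^esub>, c\<rbrace>\<^bsub>R\<^esub> \<and>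
        \<lbrace>a, b \<otimes>\<^bsub>R\<^esub> c\<rbrace>\<^bsub>R\<^esub> = \<lbrace>a, b\<rbrace>\<^bsub>R\<^esub> \<otimes>\<^bsub>R\<^esub> c \<oplus>\<^bsub>R\<^esub> koszul R i j (b \<otimes>\<^bsub>R\<^esub> \<lbrace>a, c\<rbrace>\<^bsub>R\<^esub>)"
    proof (intro allI ballI)
      fix i j l a b c assume "a \<in> part R i" "b \<in> part R j" "c \<in> part R l"
      then obtain u v w where uvw: "a = g u" "b = g v" "c = g w" "u \<in> Q" "v \<in> Q" "w \<in> Q"
        and p: "u \<in> part P i" "v \<in> part P j" "w \<in> part P l"
        by auto
      show "\<lbrace>a, \<lbrace>b, c\<rbrace>\<^bsub>R\<^esub>\<rbrace>\<^bsub>R\<^esub> \<ominus>\<^bsub>R\<^esub> koszul R i j \<lbrace>b, \<lbrace>a, c\<rbrace>\<^bsub>R\<^esub>\<rbrace>\<^bsub>R\<^esub> = \<lbrace>\<lbrace>a, b\<rbrace>\<^bsub>R\<^esub>, c\<rbrace>\<^bsub>R\<^esub> \<and>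
        \<lbrace>a, b \<otimes>\<^bsub>R\<^esub> c\<rbrace>\<^bsub>R\<^esub> = \<lbrace>a, b\<rbrace>\<^bsub>R\<^esub> \<otimes>\<^bsub>R\<^esub> c \<oplus>\<^bsub>R\<^esub> koszul R i j (b \<otimes>\<^bsub>R\<^esub> \<lbrace>a, c\<rbrace>\<^bsub>R\<^esub>)"
        using uvw jl[OF p] by (simp add: ksz mns)
    qed
  qed (rule SR)
  have dR: "even_derivation K R (\<lambda>X. g (d (h X)))"
    using d Qc unfolding even_derivation_def even_linear_def by (auto simp: Pi_iff image_subset_iff)
  have fR: "gd_embedding K V (derived_gd R (\<lambda>X. g (d (h X)))) (\<lambda>v. g (f v))"
  proof -
    have "inj_on (\<lambda>v. g (f v)) (carrier V)"
    proof (rule inj_onI)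
      fix x y assume "x \<in> carrier V" "y \<in> carrier V" "g (f x) = g (f y)"
      then show "x = y" using f hg Qf unfolding gd_embedding_def by (metis inj_onD)
    qed
    then show ?thesis
      using f superspace_parts(2)[OF SV]
      unfolding gd_embedding_def even_linear_def derived_gd_def
      by (auto simp: Pi_iff image_subset_iff)
  qed
  show ?thesis unfolding special_def using V PR dR fR by blast
qed

end

theory Submission
  imports Defs "HOL-Library.Function_Algebras"
begin

text \<open>
  A supercommutative algebra with an even derivation \<open>D\<close> is a Novikov superalgebra under
  \<open>x D(y)\<close>, and its supercommutator is \<open>x D(y) - D(x) y\<close>. That bracket is not a Poisson
  bracket: in \<open>{a, b c}\<close> the term \<open>D(a) b c\<close> occurs once too few. A weight repairs this. If
  \<open>E\<close> is a second even derivation and \<open>E D = D E - D\<close>, then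
  \<open>{x, y} = E(x) D(y) - D(x) E(y)\<close> is a Poisson bracket, \<open>D\<close> is a derivation of it, and on
  elements with \<open>E(x) = x\<close> it is the supercommutator. So it is enough to embed the Novikov
  superalgebra \<open>V\<close> into such an algebra with \<open>a \<circ> b = a D(b)\<close> and \<open>E(a) = a\<close> for
  \<open>a \<in> V\<close> (locale \<open>differential_superalgebra\<close>).

  The natural candidate is generated by letters \<open>a\<^sup>(\<^sup>n\<^sup>)\<close>, the \<open>n\<close>-th derivative of \<open>a \<in> V\<close>,
  where \<open>E\<close> multiplies \<open>a\<^sup>(\<^sup>n\<^sup>)\<close> by \<open>1 - n\<close>, subject to supercommutativity, linearity in
  \<open>a\<close> and the derivatives of \<open>a \<circ> b = a b'\<close>. The question is whether \<open>V\<close> survives these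
  relations. It does, because the words on which \<open>E\<close> acts by \<open>1\<close>, those with one letter more
  than the sum of their orders, have a value in \<open>V\<close> that respects all of the relations
  (\<open>word_value_tests\<close>), and the value of the word \<open>a\<close> is \<open>a\<close>.

  To construct the value, read \<open>x\<^sub>0 x\<^sub>1 ... x\<^sub>n y\<^sup>(\<^sup>n\<^sup>+\<^sup>1\<^sup>)\<close> as an operation \<open>letter_op n y\<close> on
  \<open>x\<^sub>0, ..., x\<^sub>n\<close>. For \<open>n = 0\<close> it is \<open>x\<^sub>0 \<circ> y\<close>; the product rule determines the next one from
  \<open>a \<circ> (x\<^sub>0 ... x\<^sub>n y\<^sup>(\<^sup>n\<^sup>+\<^sup>1\<^sup>))\<close>, by subtracting the terms in which some \<open>x\<^sub>i\<close> is
  differentiated, and these have \<open>a \<circ> x\<^sub>i\<close> in place of \<open>x\<^sub>i\<close> (\<open>lie\<close>). Right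
  commutativity makes the operations commute with the right multiplications; left symmetry
  then makes them supersymmetric (\<open>good_lie\<close>), and they commute with one another
  (\<open>commuting_letter_op\<close>). Hence a word has a well-defined value: its letters of positive order
  act, in any order, on its letters of order zero (\<open>word_value\<close>). The value is compatible with
  differentiation, \<open>a \<circ> word_value w = word_value (a w')\<close> (\<open>mul_word_value\<close>), and this gives
  the derivatives of \<open>a \<circ> b = a b'\<close> by induction on their order
  (\<open>word_value_mul_derivative\<close>).

  The algebra is realised without quotients. Its elements are sums of evaluation functionals
  \<open>h \<mapsto> h w\<close> at words \<open>w\<close>, restricted to the functions \<open>h\<close> from words to \<open>V\<close> that respect the
  relations (\<open>tests\<close>); the product is convolution along concatenation of words. All relations
  then hold by construction, and evaluation at \<open>word_value\<close> recovers \<open>V\<close>.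
\<close>

section \<open>Signs and sums over the entries of a list\<close>

text \<open>
  Signs are computed in the field of two elements, so its sums and products must stay in the
  form of ring expressions.
\<close>

declare add_bit_eq_xor [simp del] mult_bit_eq_and [simp del]

text \<open>
  The sign \<open>(-1)\<^sup>b\<close> in front of \<open>x\<close>. Koszul signs compose by adding exponents, which turns every
  sign check into an identity of polynomials over the field of two elements.
\<close>

definition sg :: "bit \<Rightarrow> 'g::ab_group_add \<Rightarrow> 'g" where
  "sg b x = (if b = 0 then x else - x)"

lemma sg_simps [simp]:
  "sg 0 x = x" "sg 1 x = - x" "sg b 0 = 0" "sg b (- x) = - sg b x"
  by (auto simp: sg_def)

lemma sg_sg: "sg b (sg c x) = sg (b + c) x"
  by (cases b; cases c) (auto simp: sg_def)

lemma sg_cancel [simp]: "sg b (sg b x) = x"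
  by (simp add: sg_def)

lemma sg_add: "sg b (x + y) = sg b x + sg b y" by (simp add: sg_def)
lemma sg_diff: "sg b (x - y) = sg b x - sg b y" by (simp add: sg_def)
lemma sg_eq_iff [simp]: "sg b x = sg b y \<longleftrightarrow> x = y" by (simp add: sg_def)

lemma bit_self_cancel: "x + (x + y) = y" for x y :: bit
  by (cases x; cases y; simp)

lemma bit_self: "x + x = 0" for x :: bit
  by (cases x; simp)

lemmas sign_simps = sg_sg sg_add sg_diff bit_self bit_self_cancel algebra_simps

text \<open>
  Elements carry their parity with them: zero has both parities, so that the parity of an
  element cannot be read off from it.
\<close>

type_synonym 'g elt = "bit \<times> 'g"

definition par :: "'g elt list \<Rightarrow> bit" where "par xs = sum_list (map fst xs)"

lemma par_simps [simp]:
  "par [] = 0" "par (x # xs) = fst x + par xs" "par (xs @ ys) = par xs + par ys"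
  by (simp_all add: par_def)

text \<open>
  The sum over the entries \<open>z\<close> of a list, each moved in front of the remaining list \<open>Y\<close> with the
  Koszul sign of that move.
\<close>

primrec front_sum :: "'g::ab_group_add elt list \<Rightarrow> ('g elt \<Rightarrow> 'g elt list \<Rightarrow> 'g) \<Rightarrow> 'g" where
  "front_sum [] = (\<lambda>k. 0)"
| "front_sum (x # xs) = (\<lambda>k. k x xs + front_sum xs (\<lambda>z Y. sg (fst x * fst z) (k z (x # Y))))"

lemma front_sum_cong:
  assumes "\<And>z Y. P z \<Longrightarrow> list_all P Y \<Longrightarrow> fst z + par Y = par xs \<Longrightarrow> length xs = Suc (length Y) \<Longrightarrow> k z Y = k' z Y"
    and "list_all P xs"
  shows "front_sum xs k = front_sum xs k'"
  using assms
proof (induction xs arbitrary: k k')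
  case (Cons x xs)
  have "front_sum xs (\<lambda>z Y. sg (fst x * fst z) (k z (x # Y))) = front_sum xs (\<lambda>z Y. sg (fst x * fst z) (k' z (x # Y)))"
  proof (rule Cons.IH)
    fix z Y assume "P z" "list_all P Y" "fst z + par Y = par xs" "length xs = Suc (length Y)"
    then have "k z (x # Y) = k' z (x # Y)"
      using Cons.prems by (intro Cons.prems) (auto simp: add.left_commute)
    then show "sg (fst x * fst z) (k z (x # Y)) = sg (fst x * fst z) (k' z (x # Y))" by simp
  qed (use Cons.prems in auto)
  moreover have "k x xs = k' x xs" using Cons.prems by (intro Cons.prems) auto
  ultimately show ?case by simp
qed simp

lemma front_sum_add: "front_sum xs (\<lambda>z Y. k z Y + k' z Y) = front_sum xs k + front_sum xs k'"
  by (induction xs arbitrary: k k') (simp_all add: sg_add algebra_simps)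

lemma front_sum_uminus: "front_sum xs (\<lambda>z Y. - k z Y) = - front_sum xs k"
  by (induction xs arbitrary: k) simp_all

lemma front_sum_sg: "front_sum xs (\<lambda>z Y. sg b (k z Y)) = sg b (front_sum xs k)"
  by (cases b) (simp_all add: front_sum_uminus)

lemma front_sum_diff: "front_sum xs (\<lambda>z Y. k z Y - k' z Y) = front_sum xs k - front_sum xs k'"
  using front_sum_add[of xs k "\<lambda>z Y. sg 1 (k' z Y)"] front_sum_sg[of xs 1 k'] by simp

lemma front_sum_swap:
  assumes "\<And>z p q. P z \<Longrightarrow> list_all P (p @ x # y # q) \<Longrightarrow>
      k z (p @ x # y # q) = sg (fst x * fst y) (k z (p @ y # x # q))"
    and "list_all P (p @ x # y # q)"
  shows "front_sum (p @ x # y # q) k = sg (fst x * fst y) (front_sum (p @ y # x # q) k)"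
  using assms
proof (induction p arbitrary: k)
  case Nil
  have "front_sum q (\<lambda>z Y. sg (fst y * fst z) (sg (fst x * fst z) (k z (x # y # Y))))
      = front_sum q (\<lambda>z Y. sg (fst x * fst y) (sg (fst x * fst z) (sg (fst y * fst z) (k z (y # x # Y)))))"
  proof (rule front_sum_cong)
    fix z Y assume "P z" "list_all P Y"
    then have "k z ([] @ x # y # Y) = sg (fst x * fst y) (k z ([] @ y # x # Y))"
      using Nil.prems by (intro Nil.prems) auto
    then show "sg (fst y * fst z) (sg (fst x * fst z) (k z (x # y # Y)))
      = sg (fst x * fst y) (sg (fst x * fst z) (sg (fst y * fst z) (k z (y # x # Y))))"
      by (simp add: sg_sg ac_simps)
  qed (use Nil in auto)
  also have "\<dots> = sg (fst x * fst y) (front_sum q (\<lambda>z Y. sg (fst x * fst z) (sg (fst y * fst z) (k z (y # x # Y)))))"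
    by (rule front_sum_sg)
  finally show ?case by (simp add: sg_add mult.commute[of "fst y" "fst x"])
next
  case (Cons u p)
  have "front_sum (p @ x # y # q) (\<lambda>z Y. sg (fst u * fst z) (k z (u # Y)))
      = sg (fst x * fst y) (front_sum (p @ y # x # q) (\<lambda>z Y. sg (fst u * fst z) (k z (u # Y))))"
  proof (rule Cons.IH)
    fix z p q assume "P z" "list_all P (p @ x # y # q)"
    then have "k z ((u # p) @ x # y # q) = sg (fst x * fst y) (k z ((u # p) @ y # x # q))"
      using Cons.prems by (intro Cons.prems) auto
    then show "sg (fst u * fst z) (k z (u # p @ x # y # q))
      = sg (fst x * fst y) (sg (fst u * fst z) (k z (u # p @ y # x # q)))"
      by (simp add: sg_sg add.commute)
  qed (use Cons.prems in auto)
  moreover have "k u (p @ x # y # q) = sg (fst x * fst y) (k u (p @ y # x # q))"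
    using Cons.prems by (intro Cons.prems) auto
  ultimately show ?case by (simp add: sg_add)
qed

section \<open>Supermultilinear operations on a Novikov superalgebra\<close>

text \<open>
  A Novikov superalgebra whose space is spanned by subgroups of a type in the class of abelian
  groups. The elements of the base field enter only through the endomaps by which they act.
\<close>

locale novikov =
  fixes mul :: "'g::ab_group_add \<Rightarrow> 'g \<Rightarrow> 'g" (infixl \<open>\<cdot>\<close> 70)
    and prt :: "bit \<Rightarrow> 'g set" and scalars :: "('g \<Rightarrow> 'g) set"
  assumes mul_add_left: "(x + y) \<cdot> z = x \<cdot> z + y \<cdot> z"
    and mul_add_right: "z \<cdot> (x + y) = z \<cdot> x + z \<cdot> y"
    and prt_zero [simp]: "0 \<in> prt i"
    and prt_add [simp]: "x \<in> prt i \<Longrightarrow> y \<in> prt i \<Longrightarrow> x + y \<in> prt i"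
    and prt_uminus [simp]: "x \<in> prt i \<Longrightarrow> - x \<in> prt i"
    and prt_mul [simp]: "x \<in> prt i \<Longrightarrow> y \<in> prt j \<Longrightarrow> x \<cdot> y \<in> prt (i + j)"
    and prt_scalar [simp]: "\<phi> \<in> scalars \<Longrightarrow> x \<in> prt i \<Longrightarrow> \<phi> x \<in> prt i"
    and scalar_add: "\<phi> \<in> scalars \<Longrightarrow> \<phi> (x + y) = \<phi> x + \<phi> y"
    and scalar_mul_left: "\<phi> \<in> scalars \<Longrightarrow> \<phi> x \<cdot> y = \<phi> (x \<cdot> y)"
    and scalar_mul_right: "\<phi> \<in> scalars \<Longrightarrow> x \<cdot> \<phi> y = \<phi> (x \<cdot> y)"
    and left_symmetric: "a \<in> prt i \<Longrightarrow> b \<in> prt j \<Longrightarrow> c \<in> prt l \<Longrightarrow>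
      a \<cdot> (b \<cdot> c) - (a \<cdot> b) \<cdot> c = sg (i * j) (b \<cdot> (a \<cdot> c) - (b \<cdot> a) \<cdot> c)"
    and right_commutative: "a \<in> prt i \<Longrightarrow> b \<in> prt j \<Longrightarrow> c \<in> prt l \<Longrightarrow>
      (a \<cdot> b) \<cdot> c = sg (j * l) ((a \<cdot> c) \<cdot> b)"
begin

lemma mul_zero [simp]: "0 \<cdot> x = 0" "x \<cdot> 0 = 0"
  using mul_add_left[of 0 0 x] mul_add_right[of x 0 0] by simp_all

lemma mul_uminus [simp]: "(- x) \<cdot> y = - (x \<cdot> y)" "x \<cdot> (- y) = - (x \<cdot> y)"
  using mul_add_left[of x "- x" y] mul_add_right[of x y "- y"]
  by (simp_all add: eq_neg_iff_add_eq_0 add.commute)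

lemma mul_diff: "(x - y) \<cdot> z = x \<cdot> z - y \<cdot> z" "z \<cdot> (x - y) = z \<cdot> x - z \<cdot> y"
  using mul_add_left[of x "- y" z] mul_add_right[of z x "- y"] by simp_all

lemma mul_sg [simp]: "sg b x \<cdot> y = sg b (x \<cdot> y)" "x \<cdot> sg b y = sg b (x \<cdot> y)"
  by (simp_all add: sg_def)

lemma prt_diff [simp]: "x \<in> prt i \<Longrightarrow> y \<in> prt i \<Longrightarrow> x - y \<in> prt i"
  using prt_add[of x i "- y"] by simp

lemma prt_sg [simp]: "x \<in> prt i \<Longrightarrow> sg b x \<in> prt i"
  by (simp add: sg_def)

lemma scalar_zero: "\<phi> \<in> scalars \<Longrightarrow> \<phi> 0 = 0"
  using scalar_add[of \<phi> 0 0] by simp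

lemma scalar_uminus: "\<phi> \<in> scalars \<Longrightarrow> \<phi> (- x) = - \<phi> x"
  using scalar_add[of \<phi> x "- x"] by (simp add: minus_unique scalar_zero)

definition homog :: "'g elt \<Rightarrow> bool" where "homog x \<longleftrightarrow> snd x \<in> prt (fst x)"

abbreviation homogs :: "'g elt list \<Rightarrow> bool" where "homogs \<equiv> list_all homog"

lemma homog_Pair [simp]: "homog (i, x) \<longleftrightarrow> x \<in> prt i" by (simp add: homog_def)

definition tmul :: "'g elt \<Rightarrow> 'g elt \<Rightarrow> 'g elt" (infixl \<open>\<odot>\<close> 70) where
  "x \<odot> y = (fst x + fst y, snd x \<cdot> snd y)"

lemma tmul_simps [simp]: "fst (x \<odot> y) = fst x + fst y" "snd (x \<odot> y) = snd x \<cdot> snd y"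
  by (simp_all add: tmul_def)

lemma homog_tmul [simp]: "homog x \<Longrightarrow> homog y \<Longrightarrow> homog (x \<odot> y)"
  by (simp add: homog_def)

text \<open>
  The value of an operation of parity \<open>e\<close>, with its parity. Operations stand to the right of
  their arguments: \<open>f [x\<^sub>0, ..., x\<^sub>n]\<close> is to be read as the product \<open>x\<^sub>0 ... x\<^sub>n f\<close>, and all Koszul
  signs below follow this convention.
\<close>

definition tagged :: "bit \<Rightarrow> ('g elt list \<Rightarrow> 'g) \<Rightarrow> 'g elt list \<Rightarrow> 'g elt" where
  "tagged e f xs = (par xs + e, f xs)"

lemma tagged_simps [simp]: "fst (tagged e f xs) = par xs + e" "snd (tagged e f xs) = f xs"
  by (simp_all add: tagged_def)

text \<open>
  Linearity in the first argument suffices, since supersymmetry carries it to the others. The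
  number of arguments is not fixed; an operation of \<open>n\<close> arguments vanishes on lists of other
  lengths.
\<close>

definition supermultilinear :: "bit \<Rightarrow> ('g elt list \<Rightarrow> 'g) \<Rightarrow> bool" where
  "supermultilinear e f \<longleftrightarrow>
     (\<forall>xs. homogs xs \<longrightarrow> f xs \<in> prt (par xs + e)) \<and>
     (\<forall>p x y q. homogs (p @ x # y # q) \<longrightarrow> f (p @ x # y # q) = sg (fst x * fst y) (f (p @ y # x # q))) \<and>
     (\<forall>i a b X. a \<in> prt i \<longrightarrow> b \<in> prt i \<longrightarrow> homogs X \<longrightarrow>
        f ((i, a + b) # X) = f ((i, a) # X) + f ((i, b) # X)) \<and>
     (\<forall>\<phi>\<in>scalars. \<forall>i a X. a \<in> prt i \<longrightarrow> homogs X \<longrightarrow> f ((i, \<phi> a) # X) = \<phi> (f ((i, a) # X)))"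

lemma supermultilinearD:
  assumes "supermultilinear e f"
  shows "homogs xs \<Longrightarrow> f xs \<in> prt (par xs + e)"
    and "homogs (p @ x # y # q) \<Longrightarrow> f (p @ x # y # q) = sg (fst x * fst y) (f (p @ y # x # q))"
    and "a \<in> prt i \<Longrightarrow> b \<in> prt i \<Longrightarrow> homogs X \<Longrightarrow> f ((i, a + b) # X) = f ((i, a) # X) + f ((i, b) # X)"
    and "\<phi> \<in> scalars \<Longrightarrow> a \<in> prt i \<Longrightarrow> homogs X \<Longrightarrow> f ((i, \<phi> a) # X) = \<phi> (f ((i, a) # X))"
  using assms unfolding supermultilinear_def by blast+

lemma homog_tagged: "supermultilinear e f \<Longrightarrow> homogs xs \<Longrightarrow> homog (tagged e f xs)"
  using supermultilinearD(1)[of e f xs] by (simp add: tagged_def)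

lemma supermultilinear_zero: assumes "supermultilinear e f" "homogs X" shows "f ((i, 0) # X) = 0"
  using supermultilinearD(3)[OF assms(1), of 0 i 0 X] assms(2) by simp

lemma supermultilinear_uminus: assumes "supermultilinear e f" "a \<in> prt i" "homogs X"
  shows "f ((i, - a) # X) = - f ((i, a) # X)"
  using supermultilinearD(3)[OF assms(1), of a i "- a" X] assms supermultilinear_zero[OF assms(1,3)]
  by (simp add: minus_unique)

lemma supermultilinear_sg: assumes "supermultilinear e f" "a \<in> prt i" "homogs X"
  shows "f ((i, sg b a) # X) = sg b (f ((i, a) # X))"
  using supermultilinear_uminus[OF assms] by (simp add: sg_def)

lemma supermultilinear_diff: assumes "supermultilinear e f" "a \<in> prt i" "b \<in> prt i" "homogs X"
  shows "f ((i, a - b) # X) = f ((i, a) # X) - f ((i, b) # X)"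
  using supermultilinearD(3)[OF assms(1), of a i "- b" X] assms by (simp add: supermultilinear_uminus[OF assms(1)])

lemma supermultilinear_front:
  assumes "supermultilinear e f" "homogs (p @ x # q)"
  shows "f (p @ x # q) = sg (par p * fst x) (f (x # p @ q))"
  using assms(2)
proof (induction p arbitrary: q rule: rev_induct)
  case (snoc y p)
  have "f (p @ y # x # q) = sg (fst y * fst x) (f (p @ x # y # q))"
    using snoc.prems by (intro supermultilinearD(2)[OF assms(1)]) auto
  then show ?case using snoc.IH[of "y # q"] snoc.prems by (simp add: sign_simps)
qed simp

lemma supermultilinear_blocks:
  assumes "supermultilinear e f" "homogs (p @ Y @ Z @ q)"
  shows "f (p @ Y @ Z @ q) = sg (par Y * par Z) (f (p @ Z @ Y @ q))"
  using assms(2)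
proof (induction Y arbitrary: p)
  case (Cons y Y)
  have *: "f (p @ Z' @ y # q) = sg (par Z' * fst y) (f (p @ y # Z' @ q))" if "homogs (p @ y # Z' @ q)" for Z' q
    using that
  proof (induction Z' arbitrary: q rule: rev_induct)
    case (snoc z Z')
    have "f ((p @ Z') @ z # y # q) = sg (fst z * fst y) (f ((p @ Z') @ y # z # q))"
      using snoc.prems by (intro supermultilinearD(2)[OF assms(1)]) auto
    then show ?case using snoc.IH[of "z # q"] snoc.prems by (simp add: sign_simps)
  qed simp
  have "f ((p @ [y]) @ Y @ Z @ q) = sg (par Y * par Z) (f ((p @ [y]) @ Z @ Y @ q))"
    using Cons.prems by (intro Cons.IH) auto
  then show ?case using *[of Z "Y @ q"] Cons.prems by (simp add: sign_simps)
qed simp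

lemma prt_front_sum:
  assumes "\<And>z Y. homog z \<Longrightarrow> homogs Y \<Longrightarrow> fst z + par Y = par X \<Longrightarrow> k z Y \<in> prt i" "homogs X"
  shows "front_sum X k \<in> prt i"
  using assms
proof (induction X arbitrary: k)
  case (Cons x X)
  have "front_sum X (\<lambda>z Y. sg (fst x * fst z) (k z (x # Y))) \<in> prt i"
    using Cons.prems by (intro Cons.IH prt_sg Cons.prems) (auto simp: add.left_commute)
  moreover have "k x X \<in> prt i" using Cons.prems by (intro Cons.prems) auto
  ultimately show ?case by simp
qed simp

text \<open>
  Additivity is only available on one homogeneous component, so the summands have to share
  their parity.
\<close>

lemma additive_front_sum:
  assumes h: "\<And>a b. a \<in> prt i \<Longrightarrow> b \<in> prt i \<Longrightarrow> h (a + b) = h a + h b"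
    and "\<And>z Y. homog z \<Longrightarrow> homogs Y \<Longrightarrow> fst z + par Y = par X \<Longrightarrow> k z Y \<in> prt i" "homogs X"
  shows "h (front_sum X k) = front_sum X (\<lambda>z Y. h (k z Y))"
  using assms(2-)
proof (induction X arbitrary: k)
  have h0: "h 0 = 0" using h[of 0 0] by simp
  {
    case Nil show ?case by (simp add: h0)
  next
    case (Cons x X)
    have hs: "h (sg b a) = sg b (h a)" if "a \<in> prt i" for a b
      using h[of a "- a"] that h0 by (simp add: sg_def minus_unique)
    let ?k = "\<lambda>z Y. sg (fst x * fst z) (k z (x # Y))"
    have k: "k z (x # Y) \<in> prt i" if "homog z" "homogs Y" "fst z + par Y = par X" for z Y
      using that Cons.prems by (intro Cons.prems) (auto simp: add.left_commute)
    have "h (front_sum X ?k) = front_sum X (\<lambda>z Y. h (?k z Y))"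
      using Cons.prems k by (intro Cons.IH prt_sg) auto
    also have "\<dots> = front_sum X (\<lambda>z Y. sg (fst x * fst z) (h (k z (x # Y))))"
      using Cons.prems by (intro front_sum_cong[where P = homog] hs k) auto
    finally have "h (front_sum X ?k) = front_sum X (\<lambda>z Y. sg (fst x * fst z) (h (k z (x # Y))))" .
    moreover have "k x X \<in> prt i" "front_sum X ?k \<in> prt i"
      using Cons.prems k by (auto intro!: Cons.prems prt_front_sum)
    ultimately show ?case by (simp add: h)
  }
qed


section \<open>Differentiating a supermultilinear operation\<close>

text \<open>
  The sum of the terms of \<open>a (x\<^sub>0 ... x\<^sub>n)' f\<close>: the derivative of \<open>x\<^sub>i\<close> appears together with the
  factor \<open>a\<close> as \<open>a x\<^sub>i' = a \<circ> x\<^sub>i\<close>.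
\<close>

primrec slot_sum :: "'g elt list \<Rightarrow> 'g elt \<Rightarrow> ('g elt list \<Rightarrow> 'g) \<Rightarrow> 'g" where
  "slot_sum [] = (\<lambda>a f. 0)"
| "slot_sum (x # xs) = (\<lambda>a f. f ((a \<odot> x) # xs) + sg (fst a * fst x) (slot_sum xs a (\<lambda>Y. f (x # Y))))"

text \<open>
  The derivative \<open>f'\<close> of an operation: \<open>a x\<^sub>0 ... x\<^sub>n f'\<close> is what remains of
  \<open>a (x\<^sub>0 ... x\<^sub>n f)'\<close> when the terms in which some \<open>x\<^sub>i\<close> is differentiated are taken away.
\<close>

primrec lie :: "('g elt list \<Rightarrow> 'g) \<Rightarrow> 'g elt list \<Rightarrow> 'g" where
  "lie f [] = 0"
| "lie f (a # xs) = snd a \<cdot> f xs - slot_sum xs a f"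

declare lie.simps(2) [simp del]

text \<open>
  Supersymmetry moves \<open>a \<circ> x\<^sub>i\<close> to the front, where the interaction of \<open>f\<close> with right
  multiplications can be used.
\<close>

lemma slot_sum_eq_front_sum:
  assumes "\<And>p x y q. homogs (p @ x # y # q) \<Longrightarrow> f (p @ x # y # q) = sg (fst x * fst y) (f (p @ y # x # q))"
    and "homog a" "homogs xs"
  shows "slot_sum xs a f = front_sum xs (\<lambda>z Y. f ((a \<odot> z) # Y))"
  using assms(1,3)
proof (induction xs arbitrary: f)
  case (Cons x xs)
  have "slot_sum xs a (\<lambda>Y. f (x # Y)) = front_sum xs (\<lambda>z Y. f (x # (a \<odot> z) # Y))"
  proof (rule Cons.IH)
    fix p u v q assume "homogs (p @ u # v # q)"
    then have "f ((x # p) @ u # v # q) = sg (fst u * fst v) (f ((x # p) @ v # u # q))"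
      using Cons.prems by (intro Cons.prems) auto
    then show "f (x # p @ u # v # q) = sg (fst u * fst v) (f (x # p @ v # u # q))" by simp
  qed (use Cons.prems in auto)
  also have "\<dots> = front_sum xs (\<lambda>z Y. sg (fst a * fst x) (sg (fst x * fst z) (f ((a \<odot> z) # x # Y))))"
  proof (rule front_sum_cong)
    fix z Y assume "homog z" "homogs Y"
    then have "f ([] @ x # (a \<odot> z) # Y) = sg (fst x * fst (a \<odot> z)) (f ([] @ (a \<odot> z) # x # Y))"
      using Cons.prems \<open>homog a\<close> by (intro Cons.prems) auto
    then show "f (x # (a \<odot> z) # Y) = sg (fst a * fst x) (sg (fst x * fst z) (f ((a \<odot> z) # x # Y)))"
      by (simp add: sign_simps)
  qed (use Cons.prems in auto)
  also have "\<dots> = sg (fst a * fst x) (front_sum xs (\<lambda>z Y. sg (fst x * fst z) (f ((a \<odot> z) # x # Y))))"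
    by (rule front_sum_sg)
  finally show ?case by simp
qed simp

lemma lie_eq_front_sum:
  assumes "supermultilinear e f" "homog a" "homogs xs"
  shows "lie f (a # xs) = snd a \<cdot> f xs - front_sum xs (\<lambda>z Y. f ((a \<odot> z) # Y))"
  using slot_sum_eq_front_sum[OF supermultilinearD(2)[OF assms(1)] assms(2,3)] by (simp add: lie.simps)

text \<open>
  The operation commutes with right multiplications: \<open>(a z') X f = \<plusminus> (a X f) z'\<close>.
\<close>

definition right_comm :: "bit \<Rightarrow> ('g elt list \<Rightarrow> 'g) \<Rightarrow> bool" where
  "right_comm e f \<longleftrightarrow> (\<forall>a z X. homog a \<longrightarrow> homog z \<longrightarrow> homogs X \<longrightarrow>
     f ((a \<odot> z) # X) = sg (fst z * (par X + e)) (f (a # X) \<cdot> snd z))"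

text \<open>
  This is \<open>a x (X f)'\<close>. Its supersymmetry in \<open>a\<close> and \<open>x\<close> (\<open>left_sym\<close>) is the left symmetry axiom
  with the right multiplication \<open>c \<mapsto> c \<circ> y\<close> replaced by \<open>c \<mapsto> c X f\<close>.
\<close>

definition left_defect :: "('g elt list \<Rightarrow> 'g) \<Rightarrow> 'g elt list \<Rightarrow> 'g elt \<Rightarrow> 'g elt \<Rightarrow> 'g" where
  "left_defect f X a x = snd a \<cdot> f (x # X) - f ((a \<odot> x) # X)"

definition left_sym :: "('g elt list \<Rightarrow> 'g) \<Rightarrow> bool" where
  "left_sym f \<longleftrightarrow> (\<forall>a x X. homog a \<longrightarrow> homog x \<longrightarrow> homogs X \<longrightarrow>
     left_defect f X a x = sg (fst a * fst x) (left_defect f X x a))"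

text \<open>
  The invariants that are passed on from \<open>f\<close> to \<open>f'\<close>.
\<close>

definition good :: "bit \<Rightarrow> ('g elt list \<Rightarrow> 'g) \<Rightarrow> bool" where
  "good e f \<longleftrightarrow> supermultilinear e f \<and> right_comm e f \<and> left_sym f"

lemma rcomm: "homog a \<Longrightarrow> homog b \<Longrightarrow> homog c \<Longrightarrow>
    (snd a \<cdot> snd b) \<cdot> snd c = sg (fst b * fst c) ((snd a \<cdot> snd c) \<cdot> snd b)"
  unfolding homog_def by (rule right_commutative)

lemma lsym: "homog a \<Longrightarrow> homog b \<Longrightarrow> homog c \<Longrightarrow>
    snd a \<cdot> (snd b \<cdot> snd c) - (snd a \<cdot> snd b) \<cdot> snd c =
    sg (fst a * fst b) (snd b \<cdot> (snd a \<cdot> snd c) - (snd b \<cdot> snd a) \<cdot> snd c)"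
  unfolding homog_def by (rule left_symmetric)

lemma right_commD:
  "right_comm e f \<Longrightarrow> homog a \<Longrightarrow> homog z \<Longrightarrow> homogs X \<Longrightarrow>
    f ((a \<odot> z) # X) = sg (fst z * (par X + e)) (f (a # X) \<cdot> snd z)"
  unfolding right_comm_def by blast

lemma left_symD:
  "left_sym f \<Longrightarrow> homog a \<Longrightarrow> homog x \<Longrightarrow> homogs X \<Longrightarrow>
    left_defect f X a x = sg (fst a * fst x) (left_defect f X x a)"
  unfolding left_sym_def by blast

text \<open>
  Only the exchange of the first two arguments \<open>a\<close> and \<open>x\<close> is not inherited from \<open>f\<close>. The terms
  that differentiate \<open>a\<close> or \<open>x\<close> form the left defect of \<open>f\<close>; in the others the differentiated
  entry can be split off as a right multiplication, which leaves \<open>f\<close> applied to both \<open>a\<close> and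
  \<open>x\<close>.
\<close>

lemma supermultilinear_lie:
  assumes "good e f"
  shows "supermultilinear e (lie f)"
proof -
  have S: "supermultilinear e f" and C: "right_comm e f" and L: "left_sym f"
    using assms by (auto simp: good_def)
  have closed: "lie f xs \<in> prt (par xs + e)" if "homogs xs" for xs
  proof (cases xs)
    case (Cons a X)
    then have aX: "homog a" "homogs X" using that by auto
    have "front_sum X (\<lambda>z Y. f ((a \<odot> z) # Y)) \<in> prt (par xs + e)"
    proof (rule prt_front_sum[OF _ aX(2)])
      fix z Y assume zY: "homog z" "homogs Y" "fst z + par Y = par X"
      then show "f ((a \<odot> z) # Y) \<in> prt (par xs + e)"
        using supermultilinearD(1)[OF S, of "(a \<odot> z) # Y"] aX by (simp add: Cons add.assoc flip: zY(3))
    qed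
    moreover have "snd a \<cdot> f X \<in> prt (fst a + (par X + e))"
      using supermultilinearD(1)[OF S] aX by (simp add: homog_def)
    ultimately show ?thesis using lie_eq_front_sum[OF S aX] by (simp add: Cons add.assoc)
  qed simp
  \<comment> \<open>here \<open>a\<close>, the argument added by \<open>lie\<close>, is exchanged with the first argument of \<open>f\<close>\<close>
  have swap0: "lie f (a # x # X) = sg (fst a * fst x) (lie f (x # a # X))"
    if h: "homog a" "homog x" "homogs X" for a x X
  proof -
    have eq: "lie f (a # x # X) = left_defect f X a x -
        front_sum X (\<lambda>z Y. sg (fst x * fst z) (f ((a \<odot> z) # x # Y)))"
      if "homog a" "homog x" for a x
      using lie_eq_front_sum[OF S, of a "x # X"] that h by (simp add: left_defect_def)
    have "front_sum X (\<lambda>z Y. sg (fst x * fst z) (f ((a \<odot> z) # x # Y)))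
        = front_sum X (\<lambda>z Y. sg (fst a * fst x) (sg (fst a * fst z) (f ((x \<odot> z) # a # Y))))"
    proof (rule front_sum_cong[where P = homog])
      fix z Y assume zY: "homog z" "homogs Y"
      have "f (a # x # Y) = sg (fst a * fst x) (f (x # a # Y))"
        using supermultilinearD(2)[OF S, of "[]" a x Y] h zY by simp
      then show "sg (fst x * fst z) (f ((a \<odot> z) # x # Y))
        = sg (fst a * fst x) (sg (fst a * fst z) (f ((x \<odot> z) # a # Y)))"
        using right_commD[OF C, of a z "x # Y"] right_commD[OF C, of x z "a # Y"] h zY
        by (simp add: sign_simps)
    qed (use h in auto)
    also have "\<dots> = sg (fst a * fst x) (front_sum X (\<lambda>z Y. sg (fst a * fst z) (f ((x \<odot> z) # a # Y))))"
      by (rule front_sum_sg)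
    finally show ?thesis
      using left_symD[OF L h] h by (simp add: eq sg_diff)
  qed
  have swap: "lie f (p @ x # y # q) = sg (fst x * fst y) (lie f (p @ y # x # q))"
    if h: "homogs (p @ x # y # q)" for p x y q
  proof (cases p)
    case Nil
    then show ?thesis using swap0[of x y q] h by simp
  next
    case (Cons a p')
    have "front_sum (p' @ x # y # q) (\<lambda>z Y. f ((a \<odot> z) # Y)) =
        sg (fst x * fst y) (front_sum (p' @ y # x # q) (\<lambda>z Y. f ((a \<odot> z) # Y)))"
    proof (rule front_sum_swap[where P = homog])
      fix z p q assume "homog z" "homogs (p @ x # y # q)"
      then show "f ((a \<odot> z) # p @ x # y # q) = sg (fst x * fst y) (f ((a \<odot> z) # p @ y # x # q))"
        using supermultilinearD(2)[OF S, of "(a \<odot> z) # p" x y q] h Cons by simp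
    qed (use h Cons in auto)
    moreover have "f (p' @ x # y # q) = sg (fst x * fst y) (f (p' @ y # x # q))"
      using supermultilinearD(2)[OF S, of p' x y q] h Cons by simp
    ultimately show ?thesis
      using h lie_eq_front_sum[OF S, of a "p' @ x # y # q"] lie_eq_front_sum[OF S, of a "p' @ y # x # q"]
      by (simp add: Cons sg_diff)
  qed
  have add: "lie f ((i, a + b) # X) = lie f ((i, a) # X) + lie f ((i, b) # X)"
    if h: "a \<in> prt i" "b \<in> prt i" "homogs X" for i a b X
  proof -
    have "front_sum X (\<lambda>z Y. f (((i, a + b) \<odot> z) # Y)) =
        front_sum X (\<lambda>z Y. f (((i, a) \<odot> z) # Y) + f (((i, b) \<odot> z) # Y))"
    proof (rule front_sum_cong[where P = homog])
      fix z Y assume zY: "homog z" "homogs Y"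
      then show "f (((i, a + b) \<odot> z) # Y) = f (((i, a) \<odot> z) # Y) + f (((i, b) \<odot> z) # Y)"
        using h by (simp add: tmul_def mul_add_left homog_def supermultilinearD(3)[OF S])
    qed (use h in auto)
    then show ?thesis
      using h by (simp add: lie_eq_front_sum[OF S] front_sum_add mul_add_left)
  qed
  have scal: "lie f ((i, \<phi> a) # X) = \<phi> (lie f ((i, a) # X))"
    if h: "a \<in> prt i" "homogs X" and phi: "\<phi> \<in> scalars" for i a X \<phi>
  proof -
    have "front_sum X (\<lambda>z Y. f (((i, \<phi> a) \<odot> z) # Y)) = front_sum X (\<lambda>z Y. \<phi> (f (((i, a) \<odot> z) # Y)))"
    proof (rule front_sum_cong[where P = homog])
      fix z Y assume zY: "homog z" "homogs Y"
      then show "f (((i, \<phi> a) \<odot> z) # Y) = \<phi> (f (((i, a) \<odot> z) # Y))"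
        using h phi by (simp add: tmul_def scalar_mul_left homog_def supermultilinearD(4)[OF S])
    qed (use h in auto)
    also have "\<dots> = \<phi> (front_sum X (\<lambda>z Y. f (((i, a) \<odot> z) # Y)))"
    proof (rule additive_front_sum[symmetric, where i = "i + par X + e"])
      fix z Y assume zY: "homog z" "homogs Y" "fst z + par Y = par X"
      then show "f (((i, a) \<odot> z) # Y) \<in> prt (i + par X + e)"
        using supermultilinearD(1)[OF S, of "((i, a) \<odot> z) # Y"] h by (simp add: add.assoc flip: zY(3))
    qed (use h phi in \<open>auto simp: scalar_add\<close>)
    finally show ?thesis
      using h phi scalar_add[OF phi] scalar_uminus[OF phi]
      by (simp add: lie_eq_front_sum[OF S] scalar_mul_left diff_conv_add_uminus del: add_uminus_conv_diff)
  qed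
  show ?thesis unfolding supermultilinear_def using closed swap add scal by blast
qed

text \<open>
  With \<open>Y\<close> and \<open>Z\<close> fixed, \<open>g\<close> and \<open>f\<close> are operators on \<open>x\<close>; they supercommute.
\<close>

definition commuting :: "bit \<Rightarrow> ('g elt list \<Rightarrow> 'g) \<Rightarrow> bit \<Rightarrow> ('g elt list \<Rightarrow> 'g) \<Rightarrow> bool" where
  "commuting e g e' f \<longleftrightarrow> (\<forall>x Y Z. homog x \<longrightarrow> homogs Y \<longrightarrow> homogs Z \<longrightarrow>
     f (tagged e g (x # Y) # Z) = sg ((par Y + e) * (par Z + e')) (g (tagged e' f (x # Z) # Y)))"

lemma commutingD:
  "commuting e g e' f \<Longrightarrow> homog x \<Longrightarrow> homogs Y \<Longrightarrow> homogs Z \<Longrightarrow>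
     f (tagged e g (x # Y) # Z) = sg ((par Y + e) * (par Z + e')) (g (tagged e' f (x # Z) # Y))"
  unfolding commuting_def by blast

text \<open>
  As an operator on its first argument, \<open>f'\<close> is a polynomial in right multiplications and in
  values of \<open>f\<close>. So whatever commutes with those commutes with \<open>f'\<close>.
\<close>

lemma commuting_lie:
  assumes f: "supermultilinear e' f" and g: "supermultilinear e g" and Cg: "right_comm e g" and c: "commuting e g e' f"
  shows "commuting e g e' (lie f)"
  unfolding commuting_def
proof (intro allI impI)
  fix x Y Z assume h: "homog x" "homogs Y" "homogs Z"
  let ?s = "(par Y + e) * (par Z + e')" and ?i = "fst x + par Z + e'"
  have xY: "homog (tagged e g (x # Y))" using homog_tagged[OF g] h by simp
  have fZ: "homog (par Z + e', f Z)" using supermultilinearD(1)[OF f] h by simp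
  have k: "f ((x \<odot> z) # W) \<in> prt ?i" if "homog z" "homogs W" "fst z + par W = par Z" for z W
    using supermultilinearD(1)[OF f, of "(x \<odot> z) # W"] that(1,2) h by (simp add: add.assoc flip: that(3))
  have "front_sum Z (\<lambda>z W. f ((tagged e g (x # Y) \<odot> z) # W)) =
      front_sum Z (\<lambda>z W. sg ?s (g ((?i, f ((x \<odot> z) # W)) # Y)))"
  proof (rule front_sum_cong[where P = homog])
    fix z W assume zW: "homog z" "homogs W" "fst z + par W = par Z"
    have "tagged e g ((x \<odot> z) # Y) = (fst x + fst z + par Y + e, sg (fst z * (par Y + e)) (g (x # Y) \<cdot> snd z))"
      using right_commD[OF Cg h(1) zW(1) h(2)] by (simp add: tagged_def)
    then have "tagged e g (x # Y) \<odot> z = (fst x + fst z + par Y + e, sg (fst z * (par Y + e)) (g ((x \<odot> z) # Y)))"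
      by (simp add: tagged_def tmul_def ac_simps)
    moreover have "g ((x \<odot> z) # Y) \<in> prt (fst x + fst z + par Y + e)"
      using supermultilinearD(1)[OF g, of "(x \<odot> z) # Y"] h zW by simp
    ultimately have "f ((tagged e g (x # Y) \<odot> z) # W) = sg (fst z * (par Y + e)) (f (tagged e g ((x \<odot> z) # Y) # W))"
      using supermultilinear_sg[OF f _ zW(2)] by (simp add: tagged_def)
    also have "\<dots> = sg (fst z * (par Y + e)) (sg ((par Y + e) * (par W + e')) (g (tagged e' f ((x \<odot> z) # W) # Y)))"
      using commutingD[OF c, of "x \<odot> z" Y W] h zW by simp
    also have "tagged e' f ((x \<odot> z) # W) = (?i, f ((x \<odot> z) # W))"
      by (simp add: tagged_def ac_simps flip: zW(3))
    finally show "f ((tagged e g (x # Y) \<odot> z) # W) = sg ?s (g ((?i, f ((x \<odot> z) # W)) # Y))"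
      by (simp add: sign_simps flip: zW(3))
  qed (use h in auto)
  also have "\<dots> = sg ?s (g ((?i, front_sum Z (\<lambda>z W. f ((x \<odot> z) # W))) # Y))"
    unfolding front_sum_sg
    by (subst additive_front_sum[where i = ?i and h = "\<lambda>a. g ((?i, a) # Y)"])
       (use h k supermultilinearD(3)[OF g] in auto)
  finally have 1: "front_sum Z (\<lambda>z W. f ((tagged e g (x # Y) \<odot> z) # W)) =
      sg ?s (g ((?i, front_sum Z (\<lambda>z W. f ((x \<odot> z) # W))) # Y))" .
  have "g ((x \<odot> (par Z + e', f Z)) # Y) = sg ((par Z + e') * (par Y + e)) (g (x # Y) \<cdot> f Z)"
    using right_commD[OF Cg h(1) fZ h(2)] by simp
  then have 2: "g (x # Y) \<cdot> f Z = sg ?s (g ((?i, snd x \<cdot> f Z) # Y))"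
    by (simp add: tmul_def sign_simps)
  have "snd x \<cdot> f Z \<in> prt ?i" using h fZ by (simp add: homog_def add.assoc)
  moreover have "front_sum Z (\<lambda>z W. f ((x \<odot> z) # W)) \<in> prt ?i" using k h(3) by (rule prt_front_sum)
  ultimately have "lie f (tagged e g (x # Y) # Z) =
      sg ?s (g ((?i, snd x \<cdot> f Z - front_sum Z (\<lambda>z W. f ((x \<odot> z) # W))) # Y))"
    using lie_eq_front_sum[OF f xY h(3)] 1 2 h by (simp add: supermultilinear_diff[OF g] sg_diff)
  then show "lie f (tagged e g (x # Y) # Z) = sg ?s (g (tagged e' (lie f) (x # Z) # Y))"
    using lie_eq_front_sum[OF f h(1,3)] by (simp add: tagged_def)
qed


lemma mul_front_sum: "a \<cdot> front_sum X k = front_sum X (\<lambda>z Y. a \<cdot> k z Y)" "front_sum X k \<cdot> a = front_sum X (\<lambda>z Y. k z Y \<cdot> a)"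
  by (induction X arbitrary: k) (simp_all add: mul_add_left mul_add_right)

text \<open>
  Right multiplications commute with one another and with \<open>f\<close>, hence with \<open>f'\<close>.
\<close>

lemma right_comm_lie:
  assumes "good e f"
  shows "right_comm e (lie f)"
  unfolding right_comm_def
proof (intro allI impI)
  have S: "supermultilinear e f" and C: "right_comm e f" using assms by (auto simp: good_def)
  fix a w X assume h: "homog a" "homog w" "homogs X"
  let ?s = "fst w * (par X + e)"
  have "front_sum X (\<lambda>z Y. f (((a \<odot> w) \<odot> z) # Y)) = front_sum X (\<lambda>z Y. sg ?s (f ((a \<odot> z) # Y) \<cdot> snd w))"
  proof (rule front_sum_cong[where P = homog])
    fix z Y assume zY: "homog z" "homogs Y" "fst z + par Y = par X"
    have "(a \<odot> w) \<odot> z = (fst a + fst z + fst w, sg (fst w * fst z) ((snd a \<cdot> snd z) \<cdot> snd w))"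
      using rcomm[OF h(1,2) zY(1)] by (simp add: tmul_def ac_simps)
    moreover have "(snd a \<cdot> snd z) \<cdot> snd w \<in> prt (fst a + fst z + fst w)"
      using h zY by (simp add: homog_def)
    ultimately have "f (((a \<odot> w) \<odot> z) # Y) = sg (fst w * fst z) (f (((a \<odot> z) \<odot> w) # Y))"
      using supermultilinear_sg[OF S _ zY(2)] by (simp add: tmul_def ac_simps)
    also have "f (((a \<odot> z) \<odot> w) # Y) = sg (fst w * (par Y + e)) (f ((a \<odot> z) # Y) \<cdot> snd w)"
      using right_commD[OF C, of "a \<odot> z" w Y] h zY by simp
    finally show "f (((a \<odot> w) \<odot> z) # Y) = sg ?s (f ((a \<odot> z) # Y) \<cdot> snd w)"
      by (simp add: sign_simps flip: zY(3))
  qed (use h in auto)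
  moreover have "(snd a \<cdot> snd w) \<cdot> f X = sg ?s ((snd a \<cdot> f X) \<cdot> snd w)"
    using rcomm[OF h(1,2), of "tagged e f X"] homog_tagged[OF S] h by simp
  ultimately show "lie f ((a \<odot> w) # X) = sg ?s (lie f (a # X) \<cdot> snd w)"
    using h by (simp add: lie_eq_front_sum[OF S] front_sum_sg mul_diff mul_front_sum sg_diff)
qed

text \<open>
  The operators with a supersymmetric left defect are closed under sums and under composition
  with right multiplications that they commute with; \<open>f'\<close> is obtained from right multiplications
  and values of \<open>f\<close> in this way. Below, \<open>G a x z Y\<close> is the contribution of the composition of
  \<open>c \<mapsto> c \<circ> z\<close> with \<open>c \<mapsto> c Y f\<close>.
\<close>

lemma left_sym_lie:
  assumes "good e f"
  shows "left_sym (lie f)"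
  unfolding left_sym_def
proof (intro allI impI)
  have S: "supermultilinear e f" and C: "right_comm e f" and L: "left_sym f"
    using assms by (auto simp: good_def)
  fix a x X assume h: "homog a" "homog x" "homogs X"
  define G where "G a x z Y = snd a \<cdot> f ((x \<odot> z) # Y) - f (((a \<odot> x) \<odot> z) # Y)" for a x z Y
  have eq: "left_defect (lie f) X a x =
      (snd a \<cdot> (snd x \<cdot> f X) - (snd a \<cdot> snd x) \<cdot> f X) - front_sum X (G a x)"
    if "homog a" "homog x" for a x
    using that h by (simp add: left_defect_def lie_eq_front_sum[OF S] mul_diff mul_front_sum G_def[abs_def] front_sum_diff)
  have Gsym: "G a x z Y = sg (fst a * fst x) (G x a z Y)" if zY: "homog z" "homogs Y" for z Y
  proof -
    let ?t = "sg (fst z * (par Y + e))"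
    let ?i = "fst a + fst x + fst z"
    have G: "G a x z Y = sg (fst a * fst x) (?t (left_defect f Y x a \<cdot> snd z)) +
        f ((fst a + fst x + fst z, snd a \<cdot> (snd x \<cdot> snd z) - (snd a \<cdot> snd x) \<cdot> snd z) # Y)"
      if hax: "homog a" "homog x" for a x
    proof -
      have "f ((fst a + fst x + fst z, snd a \<cdot> (snd x \<cdot> snd z) - (snd a \<cdot> snd x) \<cdot> snd z) # Y) =
          f ((a \<odot> (x \<odot> z)) # Y) - f (((a \<odot> x) \<odot> z) # Y)"
        using supermultilinear_diff[OF S, of "snd (a \<odot> (x \<odot> z))" "fst a + fst x + fst z" "snd (a \<odot> x \<odot> z)" Y]
          homog_tmul[OF hax(1) homog_tmul[OF hax(2) zY(1)]] homog_tmul[OF homog_tmul[OF hax] zY(1)] zY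
        by (simp add: tmul_def add.assoc)
      then have "G a x z Y = left_defect f Y a (x \<odot> z) +
          f ((fst a + fst x + fst z, snd a \<cdot> (snd x \<cdot> snd z) - (snd a \<cdot> snd x) \<cdot> snd z) # Y)"
        by (simp add: G_def left_defect_def)
      also have "left_defect f Y a (x \<odot> z) = sg (fst a * (fst x + fst z)) (left_defect f Y (x \<odot> z) a)"
        using left_symD[OF L, of a "x \<odot> z" Y] hax zY by simp
      also have "left_defect f Y (x \<odot> z) a = sg (fst z * (fst a + par Y + e)) (left_defect f Y x a \<cdot> snd z)"
      proof -
        have 1: "(snd x \<cdot> snd z) \<cdot> f (a # Y) = sg (fst z * (fst a + par Y + e)) ((snd x \<cdot> f (a # Y)) \<cdot> snd z)"
          using rcomm[OF hax(2) zY(1), of "tagged e f (a # Y)"] homog_tagged[OF S, of "a # Y"] hax zY by simp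
        have xza: "(x \<odot> z) \<odot> a = (fst x + fst a + fst z, sg (fst z * fst a) (snd ((x \<odot> a) \<odot> z)))"
          using rcomm[OF hax(2) zY(1) hax(1)] by (simp add: tmul_def ac_simps)
        have "f (((x \<odot> z) \<odot> a) # Y) = sg (fst z * fst a) (f (((x \<odot> a) \<odot> z) # Y))"
          using supermultilinear_sg[OF S, of "snd ((x \<odot> a) \<odot> z)" "fst x + fst a + fst z" Y] hax zY
            homog_tmul[OF homog_tmul[OF hax(2,1)] zY(1)]
          by (simp add: xza homog_def) (simp add: tmul_def)
        also have "f (((x \<odot> a) \<odot> z) # Y) = sg (fst z * (par Y + e)) (f ((x \<odot> a) # Y) \<cdot> snd z)"
          using right_commD[OF C, of "x \<odot> a" z Y] hax zY by simp
        finally have 2: "f (((x \<odot> z) \<odot> a) # Y) =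
            sg (fst z * (fst a + par Y + e)) (f ((x \<odot> a) # Y) \<cdot> snd z)"
          by (simp add: sign_simps)
        show ?thesis by (simp add: left_defect_def 1 2 mul_diff sg_diff)
      qed
      also have "sg (fst a * (fst x + fst z)) (sg (fst z * (fst a + par Y + e)) (left_defect f Y x a \<cdot> snd z))
          = sg (fst a * fst x) (?t (left_defect f Y x a \<cdot> snd z))"
        by (simp add: sign_simps)
      finally show ?thesis .
    qed
    have "snd a \<cdot> (snd x \<cdot> snd z) - (snd a \<cdot> snd x) \<cdot> snd z
        = sg (fst a * fst x) (snd x \<cdot> (snd a \<cdot> snd z) - (snd x \<cdot> snd a) \<cdot> snd z)"
      by (rule lsym) (use h zY in auto)
    moreover have "snd x \<cdot> (snd a \<cdot> snd z) - (snd x \<cdot> snd a) \<cdot> snd z \<in> prt ?i"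
      using homog_tmul[OF h(2) homog_tmul[OF h(1) zY(1)]] homog_tmul[OF homog_tmul[OF h(2,1)] zY(1)]
      by (simp add: homog_def ac_simps)
    ultimately have "f ((?i, snd a \<cdot> (snd x \<cdot> snd z) - (snd a \<cdot> snd x) \<cdot> snd z) # Y)
        = sg (fst a * fst x) (f ((?i, snd x \<cdot> (snd a \<cdot> snd z) - (snd x \<cdot> snd a) \<cdot> snd z) # Y))"
      using supermultilinear_sg[OF S _ zY(2)] by simp
    moreover have "left_defect f Y x a = sg (fst a * fst x) (left_defect f Y a x)"
      using left_symD[OF L h(2,1) zY(2)] by (simp add: mult.commute)
    ultimately show ?thesis
      using G[OF h(1,2)] G[OF h(2,1)] by (simp add: sg_add add.commute[of "fst x" "fst a"] mult.commute[of "fst x" "fst a"])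
        (simp add: sg_sg bit_self_cancel ac_simps)
  qed
  have "front_sum X (G a x) = front_sum X (\<lambda>z Y. sg (fst a * fst x) (G x a z Y))"
    by (rule front_sum_cong[where P = homog]) (use Gsym h in auto)
  also have "\<dots> = sg (fst a * fst x) (front_sum X (G x a))"
    by (rule front_sum_sg)
  finally have "front_sum X (G a x) = sg (fst a * fst x) (front_sum X (G x a))" .
  moreover have "snd a \<cdot> (snd x \<cdot> f X) - (snd a \<cdot> snd x) \<cdot> f X
      = sg (fst a * fst x) (snd x \<cdot> (snd a \<cdot> f X) - (snd x \<cdot> snd a) \<cdot> f X)"
    using lsym[OF h(1,2), of "tagged e f X"] homog_tagged[OF S h(3)] by simp
  ultimately show "left_defect (lie f) X a x = sg (fst a * fst x) (left_defect (lie f) X x a)"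
    by (simp add: eq h sg_diff)
qed

lemma good_lie: "good e f \<Longrightarrow> good e (lie f)"
  using supermultilinear_lie right_comm_lie left_sym_lie by (simp add: good_def[of e "lie f"])

section \<open>The operations defined by differentiated letters\<close>

definition rmul :: "'g elt \<Rightarrow> 'g elt list \<Rightarrow> 'g" where
  "rmul y xs = (case xs of [x] \<Rightarrow> snd x \<cdot> snd y | _ \<Rightarrow> 0)"

lemma rmul_simps [simp]:
  "rmul y [] = 0" "rmul y [x] = snd x \<cdot> snd y" "rmul y (x # x' # xs) = 0"
  by (simp_all add: rmul_def)

lemma good_rmul:
  assumes y: "homog y"
  shows "good (fst y) (rmul y)"
proof -
  have "supermultilinear (fst y) (rmul y)"
    unfolding supermultilinear_def
  proof (intro conjI allI impI ballI)
    fix xs assume "homogs xs"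
    then show "rmul y xs \<in> prt (par xs + fst y)"
      using y by (auto simp: rmul_def homog_def split: list.split)
  next
    fix p q :: "'g elt list" and u v
    have "rmul y (p @ u # v # q) = 0" for u v by (cases p; cases "tl p") auto
    then show "rmul y (p @ u # v # q) = sg (fst u * fst v) (rmul y (p @ v # u # q))" by simp
  next
    fix i a b and X :: "'g elt list"
    show "rmul y ((i, a + b) # X) = rmul y ((i, a) # X) + rmul y ((i, b) # X)"
      by (cases X) (auto simp: mul_add_left)
  next
    fix i a \<phi> and X :: "'g elt list" assume "\<phi> \<in> scalars"
    then show "rmul y ((i, \<phi> a) # X) = \<phi> (rmul y ((i, a) # X))"
      by (cases X) (auto simp: scalar_mul_left scalar_zero)
  qed
  moreover have "right_comm (fst y) (rmul y)"
    unfolding right_comm_def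
  proof (intro allI impI)
    fix a z and X :: "'g elt list" assume "homog a" "homog z"
    then show "rmul y ((a \<odot> z) # X) = sg (fst z * (par X + fst y)) (rmul y (a # X) \<cdot> snd z)"
      using rcomm[of a z y] y by (cases X) (auto)
  qed
  moreover have "left_sym (rmul y)"
    unfolding left_sym_def
  proof (intro allI impI)
    fix a x and X :: "'g elt list" assume "homog a" "homog x"
    then show "left_defect (rmul y) X a x = sg (fst a * fst x) (left_defect (rmul y) X x a)"
      using lsym[of a x y] y by (cases X) (auto simp: left_defect_def)
  qed
  ultimately show ?thesis by (simp add: good_def)
qed

lemma commuting_rmul:
  assumes f: "good e f" and y: "homog y"
  shows "commuting (fst y) (rmul y) e f"
  unfolding commuting_def
proof (intro allI impI)
  have S: "supermultilinear e f" and C: "right_comm e f" using f by (auto simp: good_def)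
  fix x Y Z assume h: "homog x" "homogs Y" "homogs Z"
  show "f (tagged (fst y) (rmul y) (x # Y) # Z) =
      sg ((par Y + fst y) * (par Z + e)) (rmul y (tagged e f (x # Z) # Y))"
  proof (cases Y)
    case Nil
    have "tagged (fst y) (rmul y) [x] = x \<odot> y" by (simp add: tagged_def tmul_def)
    then show ?thesis using right_commD[OF C h(1) y h(3)] by (simp add: Nil)
  next
    case (Cons u Y')
    then show ?thesis using supermultilinear_zero[OF S h(3)] by (simp add: tagged_def)
  qed
qed

lemma commuting_sym:
  assumes "commuting e g e' f"
  shows "commuting e' f e g"
  unfolding commuting_def
proof (intro allI impI)
  fix x Y Z assume "homog x" "homogs Y" "homogs Z"
  then show "g (tagged e' f (x # Y) # Z) = sg ((par Y + e') * (par Z + e)) (f (tagged e g (x # Z) # Y))"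
    using commutingD[OF assms, of x Z Y] by (simp add: mult.commute[of "par Y + e'"])
qed

text \<open>
  The operation of multiplication by the \<open>n + 1\<close>-st derivative of \<open>y\<close>, on \<open>n + 1\<close> arguments.
\<close>

primrec letter_op :: "nat \<Rightarrow> 'g elt \<Rightarrow> 'g elt list \<Rightarrow> 'g" where
  "letter_op 0 y = rmul y"
| "letter_op (Suc n) y = lie (letter_op n y)"

lemma good_letter_op: "homog y \<Longrightarrow> good (fst y) (letter_op n y)"
  by (induction n) (simp_all add: good_rmul good_lie)

lemma commuting_letter_op:
  assumes "homog y" "homog y'"
  shows "commuting (fst y) (letter_op n y) (fst y') (letter_op m y')"
proof (induction m)
  case 0
  show ?case using commuting_sym[OF commuting_rmul[OF good_letter_op[OF assms(1)] assms(2)]] by simp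
next
  case (Suc m)
  then show ?case
    using commuting_lie[of "fst y'" "letter_op m y'" "fst y" "letter_op n y"] good_letter_op assms by (auto simp: good_def)
qed

lemma lie_length:
  assumes "\<And>xs. length xs \<noteq> n \<Longrightarrow> f xs = 0" "length xs \<noteq> Suc n"
  shows "lie f xs = 0"
proof (cases xs)
  case (Cons a X)
  have "slot_sum X a f = 0" if "\<And>xs. length xs = length X \<Longrightarrow> f xs = 0" for X and f :: "'g elt list \<Rightarrow> 'g"
    using that by (induction X arbitrary: f) auto
  then show ?thesis using assms Cons by (simp add: lie.simps)
qed simp

lemma letter_op_length: "length xs \<noteq> Suc n \<Longrightarrow> letter_op n y xs = 0"
proof (induction n arbitrary: xs)
  case 0
  then show ?case by (cases xs; cases "tl xs") auto
next
  case (Suc n)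
  then show ?case using lie_length[of "Suc n" "letter_op n y"] by simp
qed

end

section \<open>Words and their derivatives\<close>

text \<open>
  A letter \<open>(x, n)\<close> stands for the \<open>n\<close>-th derivative of the element \<open>x\<close> with its parity.
\<close>

type_synonym 'g letter = "'g elt \<times> nat"

definition wpar :: "'g letter list \<Rightarrow> bit" where "wpar w = par (map fst w)"

definition ord :: "'g letter list \<Rightarrow> nat" where "ord w = sum_list (map snd w)"

lemma wpar_simps [simp]: "wpar [] = 0" "wpar (l # w) = fst (fst l) + wpar w" "wpar (v @ w) = wpar v + wpar w"
  by (simp_all add: wpar_def)

lemma ord_simps [simp]: "ord [] = 0" "ord (l # w) = snd l + ord w" "ord (v @ w) = ord v + ord w"
  by (simp_all add: ord_def)

text \<open>
  The derivative of a word is the sum of the words in which one order is raised; a function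
  \<open>h\<close> on words is applied to it. Working with functions instead of formal sums keeps words
  free of coefficients.
\<close>

primrec raise_sum :: "'g letter list \<Rightarrow> ('g letter list \<Rightarrow> 'h::ab_group_add) \<Rightarrow> 'h" where
  "raise_sum [] = (\<lambda>h. 0)"
| "raise_sum (l # w) = (\<lambda>h. h ((fst l, Suc (snd l)) # w) + raise_sum w (\<lambda>w. h (l # w)))"

definition ddx :: "('g letter list \<Rightarrow> 'h::ab_group_add) \<Rightarrow> 'g letter list \<Rightarrow> 'h" where
  "ddx h w = raise_sum w h"

lemma raise_sum_append:
  "raise_sum (u @ v) h = raise_sum u (\<lambda>u. h (u @ v)) + raise_sum v (\<lambda>v. h (u @ v))"
  by (induction u arbitrary: h) (simp_all add: add.assoc)

lemma raise_sum_cong: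
  "(\<And>v. map fst v = map fst w \<Longrightarrow> ord v = Suc (ord w) \<Longrightarrow> h v = h' v) \<Longrightarrow> raise_sum w h = raise_sum w h'"
proof (induction w arbitrary: h h')
  case (Cons l w)
  have "raise_sum w (\<lambda>w. h (l # w)) = raise_sum w (\<lambda>w. h' (l # w))"
    by (rule Cons.IH, rule Cons.prems) simp_all
  moreover have "h ((fst l, Suc (snd l)) # w) = h' ((fst l, Suc (snd l)) # w)"
    by (rule Cons.prems) simp_all
  ultimately show ?case by simp
qed simp

lemma raise_sum_add: "raise_sum w (\<lambda>v. h v + h' v) = raise_sum w h + raise_sum w h'"
  by (induction w arbitrary: h h') (simp_all add: algebra_simps)

lemma raise_sum_zero: "raise_sum w (\<lambda>v. 0) = 0"
  by (induction w) simp_all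

lemma raise_sum_additive:
  assumes "\<And>x y. \<phi> (x + y) = \<phi> x + \<phi> y"
  shows "\<phi> (raise_sum w h) = raise_sum w (\<lambda>v. \<phi> (h v))"
proof -
  have "\<phi> 0 = 0" using assms[of 0 0] by simp
  then show ?thesis by (induction w arbitrary: h) (simp_all add: assms)
qed

lemma raise_sum_sg: "raise_sum w (\<lambda>v. sg b (h v)) = sg b (raise_sum w h)"
  by (rule raise_sum_additive[symmetric]) (rule sg_add)

lemma raise_sum_swap:
  "raise_sum u (\<lambda>a. raise_sum v (\<lambda>b. h a b)) = raise_sum v (\<lambda>b. raise_sum u (\<lambda>a. h a b))"
  by (induction u arbitrary: h) (simp_all add: raise_sum_zero raise_sum_add)

text \<open>
  Differentiation changes nothing but orders, so only words with the same entries matter.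
\<close>

lemma ddx_funpow_cong:
  "(\<And>v. map fst v = map fst u \<Longrightarrow> ord v = ord u + n \<Longrightarrow> h v = h' v) \<Longrightarrow> (ddx ^^ n) h u = (ddx ^^ n) h' u"
proof (induction n arbitrary: u)
  case (Suc n)
  show ?case unfolding funpow.simps comp_def ddx_def[of "(ddx ^^ n) _"]
    by (intro raise_sum_cong Suc.IH Suc.prems) auto
qed simp

lemma ddx_funpow_additive:
  assumes "\<And>x y. \<phi> (x + y) = \<phi> x + \<phi> y"
  shows "\<phi> ((ddx ^^ n) h u) = (ddx ^^ n) (\<lambda>v. \<phi> (h v)) u"
  by (induction n arbitrary: u) (simp_all add: ddx_def raise_sum_additive[of \<phi>, OF assms])

lemma ddx_add: "ddx (\<lambda>v. h v + h' v) u = ddx h u + ddx h' u"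
  by (simp add: ddx_def raise_sum_add)

lemma ddx_raise_sum: "ddx (\<lambda>u. raise_sum v (h u)) u = raise_sum v (\<lambda>b. ddx (\<lambda>u. h u b) u)"
  unfolding ddx_def by (rule raise_sum_swap)

lemma ddx_funpow_add: "(ddx ^^ n) (\<lambda>v. h v + h' v) u = (ddx ^^ n) h u + (ddx ^^ n) h' u"
proof (induction n arbitrary: u)
  case (Suc n)
  then have "(ddx ^^ n) (\<lambda>v. h v + h' v) = (\<lambda>u. (ddx ^^ n) h u + (ddx ^^ n) h' u)" by (rule ext)
  then show ?case by (simp add: ddx_add)
qed simp

lemma ddx_funpow_sg: "(ddx ^^ n) (\<lambda>v. sg b (h v)) u = sg b ((ddx ^^ n) h u)"
  by (rule ddx_funpow_additive[symmetric]) (rule sg_add)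

lemma ddx_funpow_raise_sum:
  "(ddx ^^ n) (\<lambda>u. raise_sum v (h u)) u = raise_sum v (\<lambda>b. (ddx ^^ n) (\<lambda>u. h u b) u)"
proof (induction n arbitrary: u)
  case (Suc n)
  then have "(ddx ^^ n) (\<lambda>u. raise_sum v (h u)) = (\<lambda>u. raise_sum v (\<lambda>b. (ddx ^^ n) (\<lambda>u. h u b) u))" by (rule ext)
  then show ?case by (simp add: ddx_raise_sum)
qed simp

context novikov
begin

definition valid :: "'g letter list \<Rightarrow> bool" where "valid w \<longleftrightarrow> homogs (map fst w)"

lemma valid_simps [simp]:
  "valid []" "valid (l # w) \<longleftrightarrow> homog (fst l) \<and> valid w" "valid (v @ w) \<longleftrightarrow> valid v \<and> valid w"
  by (simp_all add: valid_def)

text \<open>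
  These are the functions that descend to words in supercommuting letters.
\<close>

definition supersym :: "('g letter list \<Rightarrow> 'g) \<Rightarrow> bool" where
  "supersym h \<longleftrightarrow> (\<forall>p l m q. valid (p @ l # m # q) \<longrightarrow>
     h (p @ l # m # q) = sg (fst (fst l) * fst (fst m)) (h (p @ m # l # q)))"

lemma supersymD: "supersym h \<Longrightarrow> valid (p @ l # m # q) \<Longrightarrow>
    h (p @ l # m # q) = sg (fst (fst l) * fst (fst m)) (h (p @ m # l # q))"
  unfolding supersym_def by blast

lemma supersymI: "(\<And>p l m q. valid (p @ l # m # q) \<Longrightarrow>
    h (p @ l # m # q) = sg (fst (fst l) * fst (fst m)) (h (p @ m # l # q))) \<Longrightarrow> supersym h"
  unfolding supersym_def by blast

lemma supersym_left: assumes "supersym h" "valid u" shows "supersym (\<lambda>w. h (u @ w))"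
proof (rule supersymI)
  fix p l m q assume "valid (p @ l # m # q)"
  then show "h (u @ p @ l # m # q) = sg (fst (fst l) * fst (fst m)) (h (u @ p @ m # l # q))"
    using supersymD[OF assms(1), of "u @ p" l m q] assms(2) by simp
qed

lemma supersym_right: assumes "supersym h" "valid u" shows "supersym (\<lambda>w. h (w @ u))"
proof (rule supersymI)
  fix p l m q assume "valid (p @ l # m # q)"
  then show "h ((p @ l # m # q) @ u) = sg (fst (fst l) * fst (fst m)) (h ((p @ m # l # q) @ u))"
    using supersymD[OF assms(1), of p l m "q @ u"] assms(2) by simp
qed

lemma supersym_front:
  assumes "supersym h" "valid (p @ l # q)"
  shows "h (p @ l # q) = sg (wpar p * fst (fst l)) (h (l # p @ q))"
  using assms(2)
proof (induction p arbitrary: q rule: rev_induct)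
  case (snoc m p)
  have "h (p @ m # l # q) = sg (fst (fst m) * fst (fst l)) (h (p @ l # m # q))"
    using snoc.prems by (intro supersymD[OF assms(1)]) auto
  then show ?case using snoc.IH[of "m # q"] snoc.prems by (simp add: sign_simps)
qed simp

lemma supersym_blocks:
  assumes "supersym h" "valid (u @ v)"
  shows "h (u @ v) = sg (wpar u * wpar v) (h (v @ u))"
  using assms(2)
proof (induction u arbitrary: v)
  case (Cons l u)
  have "h ([l] @ u @ v) = sg ((wpar u + fst (fst l)) * wpar v) (h ((v @ [l]) @ u))"
  proof -
    have "h (u @ v @ [l]) = sg (wpar u * (wpar v + fst (fst l))) (h ((v @ [l]) @ u))"
      using Cons.IH[of "v @ [l]"] Cons.prems by simp
    moreover have "h ((u @ v) @ l # []) = sg (wpar (u @ v) * fst (fst l)) (h (l # (u @ v) @ []))"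
      by (rule supersym_front[OF assms(1)]) (use Cons.prems in auto)
    ultimately have "sg (wpar (u @ v) * fst (fst l)) (h (l # u @ v)) =
        sg (wpar u * (wpar v + fst (fst l))) (h ((v @ [l]) @ u))" by simp
    then have "sg (wpar (u @ v) * fst (fst l)) (sg (wpar (u @ v) * fst (fst l)) (h (l # u @ v))) =
        sg (wpar (u @ v) * fst (fst l)) (sg (wpar u * (wpar v + fst (fst l))) (h ((v @ [l]) @ u)))"
      by (rule arg_cong)
    then show ?thesis by (simp add: sg_sg) (simp add: sign_simps)
  qed
  then show ?case by (simp add: sign_simps)
qed simp

lemma supersym_ddx:
  assumes "supersym h"
  shows "supersym (ddx h)"
proof (rule supersymI)
  fix p l m q assume v: "valid (p @ l # m # q)"
  let ?s = "fst (fst l) * fst (fst m)"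
  have E: "raise_sum (p @ l # m # q) h = raise_sum p (\<lambda>p. h (p @ l # m # q)) +
      (h (p @ (fst l, Suc (snd l)) # m # q) + (h (p @ l # (fst m, Suc (snd m)) # q) +
       raise_sum q (\<lambda>q. h (p @ l # m # q))))" for l m
    by (simp add: raise_sum_append)
  have "raise_sum p (\<lambda>p. h (p @ l # m # q)) = raise_sum p (\<lambda>p. sg ?s (h (p @ m # l # q)))"
    by (intro raise_sum_cong supersymD[OF assms]) (use v in \<open>auto simp: valid_def\<close>)
  moreover have "raise_sum q (\<lambda>q. h (p @ l # m # q)) = raise_sum q (\<lambda>q. sg ?s (h (p @ m # l # q)))"
    by (intro raise_sum_cong supersymD[OF assms]) (use v in \<open>auto simp: valid_def\<close>)
  moreover have "h (p @ (fst l, Suc (snd l)) # m # q) = sg ?s (h (p @ m # (fst l, Suc (snd l)) # q))"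
    using supersymD[OF assms, of p "(fst l, Suc (snd l))" m q] v by simp
  moreover have "h (p @ l # (fst m, Suc (snd m)) # q) = sg ?s (h (p @ (fst m, Suc (snd m)) # l # q))"
    using supersymD[OF assms, of p l "(fst m, Suc (snd m))" q] v by simp
  ultimately show "ddx h (p @ l # m # q) = sg ?s (ddx h (p @ m # l # q))"
    by (simp only: ddx_def E raise_sum_sg sg_add) (simp add: ac_simps)
qed

text \<open>
  The exponent of the sign that moves all letters of order zero to the left.
\<close>

primrec sort_sign :: "'g letter list \<Rightarrow> bit" where
  "sort_sign [] = 0"
| "sort_sign (l # w) = sort_sign w + (if snd l = 0 then 0 else fst (fst l) * wpar (filter (\<lambda>l. snd l = 0) w))"

abbreviation zeros :: "'g letter list \<Rightarrow> 'g letter list" where "zeros w \<equiv> filter (\<lambda>l. snd l = 0) w"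
abbreviation nonzeros :: "'g letter list \<Rightarrow> 'g letter list" where "nonzeros w \<equiv> filter (\<lambda>l. 0 < snd l) w"

lemma valid_filter: "valid w \<Longrightarrow> valid (filter P w)"
  by (induction w) auto

lemma supersym_sort:
  assumes "supersym h" "valid w"
  shows "h w = sg (sort_sign w) (h (zeros w @ nonzeros w))"
  using assms
proof (induction w arbitrary: h)
  case (Cons l w)
  have "h ([l] @ w) = sg (sort_sign w) (h ([l] @ zeros w @ nonzeros w))"
    using Cons.IH[OF supersym_left[OF Cons.prems(1), of "[l]"]] Cons.prems by simp
  moreover have "h ([l] @ zeros w @ nonzeros w) = sg (fst (fst l) * wpar (zeros w)) (h ((zeros w @ [l]) @ nonzeros w))"
    using supersym_blocks[OF supersym_right[OF Cons.prems(1), of "nonzeros w"], of "[l]" "zeros w"] Cons.prems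
    by (simp add: valid_filter)
  ultimately show ?case by (auto simp: sg_sg)
qed simp

lemma sort_sign_append: "sort_sign (u @ v) = sort_sign u + wpar (nonzeros u) * wpar (zeros v) + sort_sign v"
  by (induction u) (simp_all add: algebra_simps)


lemma supermultilinear_sg_elt:
  assumes "supermultilinear e f" "homog u" "homogs X"
  shows "f ((fst u, sg b (snd u)) # X) = sg b (f (u # X))"
  using supermultilinear_sg[OF assms(1), of "snd u" "fst u" X] assms by (simp add: homog_def)

section \<open>Products of the operations\<close>

text \<open>
  The product \<open>g f\<close> of operations, where \<open>g\<close> takes \<open>k\<close> arguments: \<open>g\<close> is applied to the first \<open>k\<close>
  arguments, and \<open>f\<close> to the result and the remaining ones. The sign moves \<open>g\<close> past the latter.
\<close>

definition feed :: "nat \<Rightarrow> bit \<Rightarrow> ('g elt list \<Rightarrow> 'g) \<Rightarrow> ('g elt list \<Rightarrow> 'g) \<Rightarrow> 'g elt list \<Rightarrow> 'g" where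
  "feed k e g f xs = sg (e * par (drop k xs)) (f (tagged e g (take k xs) # drop k xs))"

lemma feed_append: "length xs = k \<Longrightarrow> feed k e g f (xs @ zs) = sg (e * par zs) (f (tagged e g xs # zs))"
  by (simp add: feed_def)

lemma homogs_take_drop: "homogs xs \<Longrightarrow> homogs (take k xs)" "homogs xs \<Longrightarrow> homogs (drop k xs)"
  by (auto simp: list_all_iff dest: in_set_takeD in_set_dropD)

text \<open>
  Supersymmetry within the arguments of \<open>g\<close> and among those of \<open>f\<close> is clear. Across the border,
  the last argument of \<open>g\<close> is moved to its front, and there commutation of \<open>g\<close> with \<open>f\<close> turns it
  into an argument of \<open>f\<close> next to the other one.
\<close>

lemma supermultilinear_feed:
  assumes g: "supermultilinear e g" and f: "supermultilinear e' f" and c: "commuting e g e' f" and k: "k \<noteq> 0"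
  shows "supermultilinear (e + e') (feed k e g f)"
proof -
  have closed: "feed k e g f xs \<in> prt (par xs + (e + e'))" if h: "homogs xs" for xs
  proof -
    have "f (tagged e g (take k xs) # drop k xs) \<in> prt (par (take k xs) + e + par (drop k xs) + e')"
      using supermultilinearD(1)[OF f, of "tagged e g (take k xs) # drop k xs"] homog_tagged[OF g] homogs_take_drop[OF h] by simp
    moreover have "par xs = par (take k xs) + par (drop k xs)"
      by (metis append_take_drop_id par_simps(3))
    ultimately show ?thesis by (simp add: feed_def ac_simps)
  qed
  have swap: "feed k e g f (p @ x # y # q) = sg (fst x * fst y) (feed k e g f (p @ y # x # q))"
    if h: "homogs (p @ x # y # q)" for p x y q
  proof -
    \<comment> \<open>the exchanged arguments belong both to \<open>f\<close>, one to each, or both to \<open>g\<close>\<close>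
    consider "k \<le> length p" | "k = Suc (length p)" | "Suc (Suc (length p)) \<le> k" by linarith
    then show ?thesis
    proof cases
      case 1
      define p1 p2 where "p1 = take k p" and "p2 = drop k p"
      have p: "p = p1 @ p2" "length p1 = k" using 1 by (auto simp: p1_def p2_def)
      have "f ((tagged e g p1 # p2) @ x # y # q) = sg (fst x * fst y) (f ((tagged e g p1 # p2) @ y # x # q))"
        by (rule supermultilinearD(2)[OF f]) (use h p homog_tagged[OF g] in auto)
      then show ?thesis using p by (simp add: feed_append sign_simps)
    next
      case 2
      have E: "feed k e g f (p @ x # y # q) = sg (fst x * par p + e * (fst y + par q) + (par p + e) * (fst y + par q + e'))
          (g (tagged e' f (x # y # q) # p))" if h: "homogs (p @ x # y # q)" for x y
      proof -
        have "g (p @ [x]) = sg (par p * fst x) (g (x # p))"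
          using supermultilinear_front[OF g, of p x "[]"] h by simp
        then have v: "tagged e g (p @ [x]) = (fst x + par p + e, sg (par p * fst x) (g (x # p)))"
          "tagged e g (x # p) = (fst x + par p + e, g (x # p))"
          by (simp_all add: tagged_def ac_simps)
        have "g (x # p) \<in> prt (fst x + par p + e)"
          using supermultilinearD(1)[OF g, of "x # p"] h by simp
        then have "f (tagged e g (p @ [x]) # y # q) = sg (par p * fst x) (f (tagged e g (x # p) # y # q))"
          unfolding v by (rule supermultilinear_sg[OF f]) (use h in auto)
        also have "f (tagged e g (x # p) # y # q) = sg ((par p + e) * (par (y # q) + e')) (g (tagged e' f (x # y # q) # p))"
          by (rule commutingD[OF c]) (use h in auto)
        finally have "f (tagged e g (p @ [x]) # y # q) =
            sg (par p * fst x + (par p + e) * (fst y + par q + e')) (g (tagged e' f (x # y # q) # p))"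
          by (simp add: sg_sg)
        then show ?thesis
          using feed_append[of "p @ [x]" k e g f "y # q"] 2 by (simp add: sg_sg ac_simps)
      qed
      have "f ([] @ x # y # q) = sg (fst x * fst y) (f ([] @ y # x # q))"
        by (rule supermultilinearD(2)[OF f]) (use h in auto)
      then have "tagged e' f (x # y # q) = (fst (tagged e' f (y # x # q)), sg (fst x * fst y) (snd (tagged e' f (y # x # q))))"
        by (simp add: tagged_def ac_simps)
      then have "g (tagged e' f (x # y # q) # p) = sg (fst x * fst y) (g (tagged e' f (y # x # q) # p))"
        using supermultilinear_sg_elt[OF g homog_tagged[OF f], of "y # x # q" p] h by simp
      then show ?thesis using E[of x y] E[of y x] h by (simp add: sign_simps)
    next
      case 3
      define q1 q2 where "q1 = take (k - Suc (Suc (length p))) q" and "q2 = drop (k - Suc (Suc (length p))) q"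
      have q: "take k (p @ x # y # q) = p @ x # y # q1" "drop k (p @ x # y # q) = q2" for x y
        using 3 by (auto simp: q1_def q2_def take_Cons' drop_Cons' numeral_2_eq_2)
      have hq: "homogs q1" "homogs q2" using h homogs_take_drop by (auto simp: q1_def q2_def)
      have gs: "g (p @ x # y # q1) = sg (fst x * fst y) (g (p @ y # x # q1))"
        by (rule supermultilinearD(2)[OF g]) (use h hq in auto)
      have "g (p @ y # x # q1) \<in> prt (par (p @ y # x # q1) + e)"
        by (rule supermultilinearD(1)[OF g]) (use h hq in auto)
      then have "f (tagged e g (p @ x # y # q1) # q2) = sg (fst x * fst y) (f (tagged e g (p @ y # x # q1) # q2))"
        using supermultilinear_sg[OF f, of "g (p @ y # x # q1)" _ q2] hq by (simp add: tagged_def gs ac_simps)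
      then show ?thesis unfolding feed_def q by (simp add: sign_simps)
    qed
  qed
  obtain k' where k': "k = Suc k'" using k by (cases k) auto
  have add: "feed k e g f ((i, a + b) # X) = feed k e g f ((i, a) # X) + feed k e g f ((i, b) # X)"
    if h: "a \<in> prt i" "b \<in> prt i" "homogs X" for i a b X
    using h supermultilinearD(1)[OF g, of "(i, a) # take k' X"] supermultilinearD(1)[OF g, of "(i, b) # take k' X"]
    by (simp add: feed_def k' tagged_def supermultilinearD(3)[OF g] supermultilinearD(3)[OF f] homogs_take_drop sg_add)
  have scal: "feed k e g f ((i, \<phi> a) # X) = \<phi> (feed k e g f ((i, a) # X))"
    if h: "\<phi> \<in> scalars" "a \<in> prt i" "homogs X" for i a X \<phi>
    using h supermultilinearD(1)[OF g, of "(i, a) # take k' X"] scalar_uminus[OF h(1)]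
    by (simp add: feed_def k' tagged_def supermultilinearD(4)[OF g] supermultilinearD(4)[OF f] homogs_take_drop sg_def)
  show ?thesis unfolding supermultilinear_def using closed swap add scal by blast
qed

lemma commuting_feed:
  assumes g: "supermultilinear e g" and f: "supermultilinear e' f" and t: "supermultilinear e'' t" and k: "k \<noteq> 0"
    and tg: "commuting e'' t e g" and tf: "commuting e'' t e' f"
  shows "commuting e'' t (e + e') (feed k e g f)"
  unfolding commuting_def
proof (intro allI impI)
  fix x Y Z assume h: "homog x" "homogs Y" "homogs Z"
  obtain k' where k': "k = Suc k'" using k by (cases k) auto
  define A B where "A = take k' Z" and "B = drop k' Z"
  have Z: "Z = A @ B" "homogs A" "homogs B" using h(3) by (auto simp: A_def B_def homogs_take_drop)
  have S: "feed k e g f (u # Z) = sg (e * par B) (f (tagged e g (u # A) # B))" for u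
    by (simp add: feed_def k' A_def B_def)
  let ?u = "tagged e g (x # A)" and ?i = "fst x + par A + e + par Y + e''"
  have u: "homog ?u" by (rule homog_tagged[OF g]) (use h Z in auto)
  have "g (tagged e'' t (x # Y) # A) = sg ((par Y + e'') * (par A + e)) (t (?u # Y))"
    by (rule commutingD[OF tg]) (use h Z in auto)
  then have "tagged e g (tagged e'' t (x # Y) # A) = (?i, sg ((par Y + e'') * (par A + e)) (t (?u # Y)))"
    by (simp add: tagged_def ac_simps)
  moreover have "t (?u # Y) \<in> prt ?i" using supermultilinearD(1)[OF t, of "?u # Y"] u h by (simp add: ac_simps)
  ultimately have "f (tagged e g (tagged e'' t (x # Y) # A) # B) =
      sg ((par Y + e'') * (par A + e)) (f ((?i, t (?u # Y)) # B))"
    using supermultilinear_sg[OF f] Z(3) by simp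
  also have "(?i, t (?u # Y)) = tagged e'' t (?u # Y)" by (simp add: tagged_def)
  also have "f (tagged e'' t (?u # Y) # B) = sg ((par Y + e'') * (par B + e')) (t (tagged e' f (?u # B) # Y))"
    by (rule commutingD[OF tf u h(2) Z(3)])
  finally have 1: "feed k e g f (tagged e'' t (x # Y) # Z) = sg (e * par B) (sg ((par Y + e'') * (par A + e))
      (sg ((par Y + e'') * (par B + e')) (t (tagged e' f (?u # B) # Y))))"
    by (simp add: S)
  have "tagged (e + e') (feed k e g f) (x # Z) = (par (?u # B) + e', sg (e * par B) (f (?u # B)))"
    by (simp add: tagged_def S) (simp add: Z ac_simps)
  moreover have "f (?u # B) \<in> prt (par (?u # B) + e')" by (rule supermultilinearD(1)[OF f]) (use u Z in auto)
  ultimately have "t (tagged (e + e') (feed k e g f) (x # Z) # Y) = sg (e * par B) (t (tagged e' f (?u # B) # Y))"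
    using supermultilinear_sg[OF t _ h(2)] by (simp add: tagged_def ac_simps)
  then show "feed k e g f (tagged e'' t (x # Y) # Z) =
      sg ((par Y + e'') * (par Z + (e + e'))) (t (tagged (e + e') (feed k e g f) (x # Z) # Y))"
    by (simp add: 1) (simp add: Z sign_simps)
qed

text \<open>
  The product of all the operations given by a word in letters of positive order. The letter
  \<open>(y, k)\<close> acts through \<open>letter_op (k - 1) y\<close>, which has \<open>k\<close> arguments; the empty product is the
  identity operation on one argument.
\<close>

primrec ops_product :: "'g letter list \<Rightarrow> 'g elt list \<Rightarrow> 'g" where
  "ops_product [] = (\<lambda>xs. case xs of [x] \<Rightarrow> snd x | _ \<Rightarrow> 0)"
| "ops_product (l # w) = feed (snd l) (fst (fst l)) (letter_op (snd l - 1) (fst l)) (ops_product w)"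

definition differentiated :: "'g letter list \<Rightarrow> bool" where
  "differentiated w \<longleftrightarrow> valid w \<and> (\<forall>l\<in>set w. snd l \<noteq> 0)"

lemma differentiated_simps [simp]:
  "differentiated []" "differentiated (l # w) \<longleftrightarrow> homog (fst l) \<and> snd l \<noteq> 0 \<and> differentiated w"
  "differentiated (v @ w) \<longleftrightarrow> differentiated v \<and> differentiated w"
  by (auto simp: differentiated_def)

lemma supermultilinear_letter_op: "homog y \<Longrightarrow> supermultilinear (fst y) (letter_op n y)"
  using good_letter_op by (simp add: good_def)

lemma ops_product_Nil_simps [simp]:
  "ops_product [] [] = 0" "ops_product [] [x] = snd x" "ops_product [] (x # y # xs) = 0"
  by simp_all

lemma ops_product_Nil_append: "ops_product [] (p @ u # v # q) = 0"
  by (cases p; cases "tl p") auto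

text \<open>
  Supersymmetry of a product requires that its factors commute, so both statements are proved
  in the same induction.
\<close>

lemma supermultilinear_ops_product_aux:
  assumes "differentiated w"
  shows "supermultilinear (wpar w) (ops_product w) \<and> (\<forall>y n. homog y \<longrightarrow> commuting (fst y) (letter_op n y) (wpar w) (ops_product w))"
  using assms
proof (induction w)
  case Nil
  have "supermultilinear 0 (ops_product [])"
    unfolding supermultilinear_def
  proof (intro conjI allI impI ballI)
    fix xs assume "homogs xs"
    then show "ops_product [] xs \<in> prt (par xs + 0)"
      by (auto simp: homog_def split: list.split)
  next
    fix i a b and X :: "'g elt list"
    show "ops_product [] ((i, a + b) # X) = ops_product [] ((i, a) # X) + ops_product [] ((i, b) # X)"
      by (cases X) auto
  next
    fix i a \<phi> and X :: "'g elt list" assume "\<phi> \<in> scalars"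
    then show "ops_product [] ((i, \<phi> a) # X) = \<phi> (ops_product [] ((i, a) # X))"
      by (cases X) (auto simp: scalar_zero)
  qed (simp only: ops_product_Nil_append sg_simps)
  moreover have "commuting (fst y) (letter_op n y) 0 (ops_product [])" if y: "homog y" for y n
    unfolding commuting_def
  proof (intro allI impI)
    fix x Y Z assume "homog x" "homogs Y" "homogs Z"
    then show "ops_product [] (tagged (fst y) (letter_op n y) (x # Y) # Z) =
        sg ((par Y + fst y) * (par Z + 0)) (letter_op n y (tagged 0 (ops_product []) (x # Z) # Y))"
      using supermultilinear_zero[OF supermultilinear_letter_op[OF y]] by (cases Z) (simp_all add: tagged_def)
  qed
  ultimately show ?case by simp
next
  case (Cons l w)
  then have l: "homog (fst l)" "snd l \<noteq> 0" and S: "supermultilinear (wpar w) (ops_product w)"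
    and c: "\<And>y n. homog y \<Longrightarrow> commuting (fst y) (letter_op n y) (wpar w) (ops_product w)" by auto
  have "supermultilinear (wpar (l # w)) (ops_product (l # w))"
    using supermultilinear_feed[OF supermultilinear_letter_op[OF l(1)] S c[OF l(1)] l(2)] by simp
  moreover have "commuting (fst y) (letter_op n y) (wpar (l # w)) (ops_product (l # w))" if y: "homog y" for y n
    using commuting_feed[OF supermultilinear_letter_op[OF l(1)] S supermultilinear_letter_op[OF y] l(2) commuting_letter_op[OF y l(1)] c[OF y]] by simp
  ultimately show ?case by blast
qed

lemma supermultilinear_ops_product: "differentiated w \<Longrightarrow> supermultilinear (wpar w) (ops_product w)"
  using supermultilinear_ops_product_aux by blast

text \<open>
  A letter of order \<open>k\<close> replaces \<open>k\<close> arguments by one. A product is nonzero only if exactly one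
  element remains at the end.
\<close>

lemma ops_product_length:
  assumes "differentiated w" "homogs xs" "length xs + length w \<noteq> Suc (ord w)"
  shows "ops_product w xs = 0"
  using assms
proof (induction w arbitrary: xs)
  case Nil
  then show ?case by (auto split: list.split)
next
  case (Cons l w)
  let ?k = "snd l" and ?t = "letter_op (snd l - 1) (fst l)"
  have hd: "homogs (drop ?k xs)" "homogs (take ?k xs)" using Cons.prems homogs_take_drop by auto
  have "ops_product w (tagged (fst (fst l)) ?t (take ?k xs) # drop ?k xs) = 0"
  proof (cases "length xs < ?k")
    case True
    then have "?t (take ?k xs) = 0" using Cons.prems by (intro letter_op_length) auto
    then show ?thesis using supermultilinear_zero[OF supermultilinear_ops_product hd(1)] Cons.prems by (simp add: tagged_def)
  next
    case False
    then show ?thesis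
      using Cons.prems hd homog_tagged[OF supermultilinear_letter_op] by (intro Cons.IH) auto
  qed
  then show ?case by (simp add: feed_def)
qed

text \<open>
  With \<open>x, A, B\<close> the arguments that the two letters consume, commutation exchanges the letters
  together with \<open>A\<close> and \<open>B\<close>, and supersymmetry of the product restores the order of \<open>A\<close> and \<open>B\<close>.
\<close>

lemma ops_product_swap_front:
  assumes d: "differentiated (l # m # w)" and h: "homogs xs"
  shows "ops_product (l # m # w) xs = sg (fst (fst l) * fst (fst m)) (ops_product (m # l # w) xs)"
proof (cases "length xs + length (l # m # w) = Suc (ord (l # m # w))")
  case False
  then show ?thesis using ops_product_length[OF d h] ops_product_length[of "m # l # w" xs] d h by simp
next
  case len: True
  obtain a b where k: "snd l = Suc a" "snd m = Suc b" using d by (cases "snd l"; cases "snd m") auto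
  have dw: "length w \<le> ord w" using d
    by (induction w) (auto simp: Suc_le_eq intro: le_less_trans)
  \<comment> \<open>\<open>l\<close> consumes \<open>x\<close> and \<open>A\<close>, and \<open>m\<close> consumes the result and \<open>B\<close>\<close>
  obtain x A B R where xs: "xs = x # A @ B @ R" "length A = a" "length B = b"
  proof (cases xs)
    case Nil
    then show ?thesis using len k dw by simp
  next
    case (Cons x X)
    then have X: "length X \<ge> a + b" using len k dw by simp
    have "xs = x # take a X @ take b (drop a X) @ drop b (drop a X)"
      by (simp only: append_take_drop_id Cons)
    then show ?thesis by (rule that) (use X in auto)
  qed
  have hx: "homog x" "homogs A" "homogs B" "homogs R" using h xs by auto
  let ?e1 = "fst (fst l)" and ?e2 = "fst (fst m)"
  let ?t1 = "letter_op a (fst l)" and ?t2 = "letter_op b (fst m)"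
  have s: "ops_product (l # m # w) (x # A @ B @ R) = sg (?e1 * par (B @ R)) (sg (?e2 * par R)
      (ops_product w (tagged ?e2 ?t2 (tagged ?e1 ?t1 (x # A) # B) # R)))"
    using xs(2,3) by (simp add: k feed_def)
  have s': "ops_product (m # l # w) (x # B @ A @ R) = sg (?e2 * par (A @ R)) (sg (?e1 * par R)
      (ops_product w (tagged ?e1 ?t1 (tagged ?e2 ?t2 (x # B) # A) # R)))"
    using xs(2,3) by (simp add: k feed_def)
  have t: "supermultilinear ?e1 ?t1" "supermultilinear ?e2 ?t2" and fw: "supermultilinear (wpar w) (ops_product w)"
    using d supermultilinear_letter_op supermultilinear_ops_product by auto
  let ?u = "tagged ?e1 ?t1 (tagged ?e2 ?t2 (x # B) # A)"
  have u: "homog ?u" using homog_tagged[OF t(1)] homog_tagged[OF t(2)] hx by simp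
  have "?t2 (tagged ?e1 ?t1 (x # A) # B) = sg ((par A + ?e1) * (par B + ?e2)) (?t1 (tagged ?e2 ?t2 (x # B) # A))"
    by (rule commutingD[OF commuting_letter_op]) (use d hx in auto)
  then have "tagged ?e2 ?t2 (tagged ?e1 ?t1 (x # A) # B) = (fst ?u, sg ((par A + ?e1) * (par B + ?e2)) (snd ?u))"
    by (simp add: tagged_def ac_simps)
  then have "ops_product w (tagged ?e2 ?t2 (tagged ?e1 ?t1 (x # A) # B) # R) =
      sg ((par A + ?e1) * (par B + ?e2)) (ops_product w (?u # R))"
    using supermultilinear_sg_elt[OF fw u hx(4)] by simp
  moreover have "ops_product (m # l # w) ([x] @ A @ B @ R) = sg (par A * par B) (ops_product (m # l # w) ([x] @ B @ A @ R))"
    by (rule supermultilinear_blocks[OF supermultilinear_ops_product]) (use d hx in auto)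
  ultimately show ?thesis
    using s s' by (simp add: xs(1) del: ops_product.simps) (simp add: sign_simps)
qed

lemma ops_product_swap:
  assumes "differentiated (p @ l # m # w)" "homogs xs"
  shows "ops_product (p @ l # m # w) xs = sg (fst (fst l) * fst (fst m)) (ops_product (p @ m # l # w) xs)"
  using assms
proof (induction p arbitrary: xs)
  case Nil
  then show ?case using ops_product_swap_front[of l m w xs] by simp
next
  case (Cons n p)
  have "homog (tagged (fst (fst n)) (letter_op (snd n - 1) (fst n)) (take (snd n) xs))"
    using homog_tagged[OF supermultilinear_letter_op] Cons.prems homogs_take_drop by simp
  then show ?case using Cons.IH Cons.prems homogs_take_drop
    by (simp add: feed_def sg_sg add.commute del: ops_product.simps(1))
qed


section \<open>The product rule\<close>

lemma slot_sum_append: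
  "slot_sum (T @ Z) a h = slot_sum T a (\<lambda>T. h (T @ Z)) + sg (fst a * par T) (slot_sum Z a (\<lambda>Z. h (T @ Z)))"
  by (induction T arbitrary: h) (simp_all add: sg_add sg_sg algebra_simps)

lemma slot_sum_cong:
  assumes "\<And>ys. homogs ys \<Longrightarrow> length ys = length xs \<Longrightarrow> par ys = fst a + par xs \<Longrightarrow> h ys = h' ys"
    and "homog a" "homogs xs"
  shows "slot_sum xs a h = slot_sum xs a h'"
  using assms(1,3)
proof (induction xs arbitrary: h h')
  case (Cons x xs)
  have "slot_sum xs a (\<lambda>Y. h (x # Y)) = slot_sum xs a (\<lambda>Y. h' (x # Y))"
  proof (rule Cons.IH)
    fix ys assume "homogs ys" "length ys = length xs" "par ys = fst a + par xs"
    then show "h (x # ys) = h' (x # ys)" using Cons.prems by (intro Cons.prems) (auto simp: ac_simps)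
  qed (use Cons.prems in auto)
  moreover have "h ((a \<odot> x) # xs) = h' ((a \<odot> x) # xs)"
    using Cons.prems \<open>homog a\<close> by (intro Cons.prems) (auto simp: ac_simps)
  ultimately show ?case by simp
qed simp

lemma slot_sum_zero: "slot_sum xs a (\<lambda>ys. 0) = 0"
  by (induction xs) simp_all

lemma slot_sum_sg: "slot_sum xs a (\<lambda>ys. sg b (h ys)) = sg b (slot_sum xs a h)"
  by (induction xs arbitrary: h) (simp_all add: sg_add sg_sg add.commute)

lemma additive_slot_sum:
  assumes h: "\<And>a b. a \<in> prt i \<Longrightarrow> b \<in> prt i \<Longrightarrow> h (a + b) = h a + h b"
    and "\<And>ys. homogs ys \<Longrightarrow> length ys = length xs \<Longrightarrow> par ys = fst a + par xs \<Longrightarrow> g ys \<in> prt i"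
    and a: "homog a" and "homogs xs"
  shows "h (slot_sum xs a g) = slot_sum xs a (\<lambda>ys. h (g ys)) \<and> slot_sum xs a g \<in> prt i"
  using assms(2,4)
proof (induction xs arbitrary: g)
  have h0: "h 0 = 0" using h[of 0 0] by simp
  {
    case Nil show ?case by (simp add: h0)
  next
    case (Cons x xs)
    have hs: "h (sg b a) = sg b (h a)" if "a \<in> prt i" for a b
      using h[of a "- a"] that h0 by (simp add: sg_def minus_unique)
    have "g ((a \<odot> x) # xs) \<in> prt i"
      using Cons.prems a by (intro Cons.prems) (auto simp: ac_simps)
    moreover have "h (slot_sum xs a (\<lambda>ys. g (x # ys))) = slot_sum xs a (\<lambda>ys. h (g (x # ys))) \<and>
        slot_sum xs a (\<lambda>ys. g (x # ys)) \<in> prt i"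
    proof (rule Cons.IH)
      fix ys assume "homogs ys" "length ys = length xs" "par ys = fst a + par xs"
      then show "g (x # ys) \<in> prt i" using Cons.prems by (intro Cons.prems) (auto simp: ac_simps)
    qed (use Cons.prems in auto)
    ultimately show ?case by (simp add: h hs)
  }
qed

lemma raise_sum_cong_differentiated:
  assumes "\<And>v. differentiated v \<Longrightarrow> wpar v = wpar w \<Longrightarrow> length v = length w \<Longrightarrow> ord v = Suc (ord w) \<Longrightarrow> h v = h' v"
    and "differentiated w"
  shows "raise_sum w h = raise_sum w h'"
  using assms
proof (induction w arbitrary: h h')
  case (Cons l w)
  have "raise_sum w (\<lambda>w. h (l # w)) = raise_sum w (\<lambda>w. h' (l # w))"
    by (rule Cons.IH, rule Cons.prems) (use Cons.prems in auto)
  moreover have "h ((fst l, Suc (snd l)) # w) = h' ((fst l, Suc (snd l)) # w)"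
    by (rule Cons.prems) (use Cons.prems in auto)
  ultimately show ?case by simp
qed simp

text \<open>
  Differentiation of operations is a derivation of their product. For a first factor \<open>g\<close> acting on
  \<open>T\<close> and a remaining product \<open>f\<close> acting on the result \<open>u\<close> and on \<open>Z\<close>, the term in which \<open>u\<close> is
  differentiated is expanded by the definition of \<open>g'\<close>; the part that differentiates \<open>T\<close> cancels.
\<close>

lemma lie_ops_product:
  assumes "differentiated w" "homog a" "homogs xs"
  shows "lie (ops_product w) (a # xs) = raise_sum w (\<lambda>w. ops_product w (a # xs))"
  using assms(1,3)
proof (induction w arbitrary: xs)
  case Nil
  have "slot_sum xs a (ops_product []) = snd a \<cdot> ops_product [] xs"
    by (cases xs; cases "tl xs") (auto simp: slot_sum_zero)
  then show ?case by (simp add: lie.simps)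
next
  case (Cons l w)
  note d = Cons.prems(1)
  show ?case
  proof (cases "length xs + length (l # w) = Suc (ord (l # w))")
    case False
    have "slot_sum xs a (ops_product (l # w)) = slot_sum xs a (\<lambda>ys. 0)"
      by (rule slot_sum_cong) (use False ops_product_length[OF d] Cons.prems assms(2) in auto)
    moreover have "ops_product (l # w) xs = 0" by (rule ops_product_length) (use Cons.prems False in auto)
    moreover have "raise_sum (l # w) (\<lambda>w. ops_product w (a # xs)) = raise_sum (l # w) (\<lambda>w. 0)"
      by (rule raise_sum_cong_differentiated[OF _ d], rule ops_product_length)
         (use Cons.prems assms(2) False in auto)
    ultimately show ?thesis by (simp add: lie.simps slot_sum_zero raise_sum_zero del: ops_product.simps raise_sum.simps)
  next
    case True
    let ?e = "fst (fst l)" and ?f = "ops_product w"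
    obtain n where n: "snd l = Suc n" using d by (cases "snd l") auto
    define g where "g = letter_op n (fst l)"
    have "length w \<le> ord w" using d by (induction w) (auto simp: Suc_le_eq intro: le_less_trans)
    then have "Suc n \<le> length xs" using True n by simp
    then obtain T Z where xs: "xs = T @ Z" "length T = Suc n"
      using that[of "take (Suc n) xs" "drop (Suc n) xs"] by simp
    have h: "homogs T" "homogs Z" using Cons.prems xs by auto
    have g: "supermultilinear ?e g" unfolding g_def using d by (intro supermultilinear_letter_op) auto
    have f: "supermultilinear (wpar w) ?f" using d by (intro supermultilinear_ops_product) auto
    let ?u = "tagged ?e g T"
    let ?i = "fst a + (par T + ?e)"
    have u: "homog ?u" using homog_tagged[OF g h(1)] .
    have F: "ops_product (l # w) (T' @ Z') = sg (?e * par Z') (?f (tagged ?e g T' # Z'))" if "length T' = Suc n" for T' Z'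
      using that by (simp add: n g_def feed_append)
    have gi: "g ys \<in> prt ?i" if "homogs ys" "par ys = fst a + par T" for ys
      using supermultilinearD(1)[OF g, of ys] that by (simp add: add.assoc)
    have "slot_sum T a (\<lambda>T. ops_product (l # w) (T @ Z)) = slot_sum T a (\<lambda>T. sg (?e * par Z) (?f ((?i, g T) # Z)))"
      by (rule slot_sum_cong) (use F xs h assms(2) in \<open>auto simp: tagged_def add.assoc simp del: ops_product.simps\<close>)
    also have "\<dots> = sg (?e * par Z) (slot_sum T a (\<lambda>T. ?f ((?i, g T) # Z)))" by (rule slot_sum_sg)
    also have "slot_sum T a (\<lambda>T. ?f ((?i, g T) # Z)) = ?f ((?i, slot_sum T a g) # Z)"
      by (rule additive_slot_sum[THEN conjunct1, symmetric, OF _ gi]) (use h assms(2) supermultilinearD(3)[OF f] in auto)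
    finally have 1: "slot_sum T a (\<lambda>T. ops_product (l # w) (T @ Z)) = sg (?e * par Z) (?f ((?i, slot_sum T a g) # Z))" .
    have "slot_sum Z a (\<lambda>Z. ops_product (l # w) (T @ Z)) = slot_sum Z a (\<lambda>Z'. sg (?e * (fst a + par Z)) (?f (?u # Z')))"
      by (rule slot_sum_cong) (use F xs h assms(2) in \<open>auto simp del: ops_product.simps\<close>)
    then have 2: "slot_sum Z a (\<lambda>Z. ops_product (l # w) (T @ Z)) = sg (?e * (fst a + par Z)) (slot_sum Z a (\<lambda>Z. ?f (?u # Z)))"
      by (simp add: slot_sum_sg del: ops_product.simps)
    have "a \<odot> ?u = (?i, snd a \<cdot> g T)" by (simp add: tmul_def)
    moreover have "snd a \<cdot> g T \<in> prt ?i" using supermultilinearD(1)[OF g h(1)] assms(2) by (simp add: homog_def)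
    moreover have "slot_sum T a g \<in> prt ?i"
      by (rule additive_slot_sum[of ?i "\<lambda>y. y", THEN conjunct2, OF _ gi]) (use h assms(2) in auto)
    ultimately have 3: "?f ((?i, lie g (a # T)) # Z) = ?f ((a \<odot> ?u) # Z) - ?f ((?i, slot_sum T a g) # Z)"
      using supermultilinear_diff[OF f _ _ h(2)] by (simp add: lie.simps)
    have "ops_product (l # w) xs = sg (?e * par Z) (?f (?u # Z))" using F xs by simp
    then have "lie (ops_product (l # w)) (a # xs) = sg (?e * par Z) (snd a \<cdot> ?f (?u # Z))
        - (sg (?e * par Z) (?f ((?i, slot_sum T a g) # Z))
        + sg (fst a * par T) (sg (?e * (fst a + par Z)) (slot_sum Z a (\<lambda>Z. ?f (?u # Z)))))"
      using 1 2 by (simp add: lie.simps xs slot_sum_append del: ops_product.simps)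
    also have "snd a \<cdot> ?f (?u # Z) = lie ?f (a # ?u # Z) + (?f ((a \<odot> ?u) # Z)
        + sg (fst a * (par T + ?e)) (slot_sum Z a (\<lambda>Z. ?f (?u # Z))))"
      by (simp add: lie.simps)
    finally have L: "lie (ops_product (l # w)) (a # xs) =
        sg (?e * par Z) (?f ((?i, lie g (a # T)) # Z) + lie ?f (a # ?u # Z))"
      unfolding 3 by (simp add: sign_simps)
    have "raise_sum w (\<lambda>w'. ops_product (l # w') (a # T @ Z)) =
        raise_sum w (\<lambda>w'. sg (?e * par Z) (ops_product w' (a # ?u # Z)))"
    proof (rule raise_sum_cong_differentiated)
      fix v assume v: "differentiated v"
      have "ops_product (l # v) ([] @ [a] @ T @ Z) = sg (par [a] * par T) (ops_product (l # v) ([] @ T @ [a] @ Z))"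
        by (rule supermultilinear_blocks[OF supermultilinear_ops_product]) (use v d h assms(2) in auto)
      moreover have "ops_product (l # v) (T @ a # Z) = sg (?e * par (a # Z)) (ops_product v (?u # a # Z))"
        using xs by (simp add: n g_def feed_append)
      moreover have "ops_product v ([] @ ?u # a # Z) = sg (fst ?u * fst a) (ops_product v ([] @ a # ?u # Z))"
        by (rule supermultilinearD(2)[OF supermultilinear_ops_product[OF v]]) (use u h assms(2) in auto)
      ultimately show "ops_product (l # v) (a # T @ Z) = sg (?e * par Z) (ops_product v (a # ?u # Z))"
        by (simp del: ops_product.simps) (simp add: sign_simps)
    qed (use d in auto)
    also have "\<dots> = sg (?e * par Z) (lie ?f (a # ?u # Z))"
      unfolding raise_sum_sg using Cons.IH[of "?u # Z"] d u h by simp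
    finally have R: "raise_sum w (\<lambda>w'. ops_product (l # w') (a # T @ Z)) = sg (?e * par Z) (lie ?f (a # ?u # Z))" .
    have "ops_product ((fst l, Suc (snd l)) # w) ((a # T) @ Z) = sg (?e * par Z) (?f (tagged ?e (lie g) (a # T) # Z))"
      using feed_append[of "a # T" "Suc (Suc n)" ?e "lie g" ?f Z] xs by (simp add: n g_def)
    then show ?thesis
      using R L by (simp add: xs tagged_def sg_add add.assoc del: ops_product.simps lie.simps)
  qed
qed

lemma letter_op_add: "letter_op n (i, a + b) xs = letter_op n (i, a) xs + letter_op n (i, b) xs"
proof (induction n arbitrary: xs)
  case 0
  show ?case by (cases xs; cases "tl xs") (auto simp: mul_add_right)
next
  case (Suc n)
  have *: "slot_sum xs c (\<lambda>ys. f ys + f' ys) = slot_sum xs c f + slot_sum xs c f'" for xs c and f f' :: "'g elt list \<Rightarrow> 'g"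
    by (induction xs arbitrary: f f') (simp_all add: sg_add algebra_simps)
  have "letter_op n (i, a + b) = (\<lambda>xs. letter_op n (i, a) xs + letter_op n (i, b) xs)" using Suc by (rule ext)
  then show ?case by (cases xs) (simp_all add: lie.simps mul_add_right *)
qed

lemma letter_op_scalar:
  assumes "\<phi> \<in> scalars"
  shows "letter_op n (i, \<phi> a) xs = \<phi> (letter_op n (i, a) xs)"
proof (induction n arbitrary: xs)
  case 0
  show ?case by (cases xs; cases "tl xs") (auto simp: scalar_mul_right assms scalar_zero)
next
  case (Suc n)
  have d: "\<phi> (x - y) = \<phi> x - \<phi> y" for x y
    using scalar_add[OF assms, of x "- y"] scalar_uminus[OF assms] by simp
  have *: "slot_sum xs c (\<lambda>ys. \<phi> (f ys)) = \<phi> (slot_sum xs c f)" for xs c and f :: "'g elt list \<Rightarrow> 'g"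
    by (induction xs arbitrary: f) (simp_all add: scalar_add assms scalar_zero sg_def scalar_uminus)
  have "letter_op n (i, \<phi> a) = (\<lambda>xs. \<phi> (letter_op n (i, a) xs))" using Suc by (rule ext)
  then show ?case by (cases xs) (simp_all add: lie.simps scalar_mul_right * assms scalar_zero d)
qed

section \<open>The value of a word\<close>

lemma differentiated_nonzeros: "valid w \<Longrightarrow> differentiated (nonzeros w)"
  by (induction w) auto

lemma homogs_zeros: "valid w \<Longrightarrow> homogs (map fst (zeros w))"
  by (induction w) auto

lemma wpar_par: "par (map fst w) = wpar w"
  by (simp add: wpar_def)

text \<open>
  The value in \<open>V\<close> of a word: after sorting, the letters of positive order act on those of order
  zero.
\<close>

definition word_value :: "'g letter list \<Rightarrow> 'g" where
  "word_value w = (if valid w then sg (sort_sign w) (ops_product (nonzeros w) (map fst (zeros w))) else 0)"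

lemma word_value_weight: "length w \<noteq> Suc (ord w) \<Longrightarrow> word_value w = 0"
proof -
  assume *: "length w \<noteq> Suc (ord w)"
  have "length (zeros w) + length (nonzeros w) = length w" "ord (nonzeros w) = ord w"
    by (induction w) auto
  with * show ?thesis unfolding word_value_def
    using ops_product_length[OF differentiated_nonzeros homogs_zeros, of w w] by simp
qed

lemma word_value_in_prt: "valid w \<Longrightarrow> word_value w \<in> prt (wpar w)"
proof -
  assume w: "valid w"
  have "wpar w = wpar (zeros w) + wpar (nonzeros w)" by (induction w) (auto simp: ac_simps)
  then show ?thesis
    using supermultilinearD(1)[OF supermultilinear_ops_product[OF differentiated_nonzeros[OF w]] homogs_zeros[OF w]] w
    by (simp add: word_value_def wpar_par)
qed

lemma word_value_single: "homog x \<Longrightarrow> word_value [(x, 0)] = snd x"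
  by (simp add: word_value_def)

lemma supersym_word_value: "supersym word_value"
proof (rule supersymI)
  fix p l m q assume v: "valid (p @ l # m # q)"
  let ?s = "fst (fst l) * fst (fst m)"
  consider "snd l = 0" "snd m = 0" | "snd l \<noteq> 0" "snd m \<noteq> 0" | "(snd l = 0) \<noteq> (snd m = 0)"
    by (cases "snd l = 0"; cases "snd m = 0") auto
  then show "word_value (p @ l # m # q) = sg ?s (word_value (p @ m # l # q))"
  proof cases
    case 1
    let ?f = "ops_product (nonzeros (p @ l # m # q))"
    have "?f (map fst (zeros p) @ fst l # fst m # map fst (zeros q)) =
        sg ?s (?f (map fst (zeros p) @ fst m # fst l # map fst (zeros q)))"
      by (rule supermultilinearD(2)[OF supermultilinear_ops_product[OF differentiated_nonzeros[OF v]]]) (use v homogs_zeros in auto)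
    then show ?thesis using v 1 by (simp add: word_value_def sort_sign_append sign_simps)
  next
    case 2
    let ?x = "map fst (zeros (p @ l # m # q))"
    have "ops_product (nonzeros p @ l # m # nonzeros q) ?x = sg ?s (ops_product (nonzeros p @ m # l # nonzeros q) ?x)"
      by (rule ops_product_swap) (use v 2 homogs_zeros[OF v] differentiated_nonzeros in auto)
    then show ?thesis using v 2 by (simp add: word_value_def sort_sign_append sign_simps)
  next
    case 3
    then show ?thesis using v by (cases "snd l = 0") (simp_all add: word_value_def sort_sign_append sign_simps)
  qed
qed

lemma word_value_add:
  assumes "a \<in> prt i" "b \<in> prt i" "valid w"
  shows "word_value (((i, a + b), k) # w) = word_value (((i, a), k) # w) + word_value (((i, b), k) # w)"
proof (cases "k = 0")
  case True
  then show ?thesis using assms supermultilinearD(3)[OF supermultilinear_ops_product[OF differentiated_nonzeros[OF assms(3)]]]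
    by (simp add: word_value_def homogs_zeros sg_add)
next
  case False
  let ?xs = "map fst (zeros w)"
  have f: "supermultilinear (wpar (nonzeros w)) (ops_product (nonzeros w))" by (rule supermultilinear_ops_product[OF differentiated_nonzeros[OF assms(3)]])
  have "letter_op (k - 1) (i, c) (take k ?xs) \<in> prt (par (take k ?xs) + i)" if "c \<in> prt i" for c
    using supermultilinearD(1)[OF supermultilinear_letter_op, of "(i, c)" "take k ?xs" "k - 1"] that
      homogs_take_drop[OF homogs_zeros[OF assms(3)]] by simp
  then show ?thesis
    using False assms homogs_take_drop[OF homogs_zeros[OF assms(3)], of k]
    by (simp add: word_value_def feed_def tagged_def letter_op_add supermultilinearD(3)[OF f] sg_add)
qed

lemma word_value_scalar:
  assumes "a \<in> prt i" "valid w" and \<phi>: "\<phi> \<in> scalars"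
  shows "word_value (((i, \<phi> a), k) # w) = \<phi> (word_value (((i, a), k) # w))"
proof (cases "k = 0")
  case True
  then show ?thesis using assms supermultilinearD(4)[OF supermultilinear_ops_product[OF differentiated_nonzeros[OF assms(2)]]]
    by (simp add: word_value_def homogs_zeros sg_def scalar_uminus)
next
  case False
  let ?xs = "map fst (zeros w)"
  have f: "supermultilinear (wpar (nonzeros w)) (ops_product (nonzeros w))" by (rule supermultilinear_ops_product[OF differentiated_nonzeros[OF assms(2)]])
  have "letter_op (k - 1) (i, a) (take k ?xs) \<in> prt (par (take k ?xs) + i)"
    using supermultilinearD(1)[OF supermultilinear_letter_op, of "(i, a)" "take k ?xs" "k - 1"] assms(1)
      homogs_take_drop[OF homogs_zeros[OF assms(2)]] by simp
  then show ?thesis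
    using False assms homogs_take_drop[OF homogs_zeros[OF assms(2)], of k]
    by (simp add: word_value_def feed_def tagged_def letter_op_scalar supermultilinearD(4)[OF f] sg_def scalar_uminus)
qed

lemma word_value_mul:
  assumes "homog a" "homog b" "valid w"
  shows "word_value ((a \<odot> b, 0) # w) = word_value ((a, 0) # (b, 1) # w)"
proof -
  have "tagged (fst b) (rmul b) [a] = a \<odot> b" by (simp add: tagged_def tmul_def)
  then show ?thesis
    using assms by (simp add: word_value_def feed_def wpar_par sg_sg ac_simps bit_self_cancel)
qed

text \<open>
  Supersymmetry moves the differentiated letter to the front, where \<open>a z' = a \<circ> z\<close> applies.
\<close>

lemma raise_sum_zeros:
  assumes "supersym h" "homogs xs"
  shows "raise_sum (map (\<lambda>x. (x, 0)) xs) h = front_sum xs (\<lambda>z Y. h ((z, 1) # map (\<lambda>x. (x, 0)) Y))"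
  using assms
proof (induction xs arbitrary: h)
  case (Cons x xs)
  let ?o = "map (\<lambda>x. (x, 0 :: nat))"
  have "raise_sum (?o xs) (\<lambda>w. h ([(x, 0)] @ w)) = front_sum xs (\<lambda>z Y. h ([(x, 0)] @ (z, 1) # ?o Y))"
    using Cons.prems by (intro Cons.IH supersym_left) auto
  also have "\<dots> = front_sum xs (\<lambda>z Y. sg (fst x * fst z) (h ((z, 1) # (x, 0) # ?o Y)))"
  proof (rule front_sum_cong[where P = homog])
    fix z Y assume "homog z" "homogs Y"
    then show "h ([(x, 0)] @ (z, 1) # ?o Y) = sg (fst x * fst z) (h ((z, 1) # (x, 0) # ?o Y))"
      using supersymD[OF Cons.prems(1), of "[]" "(x, 0)" "(z, 1)" "?o Y"] Cons.prems
      by (simp add: valid_def comp_def)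
  qed (use Cons.prems in auto)
  finally show ?case by simp
qed simp

lemma word_value_zeros_differentiated:
  assumes "homogs xs" "differentiated w"
  shows "word_value (map (\<lambda>x. (x, 0)) xs @ w) = ops_product w xs"
proof -
  have "nonzeros w = w" "zeros w = []" using assms(2) by (auto simp: differentiated_def filter_id_conv filter_empty_conv)
  moreover have "sort_sign (map (\<lambda>x. (x, 0)) xs @ w) = 0"
  proof (induction xs)
    case Nil
    show ?case using assms(2) by (induction w) (auto simp: differentiated_def)
  qed simp
  ultimately show ?thesis using assms
    by (simp add: word_value_def differentiated_def valid_def comp_def filter_map)
qed

text \<open>
  The derivative of a sorted word has two parts. Raising letters of positive order gives the
  derivative of the product of operations by \<open>lie_ops_product\<close>, and raising letters of order zero
  gives \<open>slot_sum\<close>, since \<open>a z' = a \<circ> z\<close>. By definition of \<open>lie\<close>, the two add up to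
  \<open>a \<circ> word_value w\<close>.
\<close>

lemma mul_word_value_sorted:
  assumes "homog a" "homogs xs" "differentiated w"
  shows "snd a \<cdot> word_value (map (\<lambda>x. (x, 0)) xs @ w) = ddx (\<lambda>w. word_value ((a, 0) # w)) (map (\<lambda>x. (x, 0)) xs @ w)"
proof -
  let ?o = "map (\<lambda>x. (x, 0 :: nat))"
  have vw: "valid w" "nonzeros w = w" "zeros w = []"
    using assms(3) by (auto simp: differentiated_def filter_id_conv filter_empty_conv)
  have "raise_sum w (\<lambda>w. word_value ((a, 0) # ?o xs @ w)) = raise_sum w (\<lambda>w. ops_product w (a # xs))"
    by (rule raise_sum_cong_differentiated) (use word_value_zeros_differentiated[of "a # xs"] assms in auto)
  then have 1: "raise_sum w (\<lambda>w. word_value ((a, 0) # ?o xs @ w)) = snd a \<cdot> ops_product w xs - slot_sum xs a (ops_product w)"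
    using lie_ops_product[OF assms(3,1,2)] by (simp add: lie.simps)
  have s: "supersym (\<lambda>u. word_value ((a, 0) # u @ w))"
    using supersym_right[OF supersym_left[OF supersym_word_value, of "[(a, 0)]"] vw(1)] assms(1) by simp
  have "raise_sum (?o xs) (\<lambda>u. word_value ((a, 0) # u @ w)) = front_sum xs (\<lambda>z Y. word_value ((a, 0) # ((z, 1) # ?o Y) @ w))"
    by (rule raise_sum_zeros[OF s assms(2)])
  also have "\<dots> = front_sum xs (\<lambda>z Y. ops_product w ((a \<odot> z) # Y))"
  proof (rule front_sum_cong[where P = homog])
    fix z Y assume zY: "homog z" "homogs Y"
    have "word_value ((a, 0) # (z, 1) # ?o Y @ w) = word_value (?o ((a \<odot> z) # Y) @ w)"
      using word_value_mul[OF assms(1) zY(1), of "?o Y @ w"] vw(1) zY by (simp add: valid_def comp_def)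
    also have "\<dots> = ops_product w ((a \<odot> z) # Y)"
      by (rule word_value_zeros_differentiated) (use assms zY in auto)
    finally show "word_value ((a, 0) # ((z, 1) # ?o Y) @ w) = ops_product w ((a \<odot> z) # Y)" by simp
  qed (use assms in auto)
  also have "\<dots> = slot_sum xs a (ops_product w)"
    by (rule slot_sum_eq_front_sum[OF supermultilinearD(2)[OF supermultilinear_ops_product[OF assms(3)]] assms(1,2), symmetric])
  finally show ?thesis
    using 1 by (simp add: ddx_def raise_sum_append word_value_zeros_differentiated[OF assms(2,3)])
qed

lemma mul_word_value:
  assumes "homog a" "valid w"
  shows "snd a \<cdot> word_value w = ddx (\<lambda>w. word_value ((a, 0) # w)) w"
proof -
  let ?h = "\<lambda>w. word_value ((a, 0) # w)" and ?w = "map (\<lambda>x. (x, 0)) (map fst (zeros w)) @ nonzeros w"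
  have w: "?w = zeros w @ nonzeros w"
    by (simp add: comp_def) (rule map_idI, auto)
  have s: "supersym (ddx ?h)"
    using supersym_ddx[OF supersym_left[OF supersym_word_value, of "[(a, 0)]"]] assms(1) by simp
  have "snd a \<cdot> word_value ?w = ddx ?h ?w"
    by (rule mul_word_value_sorted) (use assms homogs_zeros differentiated_nonzeros in auto)
  then have "snd a \<cdot> word_value (zeros w @ nonzeros w) = ddx ?h (zeros w @ nonzeros w)" unfolding w .
  then show ?thesis
    using supersym_sort[OF supersym_word_value assms(2)] supersym_sort[OF s assms(2)] by simp
qed

end

section \<open>The derivatives of the Novikov product\<close>

text \<open>
  Integer multiples, with \<open>wmul m n x = (m - n) x\<close>. The eigenvalue of \<open>E\<close> on a word is its length
  minus the sum of its orders.
\<close>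

primrec nmul :: "nat \<Rightarrow> 'g::ab_group_add \<Rightarrow> 'g" where
  "nmul 0 x = 0"
| "nmul (Suc n) x = x + nmul n x"

definition wmul :: "nat \<Rightarrow> nat \<Rightarrow> 'g::ab_group_add \<Rightarrow> 'g" where
  "wmul m n x = nmul m x - nmul n x"

lemma nmul_plus: "nmul (m + n) x = nmul m x + nmul n x"
  by (induction m) (simp_all add: add.assoc)

lemma nmul_zero [simp]: "nmul n 0 = 0"
  by (induction n) simp_all

lemma nmul_additive:
  assumes "\<And>x y. \<phi> (x + y) = \<phi> x + \<phi> y"
  shows "\<phi> (nmul n x) = nmul n (\<phi> x)"
proof -
  have "\<phi> 0 = 0" using assms[of 0 0] by simp
  then show ?thesis by (induction n) (simp_all add: assms)
qed

lemma wmul_plus: "wmul (m + m') (n + n') x = wmul m n x + wmul m' n' x"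
  by (simp add: wmul_def nmul_plus)

lemma wmul_Suc [simp]: "wmul (Suc m) (Suc n) x = wmul m n x"
  by (simp add: wmul_def)

lemma wmul_additive:
  assumes "\<And>x y. \<phi> (x + y) = \<phi> x + \<phi> y"
  shows "\<phi> (wmul m n x) = wmul m n (\<phi> x)"
proof -
  have "\<phi> (x - y) = \<phi> x - \<phi> y" for x y
    using assms[of "x - y" y] by (simp add: algebra_simps)
  then show ?thesis by (simp add: wmul_def nmul_additive[of \<phi>, OF assms])
qed

lemma wmul_add: "wmul m n (x + y) = wmul m n x + wmul m n y"
proof -
  have "nmul m (x + y) = nmul m x + nmul m y" for m
    by (induction m) (simp_all add: algebra_simps)
  then show ?thesis by (simp add: wmul_def)
qed

lemma wmul_zero [simp]: "wmul m n 0 = 0" by (simp add: wmul_def)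

lemma ddx_funpow_zero: "(ddx ^^ n) (\<lambda>v. 0) u = 0"
  using ddx_funpow_add[of n "\<lambda>v. 0" "\<lambda>v. 0" u] by simp

context novikov
begin

text \<open>
  Induction on \<open>n\<close>. A word of nonzero value that contains \<open>(a \<circ> b)\<^sup>(\<^sup>n\<^sup>+\<^sup>1\<^sup>)\<close> must also contain a letter \<open>c\<close> of
  order zero, and then \<open>mul_word_value\<close> for \<open>c\<close>, applied to both sides of the relation of order \<open>n\<close>,
  yields the relation of order \<open>n + 1\<close> plus terms that agree by the induction hypothesis.
\<close>

lemma word_value_mul_derivative:
  assumes a: "homog a" and b: "homog b" and "valid q"
  shows "word_value ((a \<odot> b, n) # q) = (ddx ^^ n) (\<lambda>u. word_value (u @ q)) [(a, 0), (b, 1)]"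
  using assms(3)
proof (induction n arbitrary: q)
  case 0
  then show ?case using word_value_mul[OF a b] by simp
next
  case (Suc n)
  let ?u = "[(a, 0 :: nat), (b, 1)]" and ?c = "a \<odot> b"
  \<comment> \<open>differentiation of \<open>a b'\<close> preserves parity and length\<close>
  have vu: "valid u \<and> wpar u = fst a + fst b \<and> length u = 2" if "map fst u = map fst ?u" for u :: "'g letter list"
  proof -
    have "length u = 2" using arg_cong[OF that, of length] by simp
    moreover have "valid u" "wpar u = fst a + fst b" using a b that by (auto simp: valid_def wpar_def)
    ultimately show ?thesis by simp
  qed
  show ?case
  proof (cases "zeros q = []")
    case True
    then have "length q \<le> ord q" by (induction q) (auto split: if_splits)
    then have "word_value ((?c, Suc n) # q) = 0" "\<And>v. map fst v = map fst ?u \<Longrightarrow> ord v = ord ?u + Suc n \<Longrightarrow> word_value (v @ q) = 0"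
      using vu by (auto intro!: word_value_weight)
    moreover from this(2) have "(ddx ^^ Suc n) (\<lambda>u. word_value (u @ q)) ?u = (ddx ^^ Suc n) (\<lambda>u. 0) ?u"
      by (rule ddx_funpow_cong)
    ultimately show ?thesis by (simp only: ddx_funpow_zero)
  next
    case False
    then obtain l where "l \<in> set q" "snd l = 0" by (auto simp: filter_empty_conv)
    then obtain c q1 q2 where q: "q = q1 @ (c, 0) # q2" by (metis split_list prod.collapse)
    have c: "homog c" and vq: "valid q1" "valid q2" using Suc.prems q by auto
    let ?p = "q1 @ q2" and ?s = "fst c * (fst a + fst b)"
    have v: "valid ?p" using vq by simp
    have m: "snd c \<cdot> word_value (u @ ?p) = ddx (\<lambda>w. word_value ((c, 0) # w @ ?p)) u + raise_sum ?p (\<lambda>w. word_value ((c, 0) # u @ w))"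
      if "valid u" for u
      using mul_word_value[OF c, of "u @ ?p"] that v by (simp only: ddx_def raise_sum_append valid_simps simp_thms)
    have "snd c \<cdot> word_value ((?c, n) # ?p) = snd c \<cdot> (ddx ^^ n) (\<lambda>u. word_value (u @ ?p)) ?u"
      using Suc.IH[OF v] by simp
    also have "\<dots> = (ddx ^^ n) (\<lambda>u. snd c \<cdot> word_value (u @ ?p)) ?u"
      by (rule ddx_funpow_additive) (rule mul_add_right)
    also have "\<dots> = (ddx ^^ n) (\<lambda>u. ddx (\<lambda>w. word_value ((c, 0) # w @ ?p)) u + raise_sum ?p (\<lambda>w. word_value ((c, 0) # u @ w))) ?u"
      by (rule ddx_funpow_cong, rule m) (use vu in blast)
    also have "\<dots> = (ddx ^^ Suc n) (\<lambda>w. word_value ((c, 0) # w @ ?p)) ?u + raise_sum ?p (\<lambda>w. (ddx ^^ n) (\<lambda>u. word_value ((c, 0) # u @ w)) ?u)"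
      unfolding ddx_funpow_add ddx_funpow_raise_sum by (simp only: funpow_Suc_right comp_def)
    also have "raise_sum ?p (\<lambda>w. (ddx ^^ n) (\<lambda>u. word_value ((c, 0) # u @ w)) ?u) =
        raise_sum ?p (\<lambda>w. word_value ((c, 0) # (?c, n) # w))"
    proof (rule raise_sum_cong)
      fix w :: "'g letter list" assume "map fst w = map fst ?p"
      then have w: "valid w" using v by (simp add: valid_def)
      have "(ddx ^^ n) (\<lambda>u. word_value ((c, 0) # u @ w)) ?u = (ddx ^^ n) (\<lambda>u. sg ?s (word_value (u @ (c, 0) # w))) ?u"
      proof (rule ddx_funpow_cong)
        fix u :: "'g letter list" assume "map fst u = map fst ?u"
        note u = vu[OF this]
        have "word_value (u @ (c, 0) # w) = sg (wpar u * fst c) (word_value ((c, 0) # u @ w))"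
          using supersym_front[OF supersym_word_value, of u "(c, 0)" w] u c w by simp
        then show "word_value ((c, 0) # u @ w) = sg ?s (word_value (u @ (c, 0) # w))"
          using u by (simp add: mult.commute[of "fst c"])
      qed
      also have "\<dots> = sg ?s (word_value ((?c, n) # (c, 0) # w))"
        using Suc.IH[of "(c, 0) # w"] c w by (simp add: ddx_funpow_sg)
      also have "\<dots> = word_value ((c, 0) # (?c, n) # w)"
        using supersymD[OF supersym_word_value, of "[]" "(c, 0)" "(?c, n)" w] a b c w by simp
      finally show "(ddx ^^ n) (\<lambda>u. word_value ((c, 0) # u @ w)) ?u = word_value ((c, 0) # (?c, n) # w)" .
    qed
    finally have "snd c \<cdot> word_value ((?c, n) # ?p) = (ddx ^^ Suc n) (\<lambda>w. word_value ((c, 0) # w @ ?p)) ?u +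
        raise_sum ?p (\<lambda>w. word_value ((c, 0) # (?c, n) # w))" .
    moreover have "snd c \<cdot> word_value ((?c, n) # ?p) = word_value ((c, 0) # (?c, Suc n) # ?p) +
        raise_sum ?p (\<lambda>w. word_value ((c, 0) # (?c, n) # w))"
      using mul_word_value[OF c, of "(?c, n) # ?p"] a b v by (simp add: ddx_def)
    ultimately have "word_value ((c, 0) # (?c, Suc n) # ?p) = (ddx ^^ Suc n) (\<lambda>w. word_value ((c, 0) # w @ ?p)) ?u"
      by simp
    moreover have "word_value (((?c, Suc n) # q1) @ (c, 0) # q2) =
        sg (wpar ((?c, Suc n) # q1) * fst c) (word_value ((c, 0) # ((?c, Suc n) # q1) @ q2))"
      using supersym_front[OF supersym_word_value, of "(?c, Suc n) # q1" "(c, 0)" q2] a b c vq by simp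
    moreover have "(ddx ^^ Suc n) (\<lambda>u. word_value (u @ q)) ?u =
        (ddx ^^ Suc n) (\<lambda>u. sg ((fst a + fst b + wpar q1) * fst c) (word_value ((c, 0) # u @ ?p))) ?u"
    proof (rule ddx_funpow_cong)
      fix u :: "'g letter list" assume "map fst u = map fst ?u"
      then show "word_value (u @ q) = sg ((fst a + fst b + wpar q1) * fst c) (word_value ((c, 0) # u @ ?p))"
        using vu supersym_front[OF supersym_word_value, of "u @ q1" "(c, 0)" q2] c vq q by simp
    qed
    ultimately show ?thesis unfolding ddx_funpow_sg q by simp
  qed
qed

section \<open>Functions on words that respect the relations\<close>

definition total :: "'g set" where "total = {x + y |x y. x \<in> prt 0 \<and> y \<in> prt 1}"

lemma totalI: "x \<in> prt i \<Longrightarrow> x \<in> total"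
  unfolding total_def by (cases i) (use prt_zero in force)+

lemma total_closed [simp]:
  "0 \<in> total"
  "x \<in> total \<Longrightarrow> y \<in> total \<Longrightarrow> x + y \<in> total"
  "x \<in> total \<Longrightarrow> - x \<in> total"
  "\<phi> \<in> scalars \<Longrightarrow> x \<in> total \<Longrightarrow> \<phi> x \<in> total"
proof -
  show "0 \<in> total" by (rule totalI[OF prt_zero])
  show "x + y \<in> total" if xy: "x \<in> total" "y \<in> total"
  proof -
    obtain a b c d where "x = a + b" "y = c + d" "a \<in> prt 0" "b \<in> prt 1" "c \<in> prt 0" "d \<in> prt 1"
      using xy by (auto simp: total_def)
    then have "x + y = (a + c) + (b + d)" "a + c \<in> prt 0" "b + d \<in> prt 1" by (simp_all add: algebra_simps)
    then show ?thesis unfolding total_def by blast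
  qed
  show "- x \<in> total" if "x \<in> total"
  proof -
    obtain a b where "x = a + b" "a \<in> prt 0" "b \<in> prt 1" using \<open>x \<in> total\<close> by (auto simp: total_def)
    then have "- x = - a + - b" "- a \<in> prt 0" "- b \<in> prt 1" by simp_all
    then show ?thesis unfolding total_def by blast
  qed
  show "\<phi> x \<in> total" if "\<phi> \<in> scalars" "x \<in> total"
  proof -
    obtain a b where "x = a + b" "a \<in> prt 0" "b \<in> prt 1" using \<open>x \<in> total\<close> by (auto simp: total_def)
    then have "\<phi> x = \<phi> a + \<phi> b" "\<phi> a \<in> prt 0" "\<phi> b \<in> prt 1" using that by (simp_all add: scalar_add)
    then show ?thesis unfolding total_def by blast
  qed
qed

lemma total_diff: "x \<in> total \<Longrightarrow> y \<in> total \<Longrightarrow> x - y \<in> total"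
  using total_closed(2)[of x "- y"] by simp

lemma total_wmul [simp]: "x \<in> total \<Longrightarrow> wmul m n x \<in> total"
proof -
  assume x: "x \<in> total"
  have "nmul m x \<in> total" for m by (induction m) (simp_all add: x)
  then show ?thesis by (simp add: wmul_def total_diff)
qed

text \<open>
  Linearity and the relations are imposed on the first letter only; supersymmetry carries them
  to the others.
\<close>

definition tests :: "('g letter list \<Rightarrow> 'g) set" where
  "tests = {h. (\<forall>w. \<not> valid w \<longrightarrow> h w = 0) \<and> (\<forall>w. h w \<in> total) \<and> supersym h \<and>
     (\<forall>i a b k w. a \<in> prt i \<longrightarrow> b \<in> prt i \<longrightarrow> valid w \<longrightarrow>
        h (((i, a + b), k) # w) = h (((i, a), k) # w) + h (((i, b), k) # w)) \<and>
     (\<forall>\<phi>\<in>scalars. \<forall>i a k w. a \<in> prt i \<longrightarrow> valid w \<longrightarrow> h (((i, \<phi> a), k) # w) = \<phi> (h (((i, a), k) # w))) \<and>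
     (\<forall>a b n w. homog a \<longrightarrow> homog b \<longrightarrow> valid w \<longrightarrow>
        h ((a \<odot> b, n) # w) = (ddx ^^ n) (\<lambda>u. h (u @ w)) [(a, 0), (b, 1)])}"

lemma testsI:
  assumes "\<And>w. \<not> valid w \<Longrightarrow> h w = 0" "\<And>w. valid w \<Longrightarrow> h w \<in> total" "supersym h"
    "\<And>i a b k w. a \<in> prt i \<Longrightarrow> b \<in> prt i \<Longrightarrow> valid w \<Longrightarrow>
        h (((i, a + b), k) # w) = h (((i, a), k) # w) + h (((i, b), k) # w)"
    "\<And>\<phi> i a k w. \<phi> \<in> scalars \<Longrightarrow> a \<in> prt i \<Longrightarrow> valid w \<Longrightarrow> h (((i, \<phi> a), k) # w) = \<phi> (h (((i, a), k) # w))"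
    "\<And>a b n w. homog a \<Longrightarrow> homog b \<Longrightarrow> valid w \<Longrightarrow>
        h ((a \<odot> b, n) # w) = (ddx ^^ n) (\<lambda>u. h (u @ w)) [(a, 0), (b, 1)]"
  shows "h \<in> tests"
proof -
  have "h w \<in> total" for w using assms(1,2)[of w] by (cases "valid w") auto
  then show ?thesis unfolding tests_def using assms by blast
qed

lemma testsD:
  assumes "h \<in> tests"
  shows "\<not> valid w \<Longrightarrow> h w = 0" "h w \<in> total" "supersym h"
    "a \<in> prt i \<Longrightarrow> b \<in> prt i \<Longrightarrow> valid w \<Longrightarrow>
        h (((i, a + b), k) # w) = h (((i, a), k) # w) + h (((i, b), k) # w)"
    "\<phi> \<in> scalars \<Longrightarrow> a \<in> prt i \<Longrightarrow> valid w \<Longrightarrow> h (((i, \<phi> a), k) # w) = \<phi> (h (((i, a), k) # w))"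
    "homog c \<Longrightarrow> homog d \<Longrightarrow> valid w \<Longrightarrow>
        h ((c \<odot> d, n) # w) = (ddx ^^ n) (\<lambda>u. h (u @ w)) [(c, 0), (d, 1)]"
  using assms unfolding tests_def by blast+

lemma word_value_tests: "word_value \<in> tests"
  by (rule testsI)
     (auto simp: word_value_add word_value_scalar word_value_mul_derivative supersym_word_value intro: totalI[OF word_value_in_prt], auto simp: word_value_def)

lemma map_fst_pair:
  fixes u :: "'g letter list"
  assumes "map fst u = map fst [(a, 0 :: nat), (b, 1)]" "homog a" "homog b"
  shows "valid u" "wpar u = fst a + fst b" "length u = 2"
proof -
  show "valid u" "wpar u = fst a + fst b" using assms by (simp_all add: valid_def wpar_def)
  show "length u = 2" using arg_cong[OF assms(1), of length] by simp
qed

lemma tests_zero [simp]: "(\<lambda>w. 0) \<in> tests"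
  by (rule testsI) (auto simp: supersym_def ddx_funpow_zero scalar_zero)

lemma tests_add [simp]:
  assumes "h \<in> tests" "h' \<in> tests"
  shows "(\<lambda>w. h w + h' w) \<in> tests"
proof (rule testsI)
  show "supersym (\<lambda>w. h w + h' w)"
  proof (rule supersymI)
    fix p l m q assume v: "valid (p @ l # m # q)"
    show "h (p @ l # m # q) + h' (p @ l # m # q) =
        sg (fst (fst l) * fst (fst m)) (h (p @ m # l # q) + h' (p @ m # l # q))"
      using supersymD[OF testsD(3)[OF assms(1)] v] supersymD[OF testsD(3)[OF assms(2)] v] by (simp add: sg_add)
  qed
next
  fix i a k w \<phi> assume "\<phi> \<in> scalars" "a \<in> prt i" "valid w"
  then show "h (((i, \<phi> a), k) # w) + h' (((i, \<phi> a), k) # w) = \<phi> (h (((i, a), k) # w) + h' (((i, a), k) # w))"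
    using testsD(5)[OF assms(1)] testsD(5)[OF assms(2)] scalar_add by simp
next
  fix a b n w assume "homog a" "homog b" "valid w"
  then show "h ((a \<odot> b, n) # w) + h' ((a \<odot> b, n) # w) = (ddx ^^ n) (\<lambda>u. h (u @ w) + h' (u @ w)) [(a, 0), (b, 1)]"
    using testsD(6)[OF assms(1)] testsD(6)[OF assms(2)] by (simp only: ddx_funpow_add)
qed (use testsD(1,2,4)[OF assms(1)] testsD(1,2,4)[OF assms(2)] in \<open>simp_all add: algebra_simps\<close>)

text \<open>
  Translations, the derivative \<open>ddx\<close>, the operator \<open>euler\<close> and the projections to one parity preserve
  the test functions. This is what makes the product, \<open>D\<close>, \<open>E\<close> and the parity decomposition
  of functionals well defined.
\<close>

lemma tests_left [simp]:
  assumes h: "h \<in> tests"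
  shows "(\<lambda>w. h (u @ w)) \<in> tests"
proof (cases "valid u")
  case False
  then have "(\<lambda>w. h (u @ w)) = (\<lambda>w. 0)" using testsD(1)[OF h] by auto
  then show ?thesis by simp
next
  case u: True
  have f: "h (u @ l # w) = sg (wpar u * fst (fst l)) (h (l # u @ w))" if "homog (fst l)" "valid w" for l w
    using supersym_front[OF testsD(3)[OF h]] that u by simp
  show ?thesis
  proof (rule testsI)
    show "supersym (\<lambda>w. h (u @ w))" by (rule supersym_left[OF testsD(3)[OF h] u])
  next
    fix i a b k w assume "a \<in> prt i" "b \<in> prt i" "valid w"
    then show "h (u @ ((i, a + b), k) # w) = h (u @ ((i, a), k) # w) + h (u @ ((i, b), k) # w)"
      by (simp add: f testsD(4)[OF h] u sg_add)
  next
    fix i a k w \<phi> assume "a \<in> prt i" "valid w" "\<phi> \<in> scalars"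
    then show "h (u @ ((i, \<phi> a), k) # w) = \<phi> (h (u @ ((i, a), k) # w))"
      by (simp add: f testsD(5)[OF h] u sg_def scalar_uminus)
  next
    fix a b n w assume ab: "homog a" "homog b" "valid w"
    have "h (u @ (a \<odot> b, n) # w) = sg (wpar u * (fst a + fst b)) ((ddx ^^ n) (\<lambda>v. h (v @ u @ w)) [(a, 0), (b, 1)])"
      using ab u by (simp add: f testsD(6)[OF h])
    also have "\<dots> = (ddx ^^ n) (\<lambda>v. sg (wpar u * (fst a + fst b)) (h (v @ u @ w))) [(a, 0), (b, 1)]"
      by (rule ddx_funpow_sg[symmetric])
    also have "\<dots> = (ddx ^^ n) (\<lambda>v. h (u @ v @ w)) [(a, 0), (b, 1)]"
    proof (rule ddx_funpow_cong)
      fix v :: "'g letter list" assume "map fst v = map fst [(a, 0 :: nat), (b, 1)]"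
      note v = map_fst_pair[OF this ab(1,2)]
      have "h ((u @ v) @ w) = sg (wpar u * wpar v) (h ((v @ u) @ w))"
        by (rule supersym_blocks[OF supersym_right[OF testsD(3)[OF h] ab(3)]]) (use u v in simp)
      then show "sg (wpar u * (fst a + fst b)) (h (v @ u @ w)) = h (u @ v @ w)" using v by simp
    qed
    finally show "h (u @ (a \<odot> b, n) # w) = (ddx ^^ n) (\<lambda>v. h (u @ v @ w)) [(a, 0), (b, 1)]" .
  qed (use testsD(1,2)[OF h] in auto)
qed

lemma tests_right [simp]:
  assumes h: "h \<in> tests"
  shows "(\<lambda>w. h (w @ u)) \<in> tests"
proof (cases "valid u")
  case False
  then have "(\<lambda>w. h (w @ u)) = (\<lambda>w. 0)" using testsD(1)[OF h] by auto
  then show ?thesis by simp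
next
  case u: True
  show ?thesis
    by (rule testsI) (use u testsD(1,2,4-6)[OF h] supersym_right[OF testsD(3)[OF h] u] in auto)
qed

lemma ddx_Cons: "ddx h (l # w) = h ((fst l, Suc (snd l)) # w) + ddx (\<lambda>w. h (l # w)) w"
  by (simp add: ddx_def)

lemma ddx_append: "ddx h (u @ w) = ddx (\<lambda>u. h (u @ w)) u + ddx (\<lambda>w. h (u @ w)) w"
  by (simp add: ddx_def raise_sum_append)

lemma ddx_tests [simp]:
  assumes h: "h \<in> tests"
  shows "ddx h \<in> tests"
proof (rule testsI)
  show "supersym (ddx h)" by (rule supersym_ddx[OF testsD(3)[OF h]])
next
  fix w assume "\<not> valid w"
  then have "raise_sum w h = raise_sum w (\<lambda>w. 0)"
    by (intro raise_sum_cong testsD(1)[OF h]) (simp add: valid_def)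
  then show "ddx h w = 0" by (simp add: ddx_def raise_sum_zero)
next
  fix w assume "valid w"
  have "raise_sum w h \<in> total" if "\<And>w. h w \<in> total" for h and w :: "'g letter list"
    using that by (induction w arbitrary: h) auto
  then show "ddx h w \<in> total" using testsD(2)[OF h] by (simp add: ddx_def)
next
  fix i a b k w assume ab: "a \<in> prt i" "b \<in> prt i" "valid w"
  have "raise_sum w (\<lambda>w. h (((i, a + b), k) # w)) = raise_sum w (\<lambda>w. h (((i, a), k) # w) + h (((i, b), k) # w))"
    by (intro raise_sum_cong testsD(4)[OF h]) (use ab in \<open>auto simp: valid_def\<close>)
  then show "ddx h (((i, a + b), k) # w) = ddx h (((i, a), k) # w) + ddx h (((i, b), k) # w)"
    by (simp add: ddx_def raise_sum_add testsD(4)[OF h] ab algebra_simps)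
next
  fix i a k w \<phi> assume ab: "a \<in> prt i" "valid w" "\<phi> \<in> scalars"
  have "raise_sum w (\<lambda>w. h (((i, \<phi> a), k) # w)) = raise_sum w (\<lambda>w. \<phi> (h (((i, a), k) # w)))"
    by (intro raise_sum_cong testsD(5)[OF h]) (use ab in \<open>auto simp: valid_def\<close>)
  also have "\<dots> = \<phi> (raise_sum w (\<lambda>w. h (((i, a), k) # w)))"
    by (rule raise_sum_additive[symmetric]) (rule scalar_add[OF ab(3)])
  finally show "ddx h (((i, \<phi> a), k) # w) = \<phi> (ddx h (((i, a), k) # w))"
    by (simp add: ddx_def scalar_add testsD(5)[OF h] ab)
next
  fix a b n w assume ab: "homog a" "homog b" "valid w"
  let ?u = "[(a, 0 :: nat), (b, 1)]"
  have "raise_sum w (\<lambda>w. h ((a \<odot> b, n) # w)) = raise_sum w (\<lambda>w. (ddx ^^ n) (\<lambda>u. h (u @ w)) ?u)"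
    by (intro raise_sum_cong testsD(6)[OF h]) (use ab in \<open>auto simp: valid_def\<close>)
  then have "ddx h ((a \<odot> b, n) # w) = (ddx ^^ Suc n) (\<lambda>u. h (u @ w)) ?u + (ddx ^^ n) (\<lambda>u. raise_sum w (\<lambda>w. h (u @ w))) ?u"
    unfolding ddx_funpow_raise_sum using testsD(6)[OF h ab, of "Suc n"] by (simp add: ddx_Cons) (simp add: ddx_def)
  also have "\<dots> = (ddx ^^ n) (\<lambda>u. ddx (\<lambda>u. h (u @ w)) u + ddx (\<lambda>w. h (u @ w)) w) ?u"
    unfolding ddx_funpow_add by (simp only: funpow_Suc_right comp_def ddx_def[of _ w])
  finally show "ddx h ((a \<odot> b, n) # w) = (ddx ^^ n) (\<lambda>u. ddx h (u @ w)) ?u"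
    by (simp only: ddx_append)
qed

definition euler :: "('g letter list \<Rightarrow> 'g) \<Rightarrow> 'g letter list \<Rightarrow> 'g" where
  "euler h w = wmul (length w) (ord w) (h w)"

lemma euler_tests [simp]:
  assumes h: "h \<in> tests"
  shows "euler h \<in> tests"
proof (rule testsI)
  have sgw: "wmul m n (sg b x) = sg b (wmul m n x)" for m n b and x :: 'g
    by (rule wmul_additive[symmetric]) (rule sg_add)
  show "supersym (euler h)"
  proof (rule supersymI)
    fix p l m q assume "valid (p @ l # m # q)"
    then have "h (p @ l # m # q) = sg (fst (fst l) * fst (fst m)) (h (p @ m # l # q))"
      by (rule supersymD[OF testsD(3)[OF h]])
    then show "euler h (p @ l # m # q) = sg (fst (fst l) * fst (fst m)) (euler h (p @ m # l # q))"
      by (simp add: euler_def sgw add.left_commute)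
  qed
next
  fix a b n w assume ab: "homog a" "homog b" "valid w"
  let ?u = "[(a, 0 :: nat), (b, 1)]"
  have "euler h ((a \<odot> b, n) # w) = wmul (Suc (length w)) (n + ord w) ((ddx ^^ n) (\<lambda>u. h (u @ w)) ?u)"
    by (simp add: euler_def testsD(6)[OF h ab])
  also have "\<dots> = (ddx ^^ n) (\<lambda>u. wmul (Suc (length w)) (n + ord w) (h (u @ w))) ?u"
    by (rule ddx_funpow_additive) (rule wmul_add)
  also have "\<dots> = (ddx ^^ n) (\<lambda>u. euler h (u @ w)) ?u"
    by (rule ddx_funpow_cong, frule map_fst_pair(3)[OF _ ab(1,2)]) (simp add: euler_def)
  finally show "euler h ((a \<odot> b, n) # w) = (ddx ^^ n) (\<lambda>u. euler h (u @ w)) ?u" .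
next
  fix i a k w \<phi> assume "a \<in> prt i" "valid w" "\<phi> \<in> scalars"
  then show "euler h (((i, \<phi> a), k) # w) = \<phi> (euler h (((i, a), k) # w))"
    by (simp add: euler_def testsD(5)[OF h] wmul_additive[of \<phi>, OF scalar_add])
qed (simp_all add: euler_def testsD[OF h] wmul_add)

definition parity_part :: "bit \<Rightarrow> ('g letter list \<Rightarrow> 'g) \<Rightarrow> 'g letter list \<Rightarrow> 'g" where
  "parity_part i h w = (if wpar w = i then h w else 0)"

lemma parity_part_tests [simp]:
  assumes h: "h \<in> tests"
  shows "parity_part j h \<in> tests"
proof (rule testsI)
  show "supersym (parity_part j h)"
  proof (rule supersymI)
    fix p l m q assume "valid (p @ l # m # q)"
    then have "h (p @ l # m # q) = sg (fst (fst l) * fst (fst m)) (h (p @ m # l # q))"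
      by (rule supersymD[OF testsD(3)[OF h]])
    then show "parity_part j h (p @ l # m # q) = sg (fst (fst l) * fst (fst m)) (parity_part j h (p @ m # l # q))"
      by (simp add: parity_part_def add.left_commute)
  qed
next
  fix a b n w assume ab: "homog a" "homog b" "valid w"
  let ?u = "[(a, 0 :: nat), (b, 1)]"
  have "(ddx ^^ n) (\<lambda>u. parity_part j h (u @ w)) ?u =
      (ddx ^^ n) (\<lambda>u. if fst a + fst b + wpar w = j then h (u @ w) else 0) ?u"
    by (rule ddx_funpow_cong, frule map_fst_pair(2)[OF _ ab(1,2)]) (simp add: parity_part_def)
  then show "parity_part j h ((a \<odot> b, n) # w) = (ddx ^^ n) (\<lambda>u. parity_part j h (u @ w)) ?u"
    using testsD(6)[OF h ab] by (simp add: parity_part_def ddx_funpow_zero add.assoc)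
next
  fix i a k w \<phi> assume "a \<in> prt i" "valid w" "\<phi> \<in> scalars"
  then show "parity_part j h (((i, \<phi> a), k) # w) = \<phi> (parity_part j h (((i, a), k) # w))"
    by (simp add: parity_part_def testsD(5)[OF h] scalar_zero)
qed (simp_all add: parity_part_def testsD[OF h])

end

section \<open>The algebra of evaluation functionals\<close>

lemma diff_add_diff: "(a - b) + (c - d) = (a + c) - (b + d)" for a b c d :: "'a::ab_group_add"
  by (simp add: algebra_simps)

context novikov
begin

type_synonym 'a functional = "('a letter list \<Rightarrow> 'a) \<Rightarrow> 'a"

definition eval_word :: "'g letter list \<Rightarrow> 'g functional" where
  "eval_word w h = (if h \<in> tests then h w else 0)"

text \<open>
  Sums of evaluations at nonempty words with parity in \<open>I\<close>. Words are nonempty so that scalars and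
  signs can be absorbed into their first letter.
\<close>

inductive_set span :: "bit set \<Rightarrow> 'g functional set" for I where
  span_zero_rule: "0 \<in> span I"
| span_step_rule: "wpar w \<in> I \<Longrightarrow> w \<noteq> [] \<Longrightarrow> valid w \<Longrightarrow> \<xi> \<in> span I \<Longrightarrow> eval_word w + \<xi> \<in> span I"

text \<open>
  Sums of functionals that have been unfolded to pointwise form are folded back.
\<close>

lemma functional_eta [simp]:
  fixes \<xi> \<eta> :: "'g functional"
  shows "(\<lambda>h. 0) = (0 :: 'g functional)" "(\<lambda>h. \<xi> h + \<eta> h) = \<xi> + \<eta>" "(\<lambda>h. - \<xi> h) = - \<xi>"
  by auto

lemma span_zero: "0 \<in> span I" by (rule span.intros)

lemma span_step: "wpar w \<in> I \<Longrightarrow> w \<noteq> [] \<Longrightarrow> valid w \<Longrightarrow> \<xi> \<in> span I \<Longrightarrow> eval_word w + \<xi> \<in> span I"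
  by (rule span.intros)

text \<open>
  The rule generated by the inductive definition, with sums of functionals in unexpanded form.
\<close>

lemma span_induct [consumes 1, case_names zero step]:
  assumes "\<xi> \<in> span I" and "P 0"
    and "\<And>w \<xi>. wpar w \<in> I \<Longrightarrow> w \<noteq> [] \<Longrightarrow> valid w \<Longrightarrow> \<xi> \<in> span I \<Longrightarrow> P \<xi> \<Longrightarrow> P (eval_word w + \<xi>)"
  shows "P \<xi>"
  using assms(1) by (rule span.induct) (fact assms(2), rule assms(3))

lemma span_eval_word: "wpar w \<in> I \<Longrightarrow> w \<noteq> [] \<Longrightarrow> valid w \<Longrightarrow> eval_word w \<in> span I"
  using span_step[OF _ _ _ span_zero, of w I] by simp

lemma span_mono: "\<xi> \<in> span I \<Longrightarrow> I \<subseteq> J \<Longrightarrow> \<xi> \<in> span J"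
  by (induction rule: span_induct) (auto intro: span_zero span_step)

lemma span_add: "\<xi> \<in> span I \<Longrightarrow> \<eta> \<in> span I \<Longrightarrow> \<xi> + \<eta> \<in> span I"
  by (induction rule: span_induct) (auto simp: add.assoc intro: span_zero span_step)

lemma eval_word_map_front:
  assumes "\<phi> \<in> insert uminus scalars" "valid (l # w)"
  shows "(\<lambda>h. \<phi> (eval_word (l # w) h)) = eval_word (((fst (fst l), \<phi> (snd (fst l))), snd l) # w)"
proof
  fix h
  show "\<phi> (eval_word (l # w) h) = eval_word (((fst (fst l), \<phi> (snd (fst l))), snd l) # w) h"
  proof (cases "h \<in> tests")
    case False
    then show ?thesis using assms(1) by (auto simp: eval_word_def scalar_zero)
  next
    case h: True
    obtain i a k where l: "l = ((i, a), k)" by (metis prod.collapse)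
    have z: "h (((i, 0), k) # w) = 0" if "valid w"
      using testsD(4)[OF h, of 0 i 0 w k] that by simp
    have "h (((i, - a), k) # w) = - h (((i, a), k) # w)"
      using testsD(4)[OF h, of a i "- a" w k] assms(2) z by (simp add: l eq_neg_iff_add_eq_0 add.commute)
    then show ?thesis using assms h by (auto simp: eval_word_def l testsD(5)[OF h])
  qed
qed

lemma span_map:
  assumes "\<phi> \<in> insert uminus scalars" "\<xi> \<in> span I"
  shows "(\<lambda>h. \<phi> (\<xi> h)) \<in> span I"
  using assms(2)
proof (induction rule: span_induct)
  case zero
  have "(\<lambda>h. \<phi> ((0 :: 'g functional) h)) = 0"
    using assms(1) by (auto simp: fun_eq_iff scalar_zero)
  then show ?case by (simp add: span_zero)
next
  case (step w \<xi>)
  obtain l u where w: "w = l # u" using step by (cases w) auto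
  have h: "homog (fst (fst l), \<phi> (snd (fst l)))" using assms(1) step by (auto simp: w homog_def)
  have "(\<lambda>h. \<phi> ((eval_word w + \<xi>) h)) = eval_word (((fst (fst l), \<phi> (snd (fst l))), snd l) # u) + (\<lambda>h. \<phi> (\<xi> h))"
    using eval_word_map_front[OF assms(1), of l u] step assms(1)
    by (auto simp: w fun_eq_iff scalar_add)
  then show ?case using h step by (simp add: w span_step)
qed

lemma span_uminus: "\<xi> \<in> span I \<Longrightarrow> - \<xi> \<in> span I"
  using span_map[of uminus \<xi> I] by simp

lemma span_outside: "\<xi> \<in> span I \<Longrightarrow> h \<notin> tests \<Longrightarrow> \<xi> h = 0"
  by (induction rule: span_induct) (auto simp: eval_word_def)

lemma span_total: "\<xi> \<in> span I \<Longrightarrow> \<xi> h \<in> total"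
  by (induction rule: span_induct) (auto simp: eval_word_def testsD(2))

lemma span_parity_part: "\<xi> \<in> span {i} \<Longrightarrow> h \<in> tests \<Longrightarrow> \<xi> (parity_part j h) = (if i = j then \<xi> h else 0)"
  by (induction rule: span_induct) (auto simp: eval_word_def parity_part_def[of _ _ "_ :: 'g letter list"])

text \<open>
  A functional that sees only even words and also only odd words vanishes, since cutting a test
  function down to words of one parity gives a test function.
\<close>

lemma span_disjoint:
  assumes "\<xi> \<in> span {0}" "\<xi> \<in> span {1}"
  shows "\<xi> = 0"
proof
  fix h
  show "\<xi> h = 0 h"
  proof (cases "h \<in> tests")
    case True
    then show ?thesis
      using span_parity_part[OF assms(1) True, of 0] span_parity_part[OF assms(2) True, of 0] by simp
  qed (use span_outside[OF assms(1)] in simp)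
qed

lemma span_decompose: "\<xi> \<in> span UNIV \<Longrightarrow> \<exists>\<eta>\<in>span {0}. \<exists>\<zeta>\<in>span {1}. \<xi> = \<eta> + \<zeta>"
proof (induction rule: span_induct)
  case zero
  show ?case by (intro bexI[where x = 0]) (auto intro: span_zero span_step)
next
  case (step w \<xi>)
  then obtain \<eta> \<zeta> where *: "\<eta> \<in> span {0}" "\<zeta> \<in> span {1}" "\<xi> = \<eta> + \<zeta>" by blast
  show ?case
  proof (cases "wpar w = 0")
    case True
    then have "eval_word w + \<eta> \<in> span {0}" using step * by (intro span_step) auto
    then show ?thesis using * by (intro bexI[of _ "eval_word w + \<eta>"] bexI[of _ \<zeta>]) (auto simp: add.assoc)
  next
    case False
    then have "eval_word w + \<zeta> \<in> span {1}" using step * by (intro span_step) auto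
    then show ?thesis using * by (intro bexI[of _ "\<eta>"] bexI[of _ "eval_word w + \<zeta>"]) (auto simp: ac_simps)
  qed
qed

text \<open>
  Convolution along concatenation of words, so that evaluations multiply like words.
\<close>

definition conv :: "'g functional \<Rightarrow> 'g functional \<Rightarrow> 'g functional" where
  "conv \<xi> \<eta> h = (if h \<in> tests then \<xi> (\<lambda>u. \<eta> (\<lambda>v. h (u @ v))) else 0)"

definition evaluated :: "'g functional \<Rightarrow> ('g letter list \<Rightarrow> 'g) \<Rightarrow> 'g letter list \<Rightarrow> 'g" where
  "evaluated \<eta> h = (\<lambda>u. \<eta> (\<lambda>v. h (u @ v)))"

lemma evaluated_tests [simp]: "\<eta> \<in> span J \<Longrightarrow> h \<in> tests \<Longrightarrow> evaluated \<eta> h \<in> tests"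
  unfolding evaluated_def by (induction rule: span_induct) (simp_all add: eval_word_def)

lemma conv_zero: "conv 0 \<eta> = 0" "\<xi> \<in> span I \<Longrightarrow> conv \<xi> 0 = 0"
proof -
  show "conv 0 \<eta> = 0" by (auto simp: conv_def)
  have "\<xi> (\<lambda>u. 0) = 0" if "\<xi> \<in> span I" using that by (induction rule: span_induct) (auto simp: eval_word_def)
  then show "conv \<xi> 0 = 0" if "\<xi> \<in> span I" using that by (auto simp: conv_def)
qed

lemma conv_add_left: "conv (\<xi> + \<xi>') \<eta> = conv \<xi> \<eta> + conv \<xi>' \<eta>"
  by (auto simp: conv_def fun_eq_iff)

lemma span_additive: "\<xi> \<in> span I \<Longrightarrow> h \<in> tests \<Longrightarrow> h' \<in> tests \<Longrightarrow> \<xi> (\<lambda>w. h w + h' w) = \<xi> h + \<xi> h'"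
  by (induction rule: span_induct) (auto simp: eval_word_def)

lemma conv_add_right:
  assumes "\<xi> \<in> span I" "\<eta> \<in> span J" "\<eta>' \<in> span J'"
  shows "conv \<xi> (\<eta> + \<eta>') = conv \<xi> \<eta> + conv \<xi> \<eta>'"
proof
  fix h
  show "conv \<xi> (\<eta> + \<eta>') h = (conv \<xi> \<eta> + conv \<xi> \<eta>') h"
    using span_additive[OF assms(1) evaluated_tests[OF assms(2)] evaluated_tests[OF assms(3)], of h h]
    by (auto simp: conv_def evaluated_def)
qed

lemma conv_eval_word: "valid w \<Longrightarrow> valid w' \<Longrightarrow> conv (eval_word w) (eval_word w') = eval_word (w @ w')"
  by (auto simp: conv_def eval_word_def fun_eq_iff)

lemma conv_span:
  assumes "\<xi> \<in> span I" "\<eta> \<in> span J" and IJ: "\<And>i j. i \<in> I \<Longrightarrow> j \<in> J \<Longrightarrow> i + j \<in> L"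
  shows "conv \<xi> \<eta> \<in> span L"
  using assms(1)
proof (induction rule: span_induct)
  case zero
  show ?case by (simp add: conv_zero span_zero)
next
  case (step w \<xi>)
  have "conv (eval_word w) \<eta> \<in> span L"
    using assms(2)
  proof (induction rule: span_induct)
    case zero
    show ?case using conv_zero(2)[OF span_eval_word[of w I]] step by (simp add: span_zero)
  next
    case (step w' \<eta>)
    have "conv (eval_word w) (eval_word w' + \<eta>) = eval_word (w @ w') + conv (eval_word w) \<eta>"
      using conv_add_right[OF span_eval_word[of w UNIV] span_eval_word[of w' UNIV] step.hyps(4)]
        \<open>w \<noteq> []\<close> \<open>valid w\<close> step.hyps by (simp add: conv_eval_word)
    then show ?case using step \<open>wpar w \<in> I\<close> \<open>valid w\<close> IJ by (simp add: span_step)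
  qed
  then show ?case using step by (simp add: conv_add_left span_add)
qed

lemma conv_assoc:
  assumes "\<zeta> \<in> span I"
  shows "conv (conv \<xi> \<eta>) \<zeta> = conv \<xi> (conv \<eta> \<zeta>)"
proof
  fix h
  show "conv (conv \<xi> \<eta>) \<zeta> h = conv \<xi> (conv \<eta> \<zeta>) h"
    using evaluated_tests[OF assms, of h] by (auto simp: conv_def evaluated_def)
qed

lemma conv_commute:
  assumes "\<xi> \<in> span {i}" "\<eta> \<in> span {j}"
  shows "conv \<xi> \<eta> = sg (i * j) (conv \<eta> \<xi>)"
  using assms(1)
proof (induction rule: span_induct)
  case zero
  show ?case by (simp add: conv_zero(1) conv_zero(2)[OF assms(2)])
next
  case (step w \<xi>)
  have w: "eval_word w \<in> span {i}" using step by (intro span_eval_word) auto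
  have "conv (eval_word w) \<eta> = sg (i * j) (conv \<eta> (eval_word w))"
    using assms(2)
  proof (induction rule: span_induct)
    case zero
    show ?case by (simp add: conv_zero(1) conv_zero(2)[OF w])
  next
    case (step w' \<eta>)
    have w': "eval_word w' \<in> span {j}" using step by (intro span_eval_word) auto
    have "eval_word (w @ w') = sg (i * j) (eval_word (w' @ w))"
    proof
      fix h
      show "eval_word (w @ w') h = sg (i * j) (eval_word (w' @ w)) h"
        using supersym_blocks[OF testsD(3), of h w w'] step \<open>valid w\<close> \<open>wpar w \<in> {i}\<close>
        by (cases "i * j") (auto simp: eval_word_def)
    qed
    then show ?case
      using step conv_add_right[OF w w' step(4)] \<open>valid w\<close>
      by (simp add: conv_add_left conv_eval_word sg_add)
  qed
  then show ?case
    using step conv_add_right[OF assms(2) w step(4)] by (simp add: conv_add_left sg_add)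
qed

text \<open>
  The transpose of an operator on test functions.
\<close>

definition dual :: "(('g letter list \<Rightarrow> 'g) \<Rightarrow> ('g letter list \<Rightarrow> 'g)) \<Rightarrow> 'g functional \<Rightarrow> 'g functional" where
  "dual \<Theta> \<xi> h = (if h \<in> tests then \<xi> (\<Theta> h) else 0)"

lemma dual_zero: "dual \<Theta> 0 = 0" by (auto simp: dual_def)

lemma dual_add: "dual \<Theta> (\<xi> + \<eta>) = dual \<Theta> \<xi> + dual \<Theta> \<eta>"
  by (auto simp: dual_def fun_eq_iff)

text \<open>
  A transpose that satisfies the product rule on evaluations satisfies it everywhere, because all
  functionals in \<open>span\<close> are sums of evaluations.
\<close>

lemma dual_conv:
  assumes "\<And>w I. wpar w \<in> I \<Longrightarrow> w \<noteq> [] \<Longrightarrow> valid w \<Longrightarrow> dual \<Theta> (eval_word w) \<in> span I"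
    and eval_word: "\<And>w w'. w \<noteq> [] \<Longrightarrow> w' \<noteq> [] \<Longrightarrow> valid w \<Longrightarrow> valid w' \<Longrightarrow>
      dual \<Theta> (eval_word (w @ w')) = conv (dual \<Theta> (eval_word w)) (eval_word w') + conv (eval_word w) (dual \<Theta> (eval_word w'))"
  shows "\<xi> \<in> span I \<Longrightarrow> dual \<Theta> \<xi> \<in> span I"
    and "\<xi> \<in> span I \<Longrightarrow> \<eta> \<in> span J \<Longrightarrow> dual \<Theta> (conv \<xi> \<eta>) = conv (dual \<Theta> \<xi>) \<eta> + conv \<xi> (dual \<Theta> \<eta>)"
proof -
  show cl: "dual \<Theta> \<xi> \<in> span I" if "\<xi> \<in> span I" for \<xi> I
    using that by (induction rule: span_induct) (auto simp: dual_zero dual_add assms(1) intro: span_zero span_add)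
  assume "\<xi> \<in> span I" and \<eta>: "\<eta> \<in> span J"
  then show "dual \<Theta> (conv \<xi> \<eta>) = conv (dual \<Theta> \<xi>) \<eta> + conv \<xi> (dual \<Theta> \<eta>)"
  proof (induction rule: span_induct)
    case zero
    show ?case by (simp add: conv_zero dual_zero)
  next
    case (step w \<xi>)
    have w: "eval_word w \<in> span I" using step by (intro span_eval_word) auto
    have "dual \<Theta> (conv (eval_word w) \<eta>) = conv (dual \<Theta> (eval_word w)) \<eta> + conv (eval_word w) (dual \<Theta> \<eta>)"
      using \<eta>
    proof (induction rule: span_induct)
      case zero
      show ?case by (simp add: conv_zero(2)[OF w] conv_zero(2)[OF cl[OF w]] dual_zero)
    next
      case (step w' \<eta>)
      have w': "eval_word w' \<in> span J" using step by (intro span_eval_word) auto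
      have "dual \<Theta> (conv (eval_word w) (eval_word w' + \<eta>)) = dual \<Theta> (eval_word (w @ w')) + dual \<Theta> (conv (eval_word w) \<eta>)"
        using conv_add_right[OF w w' step(4)] \<open>valid w\<close> \<open>valid w'\<close> by (simp only: dual_add conv_eval_word)
      moreover have "conv (dual \<Theta> (eval_word w)) (eval_word w' + \<eta>) = conv (dual \<Theta> (eval_word w)) (eval_word w') + conv (dual \<Theta> (eval_word w)) \<eta>"
        by (rule conv_add_right[OF cl[OF w] w' step(4)])
      moreover have "conv (eval_word w) (dual \<Theta> (eval_word w' + \<eta>)) = conv (eval_word w) (dual \<Theta> (eval_word w')) + conv (eval_word w) (dual \<Theta> \<eta>)"
        unfolding dual_add by (rule conv_add_right[OF w cl[OF w'] cl[OF step(4)]])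
      ultimately show ?case
        using step.IH eval_word[OF \<open>w \<noteq> []\<close> \<open>w' \<noteq> []\<close> \<open>valid w\<close> \<open>valid w'\<close>]
        by (simp only: ac_simps)
    qed
    then show ?case using step.IH[OF \<eta>] by (simp only: conv_add_left dual_add ac_simps)
  qed
qed

lemma raise_sum_apply: "raise_sum w F h = raise_sum w (\<lambda>v. F v h)"
  by (induction w arbitrary: F) simp_all

lemma dual_ddx_eval_word: "dual ddx (eval_word w) = raise_sum w eval_word"
proof
  fix h
  show "dual ddx (eval_word w) h = raise_sum w eval_word h"
    by (cases "h \<in> tests") (auto simp: raise_sum_apply dual_def eval_word_def ddx_def raise_sum_zero)
qed

lemma raise_sum_span:
  assumes "\<And>v. map fst v = map fst w \<Longrightarrow> F v \<in> span I"
  shows "raise_sum w F \<in> span I"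
  using assms
proof (induction w arbitrary: F)
  case Nil
  show ?case by (simp add: span_zero)
next
  case (Cons l w)
  then show ?case by (auto intro!: span_add)
qed

lemma raise_sum_conv:
  assumes "\<xi> \<in> span I" "\<And>v. map fst v = map fst w \<Longrightarrow> F v \<in> span J"
  shows "conv \<xi> (raise_sum w F) = raise_sum w (\<lambda>v. conv \<xi> (F v))"
  using assms(2)
proof (induction w arbitrary: F)
  case Nil
  show ?case using conv_zero(2)[OF assms(1)] by simp
next
  case (Cons l w)
  have "conv \<xi> (F ((fst l, Suc (snd l)) # w) + raise_sum w (\<lambda>w. F (l # w))) =
      conv \<xi> (F ((fst l, Suc (snd l)) # w)) + conv \<xi> (raise_sum w (\<lambda>w. F (l # w)))"
    by (rule conv_add_right[OF assms(1)]) (auto intro!: Cons.prems raise_sum_span)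
  then show ?case using Cons by simp
qed

lemma conv_raise_sum: "conv (raise_sum w F) \<eta> = raise_sum w (\<lambda>v. conv (F v) \<eta>)"
  by (rule raise_sum_additive[of "\<lambda>\<xi>. conv \<xi> \<eta>"]) (rule conv_add_left)

lemma dual_ddx:
  shows "\<xi> \<in> span I \<Longrightarrow> dual ddx \<xi> \<in> span I"
    and "\<xi> \<in> span I \<Longrightarrow> \<eta> \<in> span J \<Longrightarrow> dual ddx (conv \<xi> \<eta>) = conv (dual ddx \<xi>) \<eta> + conv \<xi> (dual ddx \<eta>)"
proof -
  have cl: "raise_sum w eval_word \<in> span I" if "wpar w \<in> I" "w \<noteq> []" "valid w" for w I
  proof (rule raise_sum_span)
    fix v :: "'g letter list" assume "map fst v = map fst w"
    then show "eval_word v \<in> span I" using that by (intro span_eval_word) (auto simp: wpar_def valid_def)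
  qed
  have "raise_sum (w @ w') eval_word = conv (raise_sum w eval_word) (eval_word w') + conv (eval_word w) (raise_sum w' eval_word)"
    if w: "w \<noteq> []" "w' \<noteq> []" "valid w" "valid w'" for w w'
  proof -
    have "conv (raise_sum w eval_word) (eval_word w') = raise_sum w (\<lambda>v. eval_word (v @ w'))"
      unfolding conv_raise_sum by (rule raise_sum_cong, rule conv_eval_word) (use w in \<open>auto simp: valid_def\<close>)
    moreover have "conv (eval_word w) (raise_sum w' eval_word) = raise_sum w' (\<lambda>v. conv (eval_word w) (eval_word v))"
    proof (rule raise_sum_conv[OF span_eval_word[of w UNIV]])
      fix v :: "'g letter list" assume "map fst v = map fst w'"
      then show "eval_word v \<in> span UNIV" using w by (intro span_eval_word) (auto simp: valid_def)
    qed (use w in auto)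
    moreover have "raise_sum w' (\<lambda>v. conv (eval_word w) (eval_word v)) = raise_sum w' (\<lambda>v. eval_word (w @ v))"
      by (rule raise_sum_cong, rule conv_eval_word) (use w in \<open>auto simp: valid_def\<close>)
    ultimately show ?thesis by (simp add: raise_sum_append)
  qed
  with cl show "\<xi> \<in> span I \<Longrightarrow> dual ddx \<xi> \<in> span I"
    and "\<xi> \<in> span I \<Longrightarrow> \<eta> \<in> span J \<Longrightarrow> dual ddx (conv \<xi> \<eta>) = conv (dual ddx \<xi>) \<eta> + conv \<xi> (dual ddx \<eta>)"
    using dual_conv[of ddx] by (simp_all add: dual_ddx_eval_word)
qed

lemma wmul_apply: "wmul m n F h = wmul m n (F h)"
proof -
  have "nmul m F h = nmul m (F h)" for m by (induction m) simp_all
  then show ?thesis by (simp add: wmul_def)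
qed

lemma dual_euler_eval_word: "dual euler (eval_word w) = wmul (length w) (ord w) (eval_word w)"
proof
  fix h
  show "dual euler (eval_word w) h = wmul (length w) (ord w) (eval_word w) h"
    by (cases "h \<in> tests") (auto simp: wmul_apply dual_def eval_word_def euler_def)
qed

lemma nmul_span: "\<xi> \<in> span I \<Longrightarrow> nmul n \<xi> \<in> span I"
  by (induction n) (auto intro: span_add span_zero)

lemma conv_nmul:
  assumes "\<xi> \<in> span I" "\<eta> \<in> span J"
  shows "conv (nmul n \<xi>) \<eta> = nmul n (conv \<xi> \<eta>)" "conv \<xi> (nmul n \<eta>) = nmul n (conv \<xi> \<eta>)"
  by (induction n)
     (simp_all add: conv_zero(1) conv_zero(2)[OF assms(1)] conv_add_left conv_add_right[OF assms(1,2) nmul_span[OF assms(2)]])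

lemma conv_uminus:
  assumes "\<xi> \<in> span I" "\<eta> \<in> span J"
  shows "conv (- \<xi>) \<eta> = - conv \<xi> \<eta>" "conv \<xi> (- \<eta>) = - conv \<xi> \<eta>"
  using conv_add_left[of \<xi> "- \<xi>" \<eta>] conv_add_right[OF assms span_uminus[OF assms(2)]]
  by (simp_all add: eq_neg_iff_add_eq_0 add.commute conv_zero(1) conv_zero(2)[OF assms(1)])

lemma conv_wmul:
  assumes "\<xi> \<in> span I" "\<eta> \<in> span J"
  shows "conv (wmul m n \<xi>) \<eta> = wmul m n (conv \<xi> \<eta>)" "conv \<xi> (wmul m n \<eta>) = wmul m n (conv \<xi> \<eta>)"
proof -
  have "conv (nmul m \<xi> + - nmul n \<xi>) \<eta> = conv (nmul m \<xi>) \<eta> + - conv (nmul n \<xi>) \<eta>"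
    by (simp only: conv_add_left conv_uminus(1)[OF nmul_span[OF assms(1)] assms(2)])
  then show "conv (wmul m n \<xi>) \<eta> = wmul m n (conv \<xi> \<eta>)" by (simp add: wmul_def conv_nmul[OF assms])
  have "conv \<xi> (nmul m \<eta> + - nmul n \<eta>) = conv \<xi> (nmul m \<eta>) + - conv \<xi> (nmul n \<eta>)"
    by (simp only: conv_add_right[OF assms(1) nmul_span[OF assms(2)] span_uminus[OF nmul_span[OF assms(2)]]]
        conv_uminus(2)[OF assms(1) nmul_span[OF assms(2)]])
  then show "conv \<xi> (wmul m n \<eta>) = wmul m n (conv \<xi> \<eta>)" by (simp add: wmul_def conv_nmul[OF assms])
qed

lemma dual_euler:
  shows "\<xi> \<in> span I \<Longrightarrow> dual euler \<xi> \<in> span I"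
    and "\<xi> \<in> span I \<Longrightarrow> \<eta> \<in> span J \<Longrightarrow> dual euler (conv \<xi> \<eta>) = conv (dual euler \<xi>) \<eta> + conv \<xi> (dual euler \<eta>)"
proof -
  have cl: "wmul m n (eval_word w) \<in> span I" if "wpar w \<in> I" "w \<noteq> []" "valid w" for w I m n
    using nmul_span[OF span_eval_word[OF that]] span_add[OF _ span_uminus, of "nmul m (eval_word w)" I "nmul n (eval_word w)"]
    by (simp add: wmul_def)
  have "dual euler (eval_word (w @ w')) = conv (dual euler (eval_word w)) (eval_word w') + conv (eval_word w) (dual euler (eval_word w'))"
    if w: "w \<noteq> []" "w' \<noteq> []" "valid w" "valid w'" for w w'
    using conv_wmul[OF span_eval_word[of w UNIV] span_eval_word[of w' UNIV]] w
    by (simp add: dual_euler_eval_word conv_eval_word wmul_plus)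
  with cl show "\<xi> \<in> span I \<Longrightarrow> dual euler \<xi> \<in> span I"
    and "\<xi> \<in> span I \<Longrightarrow> \<eta> \<in> span J \<Longrightarrow> dual euler (conv \<xi> \<eta>) = conv (dual euler \<xi>) \<eta> + conv \<xi> (dual euler \<eta>)"
    using dual_conv[of euler] by (simp_all add: dual_euler_eval_word)
qed

text \<open>
  Differentiation lowers the eigenvalue of \<open>E\<close> on a word by one.
\<close>

lemma euler_ddx:
  assumes "\<xi> \<in> span I"
  shows "dual euler (dual ddx \<xi>) = dual ddx (dual euler \<xi>) - dual ddx \<xi>"
  using assms
proof (induction rule: span_induct)
  case zero
  show ?case by (simp add: dual_zero)
next
  case (step w \<xi>)
  have "dual euler (dual ddx (eval_word w)) = raise_sum w (\<lambda>v. wmul (length w) (Suc (ord w)) (eval_word v))"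
  proof -
    have "dual euler (raise_sum w eval_word) = raise_sum w (\<lambda>v. dual euler (eval_word v))"
      by (rule raise_sum_additive[of "dual euler"]) (rule dual_add)
    also have "\<dots> = raise_sum w (\<lambda>v. wmul (length w) (Suc (ord w)) (eval_word v))"
      by (rule raise_sum_cong) (metis dual_euler_eval_word length_map)
    finally show ?thesis by (simp add: dual_ddx_eval_word)
  qed
  also have "\<dots> = wmul (length w) (Suc (ord w)) (raise_sum w eval_word)"
    by (rule raise_sum_additive[of "wmul (length w) (Suc (ord w))", symmetric]) (rule wmul_add)
  also have "\<dots> = wmul (length w) (ord w) (raise_sum w eval_word) - raise_sum w eval_word"
    by (simp add: wmul_def algebra_simps)
  also have "wmul (length w) (ord w) (raise_sum w eval_word) = dual ddx (dual euler (eval_word w))"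
    unfolding dual_euler_eval_word dual_ddx_eval_word[symmetric] by (rule wmul_additive[of "dual ddx", symmetric]) (rule dual_add)
  finally show ?case using step.IH by (simp only: dual_ddx_eval_word dual_add diff_add_diff)
qed

lemma conv_map:
  assumes \<phi>: "\<phi> \<in> scalars" and "\<xi> \<in> span I" and \<eta>: "\<eta> \<in> span J"
  shows "conv (\<lambda>h. \<phi> (\<xi> h)) \<eta> = (\<lambda>h. \<phi> (conv \<xi> \<eta> h))"
    and "conv \<xi> (\<lambda>h. \<phi> (\<eta> h)) = (\<lambda>h. \<phi> (conv \<xi> \<eta> h))"
proof -
  show "conv (\<lambda>h. \<phi> (\<xi> h)) \<eta> = (\<lambda>h. \<phi> (conv \<xi> \<eta> h))"
    by (auto simp: conv_def scalar_zero[OF \<phi>])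
  have m: "(\<lambda>h. \<phi> (\<eta> h)) \<in> span J" using span_map[OF _ \<eta>] \<phi> by simp
  have "conv \<xi> (\<lambda>h. \<phi> (\<eta> h)) h = \<phi> (conv \<xi> \<eta> h)" for h
    using assms(2)
  proof (induction rule: span_induct)
    case zero
    show ?case by (simp add: conv_zero scalar_zero[OF \<phi>])
  next
    case (step w \<xi>)
    have "conv (eval_word w) (\<lambda>h. \<phi> (\<eta> h)) h = \<phi> (conv (eval_word w) \<eta> h)"
      using evaluated_tests[OF m, of h] evaluated_tests[OF \<eta>, of h]
      by (auto simp: conv_def evaluated_def eval_word_def scalar_zero[OF \<phi>])
    then show ?case using step by (simp add: conv_add_left scalar_add[OF \<phi>])
  qed
  then show "conv \<xi> (\<lambda>h. \<phi> (\<eta> h)) = (\<lambda>h. \<phi> (conv \<xi> \<eta> h))" by (rule ext)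
qed

lemma dual_map: "\<phi> \<in> scalars \<Longrightarrow> dual \<Theta> (\<lambda>h. \<phi> (\<xi> h)) = (\<lambda>h. \<phi> (dual \<Theta> \<xi> h))"
  by (auto simp: dual_def scalar_zero)

text \<open>
  The embedding of \<open>V\<close> on homogeneous elements.
\<close>

definition generator :: "'g elt \<Rightarrow> 'g functional" where
  "generator x = eval_word [(x, 0)]"

lemma generator_span: "homog x \<Longrightarrow> fst x \<in> I \<Longrightarrow> generator x \<in> span I"
  unfolding generator_def by (rule span_eval_word) auto

lemma generator_add: "a \<in> prt i \<Longrightarrow> b \<in> prt i \<Longrightarrow> generator (i, a + b) = generator (i, a) + generator (i, b)"
  by (auto simp: generator_def eval_word_def fun_eq_iff testsD(4))

lemma generator_scalar: "\<phi> \<in> scalars \<Longrightarrow> a \<in> prt i \<Longrightarrow> generator (i, \<phi> a) = (\<lambda>h. \<phi> (generator (i, a) h))"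
  by (auto simp: generator_def eval_word_def fun_eq_iff testsD(5) scalar_zero)

lemma generator_mul:
  assumes "homog x" "homog y"
  shows "generator (x \<odot> y) = conv (generator x) (dual ddx (generator y))"
proof -
  have "eval_word [(x \<odot> y, 0)] = eval_word [(x, 0), (y, 1)]"
    using testsD(6)[OF _ assms, of _ "[]" 0] by (auto simp: eval_word_def fun_eq_iff)
  also have "\<dots> = conv (eval_word [(x, 0)]) (eval_word [(y, 1)])" using assms by (simp add: conv_eval_word)
  also have "eval_word [(y, 1)] = dual ddx (eval_word [(y, 0)])" by (auto simp: dual_ddx_eval_word)
  finally show ?thesis by (simp add: generator_def)
qed

lemma euler_generator: "dual euler (generator x) = generator x"
proof -
  have "wmul 1 0 (eval_word [(x, 0)]) = eval_word [(x, 0)]" by (simp add: wmul_def)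
  then show ?thesis by (simp add: generator_def dual_euler_eval_word)
qed

text \<open>
  The test function \<open>word_value\<close> recovers an element from its image.
\<close>

lemma generator_word_value: "homog x \<Longrightarrow> generator x word_value = snd x"
  by (simp add: generator_def eval_word_def word_value_tests word_value_single)

end

section \<open>The Poisson bracket of two derivations\<close>

text \<open>
  The data that produce a Poisson bracket. All laws are relative to the set \<open>car\<close>, because the
  convolution of functionals obeys them only on sums of evaluations.
\<close>

locale differential_superalgebra =
  fixes K :: "('k, 'c) ring_scheme" and car :: "'p::ab_group_add set" and hom :: "bit \<Rightarrow> 'p set"
    and prod :: "'p \<Rightarrow> 'p \<Rightarrow> 'p" (infixl \<open>\<star>\<close> 70) and sc :: "'k \<Rightarrow> 'p \<Rightarrow> 'p"
    and D :: "'p \<Rightarrow> 'p" and E :: "'p \<Rightarrow> 'p"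
  assumes K: "cring K"
    and hom_car: "x \<in> hom i \<Longrightarrow> x \<in> car"
    and hom_zero: "0 \<in> hom i" and hom_add: "x \<in> hom i \<Longrightarrow> y \<in> hom i \<Longrightarrow> x + y \<in> hom i"
    and hom_uminus: "x \<in> hom i \<Longrightarrow> - x \<in> hom i"
    and hom_sc: "k \<in> carrier K \<Longrightarrow> x \<in> hom i \<Longrightarrow> sc k x \<in> hom i"
    and hom_disjoint: "x \<in> hom 0 \<Longrightarrow> x \<in> hom 1 \<Longrightarrow> x = 0"
    and car_decompose: "x \<in> car \<Longrightarrow> \<exists>y\<in>hom 0. \<exists>z\<in>hom 1. x = y + z"
    and car_add [simp]: "x \<in> car \<Longrightarrow> y \<in> car \<Longrightarrow> x + y \<in> car"
    and sc_car [simp]: "k \<in> carrier K \<Longrightarrow> x \<in> car \<Longrightarrow> sc k x \<in> car"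
    and sc_add_left: "k \<in> carrier K \<Longrightarrow> l \<in> carrier K \<Longrightarrow> x \<in> car \<Longrightarrow> sc (k \<oplus>\<^bsub>K\<^esub> l) x = sc k x + sc l x"
    and sc_add_right: "k \<in> carrier K \<Longrightarrow> x \<in> car \<Longrightarrow> y \<in> car \<Longrightarrow> sc k (x + y) = sc k x + sc k y"
    and sc_mult: "k \<in> carrier K \<Longrightarrow> l \<in> carrier K \<Longrightarrow> x \<in> car \<Longrightarrow> sc (k \<otimes>\<^bsub>K\<^esub> l) x = sc k (sc l x)"
    and sc_one: "x \<in> car \<Longrightarrow> sc \<one>\<^bsub>K\<^esub> x = x"
    and prod_hom: "x \<in> hom i \<Longrightarrow> y \<in> hom j \<Longrightarrow> x \<star> y \<in> hom (i + j)"
    and prod_car [simp]: "x \<in> car \<Longrightarrow> y \<in> car \<Longrightarrow> x \<star> y \<in> car"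
    and prod_add_left: "x \<in> car \<Longrightarrow> y \<in> car \<Longrightarrow> z \<in> car \<Longrightarrow> (x + y) \<star> z = x \<star> z + y \<star> z"
    and prod_add_right: "x \<in> car \<Longrightarrow> y \<in> car \<Longrightarrow> z \<in> car \<Longrightarrow> x \<star> (y + z) = x \<star> y + x \<star> z"
    and prod_sc_left: "k \<in> carrier K \<Longrightarrow> x \<in> car \<Longrightarrow> y \<in> car \<Longrightarrow> sc k x \<star> y = sc k (x \<star> y)"
    and prod_sc_right: "k \<in> carrier K \<Longrightarrow> x \<in> car \<Longrightarrow> y \<in> car \<Longrightarrow> x \<star> sc k y = sc k (x \<star> y)"
    and prod_assoc: "x \<in> car \<Longrightarrow> y \<in> car \<Longrightarrow> z \<in> car \<Longrightarrow> (x \<star> y) \<star> z = x \<star> (y \<star> z)"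
    and prod_commute: "x \<in> hom i \<Longrightarrow> y \<in> hom j \<Longrightarrow> x \<star> y = sg (i * j) (y \<star> x)"
    and D_hom: "x \<in> hom i \<Longrightarrow> D x \<in> hom i" and E_hom: "x \<in> hom i \<Longrightarrow> E x \<in> hom i"
    and D_car [simp]: "x \<in> car \<Longrightarrow> D x \<in> car" and E_car [simp]: "x \<in> car \<Longrightarrow> E x \<in> car"
    and D_add: "x \<in> car \<Longrightarrow> y \<in> car \<Longrightarrow> D (x + y) = D x + D y"
    and E_add: "x \<in> car \<Longrightarrow> y \<in> car \<Longrightarrow> E (x + y) = E x + E y"
    and D_sc: "k \<in> carrier K \<Longrightarrow> x \<in> car \<Longrightarrow> D (sc k x) = sc k (D x)"
    and E_sc: "k \<in> carrier K \<Longrightarrow> x \<in> car \<Longrightarrow> E (sc k x) = sc k (E x)"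
    and D_prod: "x \<in> car \<Longrightarrow> y \<in> car \<Longrightarrow> D (x \<star> y) = D x \<star> y + x \<star> D y"
    and E_prod: "x \<in> car \<Longrightarrow> y \<in> car \<Longrightarrow> E (x \<star> y) = E x \<star> y + x \<star> E y"
    and E_D: "x \<in> car \<Longrightarrow> E (D x) = D (E x) - D x"
begin

lemma car_zero [simp]: "0 \<in> car" using hom_car[OF hom_zero] .

lemma car_uminus [simp]: "x \<in> car \<Longrightarrow> - x \<in> car"
proof -
  assume "x \<in> car"
  then obtain y z where "y \<in> hom 0" "z \<in> hom 1" "x = y + z" using car_decompose by blast
  then show "- x \<in> car" using car_add[OF hom_car[OF hom_uminus] hom_car[OF hom_uminus]] by simp
qed

lemma car_diff [simp]: "x \<in> car \<Longrightarrow> y \<in> car \<Longrightarrow> x - y \<in> car"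
  using car_add[of x "- y"] by simp

lemma additive_uminus:
  assumes "\<And>x y. x \<in> car \<Longrightarrow> y \<in> car \<Longrightarrow> f (x + y) = f x + (f y :: 'p)" "x \<in> car"
  shows "f (- x) = - f x"
  using assms(1)[of x "- x"] assms(1)[of 0 0] assms(2) by (simp add: eq_neg_iff_add_eq_0 add.commute)

lemma additive_diff:
  assumes "\<And>x y. x \<in> car \<Longrightarrow> y \<in> car \<Longrightarrow> f (x + y) = f x + (f y :: 'p)" "x \<in> car" "y \<in> car"
  shows "f (x - y) = f x - f y"
  using assms(1)[of x "- y"] additive_uminus[of f, OF assms(1) assms(3)] assms by simp

lemma D_diff: "x \<in> car \<Longrightarrow> y \<in> car \<Longrightarrow> D (x - y) = D x - D y"
  and E_diff: "x \<in> car \<Longrightarrow> y \<in> car \<Longrightarrow> E (x - y) = E x - E y"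
  and prod_diff_left: "x \<in> car \<Longrightarrow> y \<in> car \<Longrightarrow> z \<in> car \<Longrightarrow> (x - y) \<star> z = x \<star> z - y \<star> z"
  and prod_diff_right: "x \<in> car \<Longrightarrow> y \<in> car \<Longrightarrow> z \<in> car \<Longrightarrow> z \<star> (x - y) = z \<star> x - z \<star> y"
  and sc_uminus: "k \<in> carrier K \<Longrightarrow> x \<in> car \<Longrightarrow> sc k (- x) = - sc k x"
  and sc_diff: "k \<in> carrier K \<Longrightarrow> x \<in> car \<Longrightarrow> y \<in> car \<Longrightarrow> sc k (x - y) = sc k x - sc k y"
  and prod_uminus_left: "x \<in> car \<Longrightarrow> z \<in> car \<Longrightarrow> (- x) \<star> z = - (x \<star> z)"
  and prod_uminus_right: "x \<in> car \<Longrightarrow> z \<in> car \<Longrightarrow> z \<star> (- x) = - (z \<star> x)"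
  using additive_diff[of D, OF D_add] additive_diff[of E, OF E_add]
    additive_diff[of "\<lambda>x. x \<star> z"] additive_diff[of "\<lambda>x. z \<star> x"] additive_uminus[of "sc k"] additive_diff[of "sc k"]
    additive_uminus[of "\<lambda>x. x \<star> z"] additive_uminus[of "\<lambda>x. z \<star> x"]
  by (simp_all add: prod_add_left prod_add_right sc_add_right)

lemmas expand = D_add E_add D_diff E_diff D_prod E_prod prod_add_left prod_add_right
  prod_diff_left prod_diff_right prod_uminus_left prod_uminus_right prod_assoc E_D

definition pbracket :: "'p \<Rightarrow> 'p \<Rightarrow> 'p" where
  "pbracket x y = E x \<star> D y - D x \<star> E y"

lemma pbracket_car [simp]: "x \<in> car \<Longrightarrow> y \<in> car \<Longrightarrow> pbracket x y \<in> car"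
  by (simp add: pbracket_def)

lemma hom_diff: "x \<in> hom i \<Longrightarrow> y \<in> hom i \<Longrightarrow> x - y \<in> hom i"
  using hom_add[OF _ hom_uminus, of x i y] by simp

lemma pbracket_hom: "x \<in> hom i \<Longrightarrow> y \<in> hom j \<Longrightarrow> pbracket x y \<in> hom (i + j)"
  by (simp add: pbracket_def hom_diff prod_hom D_hom E_hom)

lemma pbracket_commute:
  assumes "x \<in> hom i" "y \<in> hom j"
  shows "pbracket x y = - sg (i * j) (pbracket y x)"
  using prod_commute[OF E_hom[OF assms(1)] D_hom[OF assms(2)]] prod_commute[OF D_hom[OF assms(1)] E_hom[OF assms(2)]]
  by (simp add: pbracket_def sg_diff)

lemma prod_left_commute:
  assumes "x \<in> hom i" "y \<in> hom j" "z \<in> car"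
  shows "y \<star> (x \<star> z) = sg (i * j) (x \<star> (y \<star> z))"
proof -
  have "(y \<star> x) \<star> z = sg (i * j) ((x \<star> y) \<star> z)"
    using prod_commute[OF assms(2,1)] assms hom_car
    by (simp add: sg_def prod_uminus_left mult.commute)
  then show ?thesis using assms hom_car by (simp add: prod_assoc)
qed

lemma pbracket_prod:
  assumes "x \<in> hom i" "y \<in> hom j" "z \<in> car"
  shows "pbracket x (y \<star> z) = pbracket x y \<star> z + sg (i * j) (y \<star> pbracket x z)"
proof -
  have c: "x \<in> car" "y \<in> car" using assms hom_car by auto
  have "E x \<star> (y \<star> D z) = sg (i * j) (y \<star> (E x \<star> D z))"
    "D x \<star> (y \<star> E z) = sg (i * j) (y \<star> (D x \<star> E z))"
    using prod_left_commute[OF assms(2) E_hom[OF assms(1)], of "D z"]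
      prod_left_commute[OF assms(2) D_hom[OF assms(1)], of "E z"] assms(3) by (simp_all add: mult.commute)
  then show ?thesis using c assms(3) by (simp add: pbracket_def expand sg_diff algebra_simps)
qed

text \<open>
  The corrections from \<open>[E, D] = - D\<close> are \<open>D(x) D(y)\<close> in both products and cancel.
\<close>

lemma D_pbracket: "x \<in> car \<Longrightarrow> y \<in> car \<Longrightarrow> D (pbracket x y) = pbracket (D x) y + pbracket x (D y)"
  by (simp add: pbracket_def expand algebra_simps)

text \<open>
  The bracket is the wedge product of the derivations \<open>E\<close> and \<open>D\<close>, and a wedge product of two
  derivations that span a Lie algebra is a Poisson structure. Concretely, all terms are expanded
  and brought to the order \<open>a, b, c\<close>.
\<close>

lemma pbracket_jacobi:
  assumes a: "a \<in> hom i" and b: "b \<in> hom j" and c: "c \<in> car"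
  shows "pbracket a (pbracket b c) - sg (i * j) (pbracket b (pbracket a c)) = pbracket (pbracket a b) c"
proof -
  have ca: "a \<in> car" "b \<in> car" using a b hom_car by auto
  have s: "sg (i * j) (y \<star> (x \<star> z)) = x \<star> (y \<star> z)" if "x \<in> hom i" "y \<in> hom j" "z \<in> car" for x y z
    using prod_left_commute[OF that] by simp
  note h = D_hom E_hom a b
  show ?thesis
    by (simp add: pbracket_def expand ca c sg_diff sg_add s h)
qed

definition poisson :: "('k, 'p) bracket_superalgebra" where
  "poisson = \<lparr>carrier = car, mult = (\<star>), one = 0, zero = 0, add = (+), smult = sc, part = hom, bracket = pbracket\<rparr>"

lemma poisson_simps [simp]:
  "carrier poisson = car" "mult poisson = (\<star>)" "zero poisson = 0" "add poisson = (+)"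
  "smult poisson = sc" "part poisson = hom" "bracket poisson = pbracket"
  by (simp_all add: poisson_def)

lemma abelian_group_poisson: "abelian_group poisson"
  by (rule abelian_groupI) (auto simp: add.assoc add.commute intro: bexI[of _ "- x" for x])

lemma a_inv_poisson [simp]: "x \<in> car \<Longrightarrow> \<ominus>\<^bsub>poisson\<^esub> x = - x"
  by (rule abelian_group.minus_equality[OF abelian_group_poisson]) auto

lemma a_minus_poisson [simp]: "x \<in> car \<Longrightarrow> y \<in> car \<Longrightarrow> x \<ominus>\<^bsub>poisson\<^esub> y = x - y"
  by (simp add: a_minus_def)

lemma koszul_poisson [simp]: "x \<in> car \<Longrightarrow> koszul poisson i j x = sg (i * j) x"
  by (simp add: koszul_def sg_def)

lemma module_poisson: "module K poisson"
  by (rule moduleI) (auto simp: K abelian_group_poisson sc_add_left sc_add_right sc_mult sc_one)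

lemma superspace_poisson: "superspace K poisson"
  unfolding superspace_def
proof (intro conjI allI)
  show "module K poisson" by (rule module_poisson)
  show "submodule (part poisson i) K poisson" for i
    by (rule module.submoduleI[OF module_poisson]) (auto simp: hom_car hom_zero hom_add hom_uminus hom_sc)
  show "part poisson 0 \<inter> part poisson 1 = {\<zero>\<^bsub>poisson\<^esub>}"
    using hom_disjoint hom_zero by auto
  show "part poisson 0 <+>\<^bsub>poisson\<^esub> part poisson 1 = carrier poisson"
  proof
    show "part poisson 0 <+>\<^bsub>poisson\<^esub> part poisson 1 \<subseteq> carrier poisson"
      by (auto simp: set_add_def' hom_car)
    show "carrier poisson \<subseteq> part poisson 0 <+>\<^bsub>poisson\<^esub> part poisson 1"
      using car_decompose by (force simp: set_add_def')
  qed
qed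

lemma sg_car [simp]: "x \<in> car \<Longrightarrow> sg b x \<in> car" by (simp add: sg_def)

theorem poisson_superalgebra_poisson: "poisson_superalgebra K poisson"
  unfolding poisson_superalgebra_def graded_op_def bilinear_op_def
proof (intro conjI ballI allI)
  show "superspace K poisson" by (rule superspace_poisson)
  fix i j a b assume "a \<in> part poisson i" "b \<in> part poisson j"
  then show "a \<otimes>\<^bsub>poisson\<^esub> b = koszul poisson i j (b \<otimes>\<^bsub>poisson\<^esub> a)"
    "\<lbrace>a, b\<rbrace>\<^bsub>poisson\<^esub> = \<ominus>\<^bsub>poisson\<^esub> koszul poisson i j \<lbrace>b, a\<rbrace>\<^bsub>poisson\<^esub>"
    using prod_commute[of a i b j] pbracket_commute[of a i b j] hom_car by simp_all
next
  fix i j l a b c assume "a \<in> part poisson i" "b \<in> part poisson j" "c \<in> part poisson l"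
  then show "\<lbrace>a, \<lbrace>b, c\<rbrace>\<^bsub>poisson\<^esub>\<rbrace>\<^bsub>poisson\<^esub> \<ominus>\<^bsub>poisson\<^esub> koszul poisson i j \<lbrace>b, \<lbrace>a, c\<rbrace>\<^bsub>poisson\<^esub>\<rbrace>\<^bsub>poisson\<^esub> =
      \<lbrace>\<lbrace>a, b\<rbrace>\<^bsub>poisson\<^esub>, c\<rbrace>\<^bsub>poisson\<^esub>"
    "\<lbrace>a, b \<otimes>\<^bsub>poisson\<^esub> c\<rbrace>\<^bsub>poisson\<^esub> = \<lbrace>a, b\<rbrace>\<^bsub>poisson\<^esub> \<otimes>\<^bsub>poisson\<^esub> c \<oplus>\<^bsub>poisson\<^esub> koszul poisson i j (b \<otimes>\<^bsub>poisson\<^esub> \<lbrace>a, c\<rbrace>\<^bsub>poisson\<^esub>)"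
    using pbracket_jacobi[of a i b j c] pbracket_prod[of a i b j c] hom_car by simp_all
qed (auto simp: prod_hom pbracket_hom[unfolded pbracket_def] prod_assoc prod_sc_left prod_sc_right pbracket_def expand sc_diff D_sc E_sc algebra_simps)

theorem even_derivation_poisson: "even_derivation K poisson D"
  unfolding even_derivation_def even_linear_def
  by (auto simp: D_hom D_add D_sc D_prod D_pbracket)

lemma gelfand_dorfman:
  assumes a: "a \<in> hom i" and b: "b \<in> hom j" and c: "c \<in> hom l"
  shows "pbracket (a \<star> D b) c - a \<star> D (pbracket b c) + pbracket a b \<star> D c + sg (i * j) (pbracket b (a \<star> D c))
      - sg (j * l) (pbracket a c \<star> D b) = 0"
proof -
  have car: "a \<in> car" "b \<in> car" "c \<in> car" using a b c hom_car by auto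
  have s: "sg (i * j) (y \<star> (x \<star> z)) = x \<star> (y \<star> z)" if "x \<in> hom i" "y \<in> hom j" "z \<in> car" for x y z
    using prod_left_commute[OF that] by simp
  have t: "sg (j * l) (x \<star> (z \<star> y)) = x \<star> (y \<star> z)" if "x \<in> car" "y \<in> hom j" "z \<in> hom l" for x y z
    using prod_commute[OF that(2,3)] that hom_car by (simp add: sg_def prod_uminus_right)
  note h = D_hom E_hom a b c
  show ?thesis
    by (simp add: pbracket_def expand car sg_diff sg_add s t h)
qed

text \<open>
  The identities of a Gelfand--Dorfman superalgebra hold in the derived superalgebra and can be
  pulled back along an injective map. For supercommutators this replaces a direct
  verification.
\<close>

lemma gelfand_dorfman_pullback:
  fixes V :: "('k, 'v) bracket_superalgebra"
  assumes N: "novikov_superalgebra K V"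
    and brp: "\<And>i j x y. x \<in> part V i \<Longrightarrow> y \<in> part V j \<Longrightarrow> \<lbrace>x, y\<rbrace>\<^bsub>V\<^esub> \<in> part V (i + j)"
    and brc: "\<And>x y. x \<in> carrier V \<Longrightarrow> y \<in> carrier V \<Longrightarrow> \<lbrace>x, y\<rbrace>\<^bsub>V\<^esub> \<in> carrier V"
    and f: "even_linear K V poisson f" and inj: "inj_on f (carrier V)"
    and fm: "\<And>x y. x \<in> carrier V \<Longrightarrow> y \<in> carrier V \<Longrightarrow> f (x \<otimes>\<^bsub>V\<^esub> y) = f x \<star> D (f y)"
    and fb: "\<And>x y. x \<in> carrier V \<Longrightarrow> y \<in> carrier V \<Longrightarrow> f \<lbrace>x, y\<rbrace>\<^bsub>V\<^esub> = pbracket (f x) (f y)"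
  shows "gd_superalgebra K V" and "gd_embedding K V (derived_gd poisson D) f"
proof -
  have SV: "superspace K V" and gm: "graded_op K V (mult V)"
    using N by (auto simp: novikov_superalgebra_def)
  interpret V: module K V using SV by (simp add: superspace_def)
  note P = superspace_parts[OF SV]
  have fc [simp]: "f x \<in> car" if "x \<in> carrier V" for x using f that by (auto simp: even_linear_def)
  have fp: "f x \<in> hom i" if "x \<in> part V i" for x i using f that by (auto simp: even_linear_def image_subset_iff)
  have fa: "f (x \<oplus>\<^bsub>V\<^esub> y) = f x + f y" if "x \<in> carrier V" "y \<in> carrier V" for x y
    using f that by (auto simp: even_linear_def)
  have fs: "f (k \<odot>\<^bsub>V\<^esub> x) = sc k (f x)" if "k \<in> carrier K" "x \<in> carrier V" for k x
    using f that by (auto simp: even_linear_def)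
  have f0: "f \<zero>\<^bsub>V\<^esub> = 0" using fa[of "\<zero>\<^bsub>V\<^esub>" "\<zero>\<^bsub>V\<^esub>"] by simp
  have fn: "f (\<ominus>\<^bsub>V\<^esub> x) = - f x" if "x \<in> carrier V" for x
    using fa[of x "\<ominus>\<^bsub>V\<^esub> x"] f0 that by (simp add: V.M.r_neg eq_neg_iff_add_eq_0 add.commute)
  have fd: "f (x \<ominus>\<^bsub>V\<^esub> y) = f x - f y" if "x \<in> carrier V" "y \<in> carrier V" for x y
    using that by (simp add: a_minus_def fa fn)
  have fk: "f (koszul V i j x) = sg (i * j) (f x)" if "x \<in> carrier V" for x i j
    using that by (simp add: koszul_def fn sg_def)
  have kc: "koszul V i j x \<in> carrier V" if "x \<in> carrier V" for x i j
    using that by (simp add: koszul_def)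
  have mc: "x \<otimes>\<^bsub>V\<^esub> y \<in> carrier V" if "x \<in> carrier V" "y \<in> carrier V" for x y
    using gm that by (auto simp: graded_op_def bilinear_op_def)
  note cl = brc mc kc V.M.minus_closed V.M.a_closed V.M.a_inv_closed V.smult_closed
  note ops = fa fs fn fd fk fm fb
  have eqI: "x = y" if "f x = f y" "x \<in> carrier V" "y \<in> carrier V" for x y
    using inj_onD[OF inj] that by blast
  have "bilinear_op K V (bracket V)"
    unfolding bilinear_op_def
    by (intro conjI ballI eqI; simp add: cl ops; simp add: pbracket_def expand D_sc E_sc prod_sc_left prod_sc_right sc_diff)
  then have gb: "graded_op K V (bracket V)" using brp by (simp add: graded_op_def)
  have lie: "lie_superalgebra K V"
    unfolding lie_superalgebra_def
  proof (intro conjI SV gb allI ballI)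
    fix i j a b assume a: "a \<in> part V i" and b: "b \<in> part V j"
    show "\<lbrace>a, b\<rbrace>\<^bsub>V\<^esub> = \<ominus>\<^bsub>V\<^esub> koszul V i j \<lbrace>b, a\<rbrace>\<^bsub>V\<^esub>"
      using pbracket_commute[OF fp[OF a] fp[OF b]] P(2)[OF a] P(2)[OF b] by (intro eqI) (simp_all add: cl ops)
  next
    fix i j l a b c assume a: "a \<in> part V i" and b: "b \<in> part V j" and c: "c \<in> part V l"
    show "\<lbrace>a, \<lbrace>b, c\<rbrace>\<^bsub>V\<^esub>\<rbrace>\<^bsub>V\<^esub> \<ominus>\<^bsub>V\<^esub> koszul V i j \<lbrace>b, \<lbrace>a, c\<rbrace>\<^bsub>V\<^esub>\<rbrace>\<^bsub>V\<^esub> = \<lbrace>\<lbrace>a, b\<rbrace>\<^bsub>V\<^esub>, c\<rbrace>\<^bsub>V\<^esub>"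
      using pbracket_jacobi[OF fp[OF a] fp[OF b] hom_car[OF fp[OF c]]] P(2)[OF a] P(2)[OF b] P(2)[OF c]
      by (intro eqI) (simp_all add: cl ops)
  qed
  show "gd_superalgebra K V"
    unfolding gd_superalgebra_def
  proof (intro conjI N lie allI ballI)
    fix i j l a b c assume a: "a \<in> part V i" and b: "b \<in> part V j" and c: "c \<in> part V l"
    show "\<lbrace>a \<otimes>\<^bsub>V\<^esub> b, c\<rbrace>\<^bsub>V\<^esub> \<ominus>\<^bsub>V\<^esub> a \<otimes>\<^bsub>V\<^esub> \<lbrace>b, c\<rbrace>\<^bsub>V\<^esub> \<oplus>\<^bsub>V\<^esub> \<lbrace>a, b\<rbrace>\<^bsub>V\<^esub> \<otimes>\<^bsub>V\<^esub> c
          \<oplus>\<^bsub>V\<^esub> koszul V i j \<lbrace>b, a \<otimes>\<^bsub>V\<^esub> c\<rbrace>\<^bsub>V\<^esub> \<ominus>\<^bsub>V\<^esub> koszul V j l (\<lbrace>a, c\<rbrace>\<^bsub>V\<^esub> \<otimes>\<^bsub>V\<^esub> b) = \<zero>\<^bsub>V\<^esub>"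
      using gelfand_dorfman[OF fp[OF a] fp[OF b] fp[OF c]] P(2)[OF a] P(2)[OF b] P(2)[OF c]
      by (intro eqI) (simp_all add: cl ops f0)
  qed
  show "gd_embedding K V (derived_gd poisson D) f"
    using f inj fm fb by (auto simp: gd_embedding_def derived_gd_def even_linear_def)
qed

end

section \<open>Abelian groups as subgroups of a type\<close>

text \<open>
  The product of all abelian groups with elements of type \<open>'v\<close>. It belongs to the type class of
  abelian groups and contains each of them as a direct factor, so a computation in any one of
  them can be carried out at the level of types, without reference to its carrier. Indices that
  are not groups contribute one fixed value.
\<close>

typedef 'v group_product =
  "{f :: 'v ring \<Rightarrow> 'v. \<forall>S. if abelian_group S then f S \<in> carrier S else f S = undefined}"
proof
  show "(\<lambda>S. if abelian_group S then \<zero>\<^bsub>S\<^esub> else undefined) \<in>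
      {f :: 'v ring \<Rightarrow> 'v. \<forall>S. if abelian_group S then f S \<in> carrier S else f S = undefined}"
    by (auto intro: abelian_group.axioms(1) abelian_monoid.zero_closed)
qed

lemma Rep_closed: "abelian_group S \<Longrightarrow> Rep_group_product f S \<in> carrier S"
  using Rep_group_product[of f] by (auto split: if_splits)

lemma Rep_undefined: "\<not> abelian_group S \<Longrightarrow> Rep_group_product f S = undefined"
  using Rep_group_product[of f] by (auto split: if_splits)

definition product_family :: "('v ring \<Rightarrow> 'v) \<Rightarrow> 'v group_product" where
  "product_family F = Abs_group_product (\<lambda>S. if abelian_group S then F S else undefined)"

lemma Rep_product_family:
  assumes "\<And>S. abelian_group S \<Longrightarrow> F S \<in> carrier S" "abelian_group S"
  shows "Rep_group_product (product_family F) S = F S"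
  unfolding product_family_def using assms by (subst Abs_group_product_inverse) auto

lemma group_product_eqI:
  assumes "\<And>S. abelian_group S \<Longrightarrow> Rep_group_product f S = Rep_group_product g S"
  shows "f = g"
  unfolding Rep_group_product_inject[symmetric] using assms Rep_undefined by (metis ext)

instantiation group_product :: (type) ab_group_add
begin

definition "0 = product_family (\<lambda>S. \<zero>\<^bsub>S\<^esub>)"
definition "f + g = product_family (\<lambda>S. Rep_group_product f S \<oplus>\<^bsub>S\<^esub> Rep_group_product g S)"
definition "- f = product_family (\<lambda>S. \<ominus>\<^bsub>S\<^esub> Rep_group_product f S)"
definition "f - g = f + - g" for f g :: "'a group_product"

lemma Rep_ops:
  assumes S: "abelian_group S"
  shows "Rep_group_product 0 S = \<zero>\<^bsub>S\<^esub>"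
    and "Rep_group_product (f + g) S = Rep_group_product f S \<oplus>\<^bsub>S\<^esub> Rep_group_product g S"
    and "Rep_group_product (- f) S = \<ominus>\<^bsub>S\<^esub> Rep_group_product f S"
  unfolding zero_group_product_def plus_group_product_def uminus_group_product_def
  by (rule Rep_product_family[OF _ S]; simp add: Rep_closed abelian_groupE abelian_group.a_inv_closed abelian_groupE(1))+

instance
proof
  fix a b c :: "'a group_product"
  show "a + b + c = a + (b + c)"
    by (rule group_product_eqI) (simp add: Rep_ops Rep_closed abelian_groupE(3))
  show "a + b = b + a"
    by (rule group_product_eqI) (simp add: Rep_ops Rep_closed abelian_groupE(4))
  show "0 + a = a"
    by (rule group_product_eqI) (simp add: Rep_ops Rep_closed abelian_groupE(5))
  show "- a + a = 0"
    by (rule group_product_eqI) (simp add: Rep_ops Rep_closed abelian_group.l_neg)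
  show "a - b = a + - b" by (rule minus_group_product_def)
qed

end

text \<open>
  The index of the factor that belongs to \<open>V\<close>.
\<close>

definition factor :: "('v, 'm) ring_scheme \<Rightarrow> 'v ring" where
  "factor V = \<lparr>carrier = carrier V, mult = mult V, one = one V, zero = zero V, add = add V\<rparr>"

lemma abelian_group_factor: "abelian_group V \<Longrightarrow> abelian_group (factor V)"
proof -
  assume "abelian_group V"
  then interpret V: abelian_group V .
  show ?thesis
  proof (rule abelian_groupI)
    fix x assume "x \<in> carrier (factor V)"
    then have "\<ominus>\<^bsub>V\<^esub> x \<in> carrier V" "\<ominus>\<^bsub>V\<^esub> x \<oplus>\<^bsub>V\<^esub> x = \<zero>\<^bsub>V\<^esub>" by (simp_all add: factor_def V.l_neg)
    then show "\<exists>y\<in>carrier (factor V). y \<oplus>\<^bsub>factor V\<^esub> x = \<zero>\<^bsub>factor V\<^esub>" by (auto simp: factor_def)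
  qed (simp_all add: factor_def V.a_ac)
qed

definition factor_proj :: "('v, 'm) ring_scheme \<Rightarrow> 'v group_product \<Rightarrow> 'v" where
  "factor_proj V f = Rep_group_product f (factor V)"

definition factor_inj :: "('v, 'm) ring_scheme \<Rightarrow> 'v \<Rightarrow> 'v group_product" where
  "factor_inj V x = product_family (\<lambda>S. if S = factor V then x else \<zero>\<^bsub>S\<^esub>)"

lemma factor_proj_factor_inj:
  assumes V: "abelian_group V" and x: "x \<in> carrier V"
  shows "factor_proj V (factor_inj V x) = x"
proof -
  have "Rep_group_product (factor_inj V x) (factor V) = (if factor V = factor V then x else \<zero>\<^bsub>factor V\<^esub>)"
    unfolding factor_inj_def
    by (rule Rep_product_family[OF _ abelian_group_factor[OF V]])
       (auto simp: x factor_def intro: abelian_groupE(2))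
  then show ?thesis by (simp add: factor_proj_def)
qed

lemma factor_proj_closed: "abelian_group V \<Longrightarrow> factor_proj V f \<in> carrier V"
  using Rep_closed[OF abelian_group_factor, of V f] by (simp add: factor_proj_def factor_def)

lemma factor_proj_add: "abelian_group V \<Longrightarrow> factor_proj V (f + g) = factor_proj V f \<oplus>\<^bsub>V\<^esub> factor_proj V g"
  unfolding factor_proj_def by (simp add: Rep_ops(2)[OF abelian_group_factor]) (simp add: factor_def)

lemma factor_inj_add:
  assumes V: "abelian_group V" and xy: "x \<in> carrier V" "y \<in> carrier V"
  shows "factor_inj V (x \<oplus>\<^bsub>V\<^esub> y) = factor_inj V x + factor_inj V y"
proof (rule group_product_eqI)
  fix S :: "'a ring" assume S: "abelian_group S"
  have R: "Rep_group_product (factor_inj V z) S = (if S = factor V then z else \<zero>\<^bsub>S\<^esub>)" if "z \<in> carrier V" for z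
    unfolding factor_inj_def
    by (rule Rep_product_family[OF _ S]) (auto simp: that factor_def intro: abelian_groupE(2))
  have "x \<oplus>\<^bsub>V\<^esub> y \<in> carrier V" using abelian_groupE(1)[OF V] xy by blast
  then show "Rep_group_product (factor_inj V (x \<oplus>\<^bsub>V\<^esub> y)) S = Rep_group_product (factor_inj V x + factor_inj V y) S"
    using xy abelian_groupE(5)[OF S abelian_groupE(2)[OF S]]
    unfolding Rep_ops(2)[OF S] by (simp add: R) (simp add: factor_def)
qed

section \<open>The supercommutator of a superalgebra\<close>

lemma commutator_gd_simps [simp]:
  "carrier (commutator_gd V) = carrier V" "mult (commutator_gd V) = mult V"
  "zero (commutator_gd V) = zero V" "add (commutator_gd V) = add V" "smult (commutator_gd V) = smult V"
  "part (commutator_gd V) = part V" "bracket (commutator_gd V) = supercommutator V"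
  by (simp_all add: commutator_gd_def)

lemma a_inv_commutator_gd [simp]: "a_inv (commutator_gd V) x = a_inv V x"
  by (simp add: a_inv_def m_inv_def)

lemma koszul_commutator_gd [simp]: "koszul (commutator_gd V) i j x = koszul V i j x"
  by (simp add: koszul_def)

lemma superspace_commutator_gd:
  assumes "superspace K V"
  shows "superspace K (commutator_gd V)"
proof -
  interpret V: module K V using assms by (simp add: superspace_def)
  have ab: "abelian_group (commutator_gd V)"
  proof (rule abelian_groupI)
    fix x assume "x \<in> carrier (commutator_gd V)"
    then have "\<ominus>\<^bsub>V\<^esub> x \<in> carrier V" "\<ominus>\<^bsub>V\<^esub> x \<oplus>\<^bsub>V\<^esub> x = \<zero>\<^bsub>V\<^esub>" by (simp_all add: V.M.l_neg)
    then show "\<exists>y\<in>carrier (commutator_gd V). y \<oplus>\<^bsub>commutator_gd V\<^esub> x = \<zero>\<^bsub>commutator_gd V\<^esub>" by auto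
  qed (simp_all add: V.M.a_ac)
  have m: "module K (commutator_gd V)"
    by (rule moduleI)
       (auto simp: ab V.R.cring_axioms V.is_cring V.smult_l_distr V.smult_r_distr V.smult_assoc1)
  note P = superspace_parts[OF assms]
  have "submodule (part (commutator_gd V) i) K (commutator_gd V)" for i
    by (rule module.submoduleI[OF m]) (use P in auto)
  then show ?thesis
    using assms m by (simp add: superspace_def set_add_def')
qed

lemma novikov_commutator_gd:
  assumes "novikov_superalgebra K V"
  shows "novikov_superalgebra K (commutator_gd V)"
  using assms superspace_commutator_gd[of K V]
  unfolding novikov_superalgebra_def graded_op_def bilinear_op_def a_minus_def
    commutator_gd_simps a_inv_commutator_gd koszul_commutator_gd
  by blast

text \<open>
  The embedding is defined through homogeneous components and inherits its additivity from them.
\<close>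

lemma component_add:
  assumes V: "superspace K V" and "a \<in> carrier V" "b \<in> carrier V"
  shows "component V i (a \<oplus>\<^bsub>V\<^esub> b) = component V i a \<oplus>\<^bsub>V\<^esub> component V i b"
proof -
  interpret abelian_group V by (rule superspace_parts(1)[OF V])
  note P = superspace_parts[OF V]
  obtain x y u v where *: "x \<in> part V i" "y \<in> part V (i + 1)" "a = x \<oplus>\<^bsub>V\<^esub> y"
    "u \<in> part V i" "v \<in> part V (i + 1)" "b = u \<oplus>\<^bsub>V\<^esub> v"
    using P(8)[OF assms(2), of i] P(8)[OF assms(3), of i] by blast
  have "a \<oplus>\<^bsub>V\<^esub> b = (x \<oplus>\<^bsub>V\<^esub> u) \<oplus>\<^bsub>V\<^esub> (y \<oplus>\<^bsub>V\<^esub> v)"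
    using * P(2) by (simp add: a_ac)
  then have "component V i (a \<oplus>\<^bsub>V\<^esub> b) = x \<oplus>\<^bsub>V\<^esub> u"
    using * P(4) by (intro component_eqI[OF V, where y = "y \<oplus>\<^bsub>V\<^esub> v"]) auto
  then show ?thesis using component_eqI[OF V *(1,2,3)] component_eqI[OF V *(4,5,6)] by simp
qed

lemma component_smult:
  assumes V: "superspace K V" and "k \<in> carrier K" "a \<in> carrier V"
  shows "component V i (k \<odot>\<^bsub>V\<^esub> a) = k \<odot>\<^bsub>V\<^esub> component V i a"
proof -
  interpret module K V using V by (simp add: superspace_def)
  note P = superspace_parts[OF V]
  obtain x y where *: "x \<in> part V i" "y \<in> part V (i + 1)" "a = x \<oplus>\<^bsub>V\<^esub> y"
    using P(8)[OF assms(3), of i] by blast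
  have "k \<odot>\<^bsub>V\<^esub> a = (k \<odot>\<^bsub>V\<^esub> x) \<oplus>\<^bsub>V\<^esub> (k \<odot>\<^bsub>V\<^esub> y)"
    using * P(2) assms(2) by (simp add: smult_r_distr)
  then have "component V i (k \<odot>\<^bsub>V\<^esub> a) = k \<odot>\<^bsub>V\<^esub> x"
    using * P(6)[OF assms(2)] by (intro component_eqI[OF V, where y = "k \<odot>\<^bsub>V\<^esub> y"]) auto
  then show ?thesis using component_eqI[OF V *] by simp
qed

lemma supercommutator_closed:
  assumes V: "superspace K V" and g: "graded_op K V (mult V)"
  shows "a \<in> carrier V \<Longrightarrow> b \<in> carrier V \<Longrightarrow> supercommutator V a b \<in> carrier V"
    and "a \<in> part V i \<Longrightarrow> b \<in> part V j \<Longrightarrow> supercommutator V a b \<in> part V (i + j)"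
proof -
  interpret abelian_group V by (rule superspace_parts(1)[OF V])
  note P = superspace_parts[OF V]
  have h: "hom_commutator V i j x y \<in> part V (i + j)" if "x \<in> part V i" "y \<in> part V j" for x y i j
  proof -
    have "x \<otimes>\<^bsub>V\<^esub> y \<in> part V (i + j)" "y \<otimes>\<^bsub>V\<^esub> x \<in> part V (i + j)"
      using g that add.commute[of j i] unfolding graded_op_def by metis+
    moreover from this(2) have "koszul V i j (y \<otimes>\<^bsub>V\<^esub> x) \<in> part V (i + j)"
      using P(5) unfolding koszul_def by auto
    ultimately show ?thesis unfolding hom_commutator_def a_minus_def by (intro P(4,5))
  qed
  show "supercommutator V a b \<in> carrier V" if "a \<in> carrier V" "b \<in> carrier V"
    unfolding supercommutator_def
    by (intro a_closed P(2)[OF h] component_part[OF V] that)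
  show "supercommutator V a b \<in> part V (i + j)" if "a \<in> part V i" "b \<in> part V j"
    using h[OF that] supercommutator_homogeneous[OF V g that] by (simp add: hom_commutator_def)
qed

section \<open>Speciality\<close>

text \<open>
  \<open>V\<close> is copied into the type \<open>group_product\<close> by \<open>\<iota>\<close>, with projection \<open>\<pi>\<close> back to \<open>V\<close>. The copy is an
  instance of the locale \<open>novikov\<close>, and its evaluation functionals are one of
  \<open>differential_superalgebra\<close>. The embedding \<open>f\<close> sends \<open>v\<close> to the sum of the generators for its even
  and odd components.
\<close>

theorem theorem2:
  fixes K :: "('k, 'c) ring_scheme" and V :: "('k, 'v) superalgebra"
  assumes "field K" and "zero_characteristic K"
    and "novikov_superalgebra K V"
  shows "special K (commutator_gd V)"
proof -
  note novikov = assms(3)[unfolded novikov_superalgebra_def]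
  have SV: "superspace K V" by (rule conjunct1[OF novikov])
  have gV: "graded_op K V (mult V)" by (rule conjunct1[OF conjunct2[OF novikov]])
  interpret V: module K V using SV by (simp add: superspace_def)
  note P = superspace_parts[OF SV]
  note ab = P(1)
  define \<pi> where "\<pi> = factor_proj V"
  define \<iota> where "\<iota> = factor_inj V"
  have \<pi>c [simp]: "\<pi> f \<in> carrier V" for f unfolding \<pi>_def by (rule factor_proj_closed[OF ab])
  have \<pi>\<iota> [simp]: "\<pi> (\<iota> x) = x" if "x \<in> carrier V" for x
    unfolding \<pi>_def \<iota>_def by (rule factor_proj_factor_inj[OF ab that])
  have \<pi>a: "\<pi> (f + g) = \<pi> f \<oplus>\<^bsub>V\<^esub> \<pi> g" for f g unfolding \<pi>_def by (rule factor_proj_add[OF ab])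
  have \<iota>a: "\<iota> (x \<oplus>\<^bsub>V\<^esub> y) = \<iota> x + \<iota> y" if "x \<in> carrier V" "y \<in> carrier V" for x y
    unfolding \<iota>_def by (rule factor_inj_add[OF ab that])
  have \<iota>0 [simp]: "\<iota> \<zero>\<^bsub>V\<^esub> = 0" using \<iota>a[of "\<zero>\<^bsub>V\<^esub>" "\<zero>\<^bsub>V\<^esub>"] by simp
  have \<iota>n: "\<iota> (\<ominus>\<^bsub>V\<^esub> x) = - \<iota> x" if "x \<in> carrier V" for x
  proof -
    have "\<iota> (\<ominus>\<^bsub>V\<^esub> x) + \<iota> x = \<iota> (\<ominus>\<^bsub>V\<^esub> x \<oplus>\<^bsub>V\<^esub> x)" by (rule \<iota>a[symmetric]) (use that in auto)
    also have "\<dots> = 0" using that by (simp only: V.M.l_neg \<iota>0)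
    finally show ?thesis by (simp only: eq_neg_iff_add_eq_0)
  qed
  have \<iota>d: "\<iota> (x \<ominus>\<^bsub>V\<^esub> y) = \<iota> x - \<iota> y" if "x \<in> carrier V" "y \<in> carrier V" for x y
    using that by (simp add: a_minus_def \<iota>a \<iota>n)
  have \<iota>k: "\<iota> (koszul V i j x) = sg (i * j) (\<iota> x)" if "x \<in> carrier V" for x i j
    using that by (simp add: koszul_def \<iota>n sg_def)
  \<comment> \<open>the structure of \<open>V\<close>, extended to the whole type by projecting first\<close>
  define m where "m f g = \<iota> (\<pi> f \<otimes>\<^bsub>V\<^esub> \<pi> g)" for f g
  define sm where "sm k f = \<iota> (k \<odot>\<^bsub>V\<^esub> \<pi> f)" for k f
  define p where "p i = \<iota> ` part V i" for i
  have mc [simp]: "x \<otimes>\<^bsub>V\<^esub> y \<in> carrier V" if "x \<in> carrier V" "y \<in> carrier V" for x y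
    using gV that by (auto simp: graded_op_def bilinear_op_def)
  have ma: "(x \<oplus>\<^bsub>V\<^esub> y) \<otimes>\<^bsub>V\<^esub> z = x \<otimes>\<^bsub>V\<^esub> z \<oplus>\<^bsub>V\<^esub> y \<otimes>\<^bsub>V\<^esub> z"
    "z \<otimes>\<^bsub>V\<^esub> (x \<oplus>\<^bsub>V\<^esub> y) = z \<otimes>\<^bsub>V\<^esub> x \<oplus>\<^bsub>V\<^esub> z \<otimes>\<^bsub>V\<^esub> y"
    if "x \<in> carrier V" "y \<in> carrier V" "z \<in> carrier V" for x y z
    using gV that by (auto simp: graded_op_def bilinear_op_def)
  have ms: "(k \<odot>\<^bsub>V\<^esub> x) \<otimes>\<^bsub>V\<^esub> y = k \<odot>\<^bsub>V\<^esub> (x \<otimes>\<^bsub>V\<^esub> y)" "x \<otimes>\<^bsub>V\<^esub> (k \<odot>\<^bsub>V\<^esub> y) = k \<odot>\<^bsub>V\<^esub> (x \<otimes>\<^bsub>V\<^esub> y)"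
    if "k \<in> carrier K" "x \<in> carrier V" "y \<in> carrier V" for k x y
    using gV that by (auto simp: graded_op_def bilinear_op_def)
  have mp: "x \<otimes>\<^bsub>V\<^esub> y \<in> part V (i + j)" if "x \<in> part V i" "y \<in> part V j" for x y i j
    using gV that by (auto simp: graded_op_def)
  note pc = P(2)
  have ls: "a \<otimes>\<^bsub>V\<^esub> b \<otimes>\<^bsub>V\<^esub> c \<ominus>\<^bsub>V\<^esub> a \<otimes>\<^bsub>V\<^esub> (b \<otimes>\<^bsub>V\<^esub> c) =
      koszul V i j (b \<otimes>\<^bsub>V\<^esub> a \<otimes>\<^bsub>V\<^esub> c \<ominus>\<^bsub>V\<^esub> b \<otimes>\<^bsub>V\<^esub> (a \<otimes>\<^bsub>V\<^esub> c))"
    and rc: "a \<otimes>\<^bsub>V\<^esub> b \<otimes>\<^bsub>V\<^esub> c = koszul V j l (a \<otimes>\<^bsub>V\<^esub> c \<otimes>\<^bsub>V\<^esub> b)"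
    if "a \<in> part V i" "b \<in> part V j" "c \<in> part V l" for a b c i j l
    using conjunct2[OF conjunct2[OF novikov], rule_format, OF that] by (rule conjunct1, rule conjunct2)
  interpret N: novikov m p "sm ` carrier K"
  proof
    fix a b c i j l assume "a \<in> p i" "b \<in> p j" "c \<in> p l"
    then obtain x y z where xyz: "a = \<iota> x" "b = \<iota> y" "c = \<iota> z" "x \<in> part V i" "y \<in> part V j" "z \<in> part V l"
      by (auto simp: p_def)
    have c: "x \<in> carrier V" "y \<in> carrier V" "z \<in> carrier V" using xyz P(2) by auto
    show "m (m a b) c = sg (j * l) (m (m a c) b)"
      using arg_cong[OF rc[OF xyz(4-6)], of \<iota>] c by (simp add: m_def xyz(1-3) \<iota>k)
    have "- (\<iota> (x \<otimes>\<^bsub>V\<^esub> y \<otimes>\<^bsub>V\<^esub> z) - \<iota> (x \<otimes>\<^bsub>V\<^esub> (y \<otimes>\<^bsub>V\<^esub> z))) =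
        - sg (i * j) (\<iota> (y \<otimes>\<^bsub>V\<^esub> x \<otimes>\<^bsub>V\<^esub> z) - \<iota> (y \<otimes>\<^bsub>V\<^esub> (x \<otimes>\<^bsub>V\<^esub> z)))"
      using arg_cong[OF ls[OF xyz(4-6)], of \<iota>] c by (simp add: \<iota>k \<iota>d)
    then show "m a (m b c) - m (m a b) c = sg (i * j) (m b (m a c) - m (m b a) c)"
      using c by (simp add: m_def xyz(1-3) sg_diff)
  next
    fix x i y j assume "x \<in> p i" "y \<in> p j"
    then obtain u v where uv: "x = \<iota> u" "y = \<iota> v" "u \<in> part V i" "v \<in> part V j" by (auto simp: p_def)
    then have "m x y = \<iota> (u \<otimes>\<^bsub>V\<^esub> v)" by (simp add: m_def pc)
    then show "m x y \<in> p (i + j)" using mp[OF uv(3,4)] by (simp add: p_def)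
  next
    fix x i y assume "x \<in> p i" "y \<in> p i"
    then obtain u v where uv: "x = \<iota> u" "y = \<iota> v" "u \<in> part V i" "v \<in> part V i" by (auto simp: p_def)
    then have "x + y = \<iota> (u \<oplus>\<^bsub>V\<^esub> v)" by (simp add: \<iota>a pc)
    then show "x + y \<in> p i" using P(4)[OF uv(3,4)] by (simp add: p_def)
  next
    fix x i assume "x \<in> p i"
    then obtain u where u: "x = \<iota> u" "u \<in> part V i" by (auto simp: p_def)
    then have "- x = \<iota> (\<ominus>\<^bsub>V\<^esub> u)" by (simp add: \<iota>n pc)
    then show "- x \<in> p i" using P(5)[OF u(2)] by (simp add: p_def)
  next
    fix \<phi> x i assume "\<phi> \<in> sm ` carrier K" "x \<in> p i"
    then obtain k u where u: "\<phi> = sm k" "k \<in> carrier K" "x = \<iota> u" "u \<in> part V i" by (auto simp: p_def)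
    then have "\<phi> x = \<iota> (k \<odot>\<^bsub>V\<^esub> u)" by (simp add: sm_def pc)
    then show "\<phi> x \<in> p i" using P(6)[OF u(2,4)] by (simp add: p_def)
  next
    fix i show "0 \<in> p i" using imageI[OF P(3), of \<iota> i] by (simp add: p_def)
  qed (auto simp: m_def sm_def \<pi>a \<iota>a ma ms V.smult_r_distr)
  have total: "\<iota> (\<pi> x) = x" if x: "x \<in> N.total" for x
  proof -
    obtain y z where "x = \<iota> y + \<iota> z" "y \<in> part V 0" "z \<in> part V 1" using x by (auto simp: N.total_def p_def)
    then show ?thesis by (simp add: \<pi>a \<iota>a pc)
  qed
  have sc: "\<xi> \<in> N.span I \<Longrightarrow> \<iota> (\<pi> (\<xi> h)) = \<xi> h" for \<xi> I h
    by (rule total[OF N.span_total])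
  let ?sc = "\<lambda>k \<xi> h. sm k (\<xi> h)"
  have sub: "\<xi> \<in> N.span {i} \<Longrightarrow> \<xi> \<in> N.span UNIV" for \<xi> i by (erule N.span_mono) simp
  have smS: "sm k \<in> sm ` carrier K" if "k \<in> carrier K" for k using that by simp
  interpret A: differential_superalgebra K "N.span UNIV" "\<lambda>i. N.span {i}" N.conv ?sc "N.dual ddx" "N.dual N.euler"
  proof
    show "\<xi> \<in> N.span {i} \<Longrightarrow> \<xi> \<in> N.span UNIV" for \<xi> i by (rule sub)
    show "0 \<in> N.span {i}" for i by (rule N.span_zero)
    show "\<xi> \<in> N.span {0} \<Longrightarrow> \<xi> \<in> N.span {1} \<Longrightarrow> \<xi> = 0" for \<xi> by (rule N.span_disjoint)
    show "\<xi> \<in> N.span UNIV \<Longrightarrow> \<exists>y\<in>N.span {0}. \<exists>z\<in>N.span {1}. \<xi> = y + z" for \<xi>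
      by (rule N.span_decompose)
    show "\<xi> \<in> N.span UNIV \<Longrightarrow> ?sc \<one>\<^bsub>K\<^esub> \<xi> = \<xi>" for \<xi> by (simp add: sm_def sc)
    show "\<xi> \<in> N.span {i} \<Longrightarrow> \<eta> \<in> N.span {j} \<Longrightarrow> N.conv \<xi> \<eta> \<in> N.span {i + j}" for \<xi> \<eta> i j
      by (erule N.conv_span) auto
    show "\<xi> \<in> N.span {i} \<Longrightarrow> \<eta> \<in> N.span {j} \<Longrightarrow> N.conv \<xi> \<eta> = sg (i * j) (N.conv \<eta> \<xi>)" for \<xi> \<eta> i j
      by (rule N.conv_commute)
    fix k l and \<xi> assume k: "k \<in> carrier K" and l: "l \<in> carrier K" and \<xi>: "\<xi> \<in> N.span UNIV"
    have "sm (k \<oplus>\<^bsub>K\<^esub> l) (\<xi> h) = sm k (\<xi> h) + sm l (\<xi> h)" for h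
      using k l by (simp add: sm_def V.smult_l_distr \<iota>a)
    then show "?sc (k \<oplus>\<^bsub>K\<^esub> l) \<xi> = ?sc k \<xi> + ?sc l \<xi>" by (simp only: N.functional_eta)
    show "?sc (k \<otimes>\<^bsub>K\<^esub> l) \<xi> = ?sc k (?sc l \<xi>)"
      using k l by (simp add: sm_def V.smult_assoc1)
  next
    fix k and \<xi> \<eta> assume k: "k \<in> carrier K" and \<xi>: "\<xi> \<in> N.span UNIV" and \<eta>: "\<eta> \<in> N.span UNIV"
    have "sm k ((\<xi> + \<eta>) h) = sm k (\<xi> h) + sm k (\<eta> h)" for h
      using N.scalar_add[OF smS[OF k]] by simp
    then show "?sc k (\<xi> + \<eta>) = ?sc k \<xi> + ?sc k \<eta>" by (simp only: N.functional_eta)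
    show "N.conv (?sc k \<xi>) \<eta> = ?sc k (N.conv \<xi> \<eta>)" by (rule N.conv_map(1)[OF smS[OF k] \<xi> \<eta>])
    show "N.conv \<xi> (?sc k \<eta>) = ?sc k (N.conv \<xi> \<eta>)" by (rule N.conv_map(2)[OF smS[OF k] \<xi> \<eta>])
  next
    fix k and \<xi> assume k: "k \<in> carrier K"
    show "\<xi> \<in> N.span UNIV \<Longrightarrow> ?sc k \<xi> \<in> N.span UNIV" by (rule N.span_map) (use smS[OF k] in simp)
    show "N.dual ddx (?sc k \<xi>) = ?sc k (N.dual ddx \<xi>)" by (rule N.dual_map[OF smS[OF k]])
    show "N.dual N.euler (?sc k \<xi>) = ?sc k (N.dual N.euler \<xi>)" by (rule N.dual_map[OF smS[OF k]])
    show "\<xi> \<in> N.span {i} \<Longrightarrow> ?sc k \<xi> \<in> N.span {i}" for i by (rule N.span_map) (use smS[OF k] in simp)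
  qed (simp_all add: N.span_add N.span_uminus N.conv_span N.conv_add_left N.conv_add_right[where I = UNIV and J = UNIV and J' = UNIV]
      N.conv_assoc[where I = UNIV] N.dual_add N.dual_ddx(1) N.dual_euler(1)
      N.dual_ddx(2)[where I = UNIV and J = UNIV] N.dual_euler(2)[where I = UNIV and J = UNIV] N.euler_ddx[where I = UNIV])
  define f where "f v = N.generator (0, \<iota> (component V 0 v)) + N.generator (1, \<iota> (component V 1 v))" for v
  have pI: "\<iota> x \<in> p i" if "x \<in> part V i" for x i using that by (simp add: p_def)
  have gp: "N.generator (i, \<iota> x) \<in> N.span {i}" if "x \<in> part V i" for x i
    using pI[OF that] by (intro N.generator_span) simp_all
  note cp = component_part[OF SV]
  have cc: "component V i v \<in> carrier V" if "v \<in> carrier V" for i v using pc[OF cp[OF that]] .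
  have fh: "f x = N.generator (i, \<iota> x)" if "x \<in> part V i" for x i
  proof -
    have "N.generator (j, 0) = 0" for j using N.generator_add[of 0 j 0] by simp
    then show ?thesis by (cases i) (simp_all add: f_def component_homogeneous[OF SV that])
  qed
  have fspan: "f x \<in> N.span {i}" if "x \<in> part V i" for x i
    unfolding fh[OF that] by (rule gp[OF that])
  have fcar: "f v \<in> N.span UNIV" if "v \<in> carrier V" for v
    unfolding f_def by (intro N.span_add sub[OF gp] cp that)
  have fa: "f (v \<oplus>\<^bsub>V\<^esub> w) = f v + f w" if "v \<in> carrier V" "w \<in> carrier V" for v w
  proof -
    have "N.generator (i, \<iota> (component V i (v \<oplus>\<^bsub>V\<^esub> w))) =
        N.generator (i, \<iota> (component V i v)) + N.generator (i, \<iota> (component V i w))" for i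
      using that by (simp only: component_add[OF SV] \<iota>a cc N.generator_add pI cp)
    then show ?thesis unfolding f_def by (simp only: ac_simps)
  qed
  have fs: "f (k \<odot>\<^bsub>V\<^esub> v) = ?sc k (f v)" if k: "k \<in> carrier K" and v: "v \<in> carrier V" for k v
  proof -
    have "N.generator (i, \<iota> (component V i (k \<odot>\<^bsub>V\<^esub> v))) = ?sc k (N.generator (i, \<iota> (component V i v)))" for i
    proof -
      have "\<iota> (component V i (k \<odot>\<^bsub>V\<^esub> v)) = sm k (\<iota> (component V i v))"
        using cc[OF v] by (simp add: component_smult[OF SV k v] sm_def)
      then show ?thesis using N.generator_scalar[OF smS[OF k] pI[OF cp[OF v]]] by simp
    qed
    then show ?thesis
      using A.sc_add_right[OF k sub[OF gp[OF cp[OF v]]] sub[OF gp[OF cp[OF v]]]] unfolding f_def by simp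
  qed
  have lin: "even_linear K (commutator_gd V) A.poisson f"
    unfolding even_linear_def by (auto simp: fcar fa fs fspan)
  have inj: "inj_on f (carrier V)"
  proof (rule inj_onI)
    fix v w assume v: "v \<in> carrier V" and w: "w \<in> carrier V" and eq: "f v = f w"
    have "f v N.word_value = \<iota> v" if v: "v \<in> carrier V" for v
    proof -
      have "f v N.word_value = \<iota> (component V 0 v) + \<iota> (component V 1 v)"
        unfolding f_def using pI[OF cp[OF v]] by (simp add: N.generator_word_value)
      also have "\<dots> = \<iota> (component V 0 v \<oplus>\<^bsub>V\<^esub> component V 1 v)"
        by (rule \<iota>a[OF cc[OF v] cc[OF v], symmetric])
      also have "\<dots> = \<iota> v" by (rule arg_cong[OF component_sum[OF SV v, symmetric]])
      finally show ?thesis .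
    qed
    note word_value = this
    have "\<iota> v = f v N.word_value" by (rule word_value[OF v, symmetric])
    also have "\<dots> = \<iota> w" unfolding eq by (rule word_value[OF w])
    finally have "\<pi> (\<iota> v) = \<pi> (\<iota> w)" by (rule arg_cong)
    then show "v = w" by (simp only: \<pi>\<iota>[OF v] \<pi>\<iota>[OF w])
  qed
  have fmh: "f (x \<otimes>\<^bsub>V\<^esub> y) = N.conv (f x) (N.dual ddx (f y))" if x: "x \<in> part V i" and y: "y \<in> part V j" for x y i j
  proof -
    have "f (x \<otimes>\<^bsub>V\<^esub> y) = N.generator (N.tmul (i, \<iota> x) (j, \<iota> y))"
      unfolding fh[OF mp[OF x y]] using pc[OF x] pc[OF y] by (simp add: N.tmul_def m_def)
    also have "\<dots> = N.conv (N.generator (i, \<iota> x)) (N.dual ddx (N.generator (j, \<iota> y)))"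
      by (rule N.generator_mul) (simp_all add: pI x y)
    finally show ?thesis by (simp only: fh[OF x] fh[OF y])
  qed
  have fsum: "f v = f (component V 0 v) + f (component V 1 v)" if v: "v \<in> carrier V" for v
    using arg_cong[OF component_sum[OF SV v], of f] fa[OF cc[OF v] cc[OF v]] by (rule trans)
  have fm: "f (v \<otimes>\<^bsub>V\<^esub> w) = N.conv (f v) (N.dual ddx (f w))" if v: "v \<in> carrier V" and w: "w \<in> carrier V" for v w
  proof -
    let ?v = "\<lambda>i. component V i v" and ?w = "\<lambda>i. component V i w"
    have "v \<otimes>\<^bsub>V\<^esub> w = (?v 0 \<oplus>\<^bsub>V\<^esub> ?v 1) \<otimes>\<^bsub>V\<^esub> (?w 0 \<oplus>\<^bsub>V\<^esub> ?w 1)"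
      by (simp only: component_sum[OF SV v, symmetric] component_sum[OF SV w, symmetric])
    also have "f \<dots> = N.conv (f (?v 0) + f (?v 1)) (N.dual ddx (f (?w 0) + f (?w 1)))"
      using cc[OF v] cc[OF w]
      by (simp only: ma fa mc V.M.a_closed fmh[OF cp[OF v] cp[OF w]] A.expand fcar A.car_add A.D_car)
    finally show ?thesis by (simp only: fsum[OF v, symmetric] fsum[OF w, symmetric])
  qed
  have Ef: "N.dual N.euler (f v) = f v" for v
    unfolding f_def N.dual_add N.euler_generator ..
  have fbh: "f (hom_commutator V i j x y) = A.pbracket (f x) (f y)" if x: "x \<in> part V i" and y: "y \<in> part V j" for x y i j
  proof -
    have "hom_commutator V i j x y = x \<otimes>\<^bsub>V\<^esub> y \<oplus>\<^bsub>V\<^esub> \<ominus>\<^bsub>V\<^esub> koszul V i j (y \<otimes>\<^bsub>V\<^esub> x)"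
      by (simp add: hom_commutator_def a_minus_def)
    moreover have "f (\<ominus>\<^bsub>V\<^esub> z) = - f z" if z: "z \<in> carrier V" for z
    proof -
      have "f \<zero>\<^bsub>V\<^esub> = 0" using fa[of "\<zero>\<^bsub>V\<^esub>" "\<zero>\<^bsub>V\<^esub>"] by simp
      moreover have "f (\<ominus>\<^bsub>V\<^esub> z) + f z = f (\<ominus>\<^bsub>V\<^esub> z \<oplus>\<^bsub>V\<^esub> z)" by (rule fa[symmetric]) (use z in auto)
      ultimately show ?thesis using z by (simp only: V.M.l_neg eq_neg_iff_add_eq_0)
    qed
    ultimately have "f (hom_commutator V i j x y) = f (x \<otimes>\<^bsub>V\<^esub> y) - sg (i * j) (f (y \<otimes>\<^bsub>V\<^esub> x))"
      using pc[OF x] pc[OF y] by (auto simp only: koszul_def sg_def fa mc V.M.a_inv_closed diff_conv_add_uminus split: if_split)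
    also have "\<dots> = N.conv (f x) (N.dual ddx (f y)) - sg (i * j) (N.conv (f y) (N.dual ddx (f x)))"
      by (simp only: fmh[OF x y] fmh[OF y x])
    also have "sg (i * j) (N.conv (f y) (N.dual ddx (f x))) = N.conv (N.dual ddx (f x)) (f y)"
      by (rule A.prod_commute[OF A.D_hom[OF fspan[OF x]] fspan[OF y], symmetric])
    finally show ?thesis by (simp only: A.pbracket_def Ef)
  qed
  have fb: "f (supercommutator V v w) = A.pbracket (f v) (f w)" if v: "v \<in> carrier V" and w: "w \<in> carrier V" for v w
  proof -
    let ?v = "\<lambda>i. component V i v" and ?w = "\<lambda>i. component V i w"
    have hc: "hom_commutator V i j (?v i) (?w j) \<in> carrier V" for i j
      using cc[OF v] cc[OF w] by (simp add: hom_commutator_def koszul_def)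
    have "f (supercommutator V v w) = A.pbracket (f (?v 0)) (f (?w 0)) + A.pbracket (f (?v 0)) (f (?w 1)) +
        A.pbracket (f (?v 1)) (f (?w 0)) + A.pbracket (f (?v 1)) (f (?w 1))"
      unfolding supercommutator_def by (simp only: fa hc V.M.a_closed fbh[OF cp[OF v] cp[OF w]])
    also have "\<dots> = A.pbracket (f (?v 0) + f (?v 1)) (f (?w 0) + f (?w 1))"
      using cc[OF v] cc[OF w]
      by (simp only: A.pbracket_def A.expand fcar A.car_add A.D_car A.E_car) (simp only: algebra_simps)
    finally show ?thesis by (simp only: fsum[OF v, symmetric] fsum[OF w, symmetric])
  qed
  have NV: "novikov_superalgebra K (commutator_gd V)" by (rule novikov_commutator_gd[OF assms(3)])
  note pullback = A.gelfand_dorfman_pullback[OF NV _ _ lin]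
  have gd: "gd_superalgebra K (commutator_gd V)"
    by (rule pullback(1)) (simp_all add: supercommutator_closed[OF SV gV] inj fm fb)
  have emb: "gd_embedding K (commutator_gd V) (derived_gd A.poisson (N.dual ddx)) f"
    by (rule pullback(2)) (simp_all add: supercommutator_closed[OF SV gV] inj fm fb)
  show ?thesis
    by (rule specialI[OF gd A.poisson_superalgebra_poisson A.even_derivation_poisson emb])
qed

end
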